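(* Every unit bivector in $\Lambda^2\mathbb R^6$ is $SO(6)$-conjugate to $$b_\lambda=\lambda_1e_{12}+\lambda_2e_{34}+\lambda_3e_{56},$$ with $$\lambda_1\ge\lambda_2\ge|\lambda_3|,\qquad\lambda_1^2+\lambda_2^2+\lambda_3^2=1.$$ The orbit space of $S(\Lambda^2\mathbb R^6)=S^{14}$ under $SO(6)$ is therefore a spherical triangle $\Delta$ (the set of such $\lambda$). The isotropy groups and orbits by open face of $\Delta$ are: - interior: stabilizer $T^3$, orbit $SO(6)/T^3$; - any open edge: stabilizer $U(2)\times SO(2)$, orbit $SO(6)/(U(2)\times SO(2))$; - vertex $\lambda_1=\lambda_2=\lambda_3$: stabilizer $U(3)$, orbit $SO(6)/U(3)\cong\mathbb{CP}^3$; - vertex $\lambda_1=\lambda_2=-\lambda_3$: stabilizer $U(3)$, orbit $SO(6)/U(3)\cong\mathbb{CP}^3$; - vertex $\lambda_2=\lambda_3=0$: stabilizer $SO(2)\times SO(4)$, orbit $\widetilde G_2(\mathbb R^6)$. The two $U(3)$ vertices are distinct $SO(6)$-orbits, distinguished by the sign of the Pfaffian.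
   Context: $(e_1,\dots,e_6)$ is the standard orthonormal basis of $\mathbb R^6$, $e_{ij}=e_i\wedge e_j$; $\Lambda^2\mathbb R^6$ has the inner product making $\{e_{ij}\}_{i<j}$ orthonormal and is identified with $\mathfrak{so}(6)$ with the adjoint action of $SO(6)$. $S(\cdot)$ is the unit sphere. $\widetilde G_2(\mathbb R^6)$ is the Grassmannian of oriented $2$-planes in $\mathbb R^6$. Stabilizers are described up to conjugacy/isomorphism as the standard subgroups of $SO(6)$. *)

theory Defs
  imports "HOL-Analysis.Analysis"
begin

section \<open>Bivectors and the action of the special orthogonal group\<close>

text \<open>
  Bivectors on R^6 are skew-symmetric matrices, u \<and> v being u v^T - v u^T. The numeral type 6 has the
  elements 1, ..., 5 and 6 = 0, so that axis 1 1, ..., axis 6 1 are the six standard basis vectors.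
\<close>

definition bivectors :: "(real^6^6) set" where
  "bivectors = {B. transpose B = - B}"

definition wedge :: "real^6 \<Rightarrow> real^6 \<Rightarrow> real^6^6" where
  "wedge u v = (\<chi> i j. u $ i * v $ j - v $ i * u $ j)"

definition e2 :: "6 \<Rightarrow> 6 \<Rightarrow> real^6^6" where
  "e2 i j = wedge (axis i 1) (axis j 1)"

text \<open>
  The inner product on matrices is the Frobenius one, in which the wedge of two orthonormal vectors
  has square norm 2.
\<close>

definition bivector_inner :: "real^6^6 \<Rightarrow> real^6^6 \<Rightarrow> real" where
  "bivector_inner A B = (A \<bullet> B) / 2"

lemma bivector_inner_wedge:
  "bivector_inner (wedge u v) (wedge x y) = (u \<bullet> x) * (v \<bullet> y) - (u \<bullet> y) * (v \<bullet> x)"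
proof -
  have "wedge u v \<bullet> wedge x y =
      (\<Sum>i\<in>UNIV. \<Sum>j\<in>UNIV. (u$i * x$i) * (v$j * y$j) + (v$i * y$i) * (u$j * x$j)
          - (u$i * y$i) * (v$j * x$j) - (v$i * x$i) * (u$j * y$j))"
    by (auto simp: inner_vec_def wedge_def algebra_simps intro!: sum.cong)
  also have "\<dots> = (u \<bullet> x) * (v \<bullet> y) + (v \<bullet> y) * (u \<bullet> x) - (u \<bullet> y) * (v \<bullet> x) - (v \<bullet> x) * (u \<bullet> y)"
    by (simp add: inner_vec_def sum.distrib sum_subtractf sum_product)
  finally show ?thesis
    by (simp add: bivector_inner_def algebra_simps)
qed

definition unit_bivectors :: "(real^6^6) set" where
  "unit_bivectors = {B \<in> bivectors. bivector_inner B B = 1}"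

definition SO :: "(real^'n^'n) set" where
  "SO = {A. rotation_matrix A}"

definition act :: "real^6^6 \<Rightarrow> real^6^6 \<Rightarrow> real^6^6" where
  "act g B = g ** B ** transpose g"

lemma act_wedge: "act g (wedge u v) = wedge (g *v u) (g *v v)"
proof -
  have "act g (wedge u v) $ i $ j = wedge (g *v u) (g *v v) $ i $ j" for i j
  proof -
    have "act g (wedge u v) $ i $ j =
        (\<Sum>k\<in>UNIV. \<Sum>n\<in>UNIV. (g$j$k * v$k) * (g$i$n * u$n)) -
        (\<Sum>k\<in>UNIV. \<Sum>n\<in>UNIV. (g$j$k * u$k) * (g$i$n * v$n))"
      by (simp add: act_def wedge_def matrix_matrix_mult_def transpose_def sum_distrib_right
          sum_distrib_left
          sum_subtractf[symmetric] algebra_simps)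
    also have "\<dots> = wedge (g *v u) (g *v v) $ i $ j"
      unfolding sum_product[symmetric]
      by (simp add: wedge_def matrix_vector_mult_def mult.commute)
    finally show ?thesis .
  qed
  then show ?thesis by (simp add: vec_eq_iff)
qed

definition orbit :: "real^6^6 \<Rightarrow> (real^6^6) set" where
  "orbit B = (\<lambda>g. act g B) ` SO"

definition stabilizer :: "real^6^6 \<Rightarrow> (real^6^6) set" where
  "stabilizer B = {g \<in> SO. act g B = B}"

definition conjugate_in_SO6 :: "(real^6^6) set \<Rightarrow> (real^6^6) set \<Rightarrow> bool" where
  "conjugate_in_SO6 K H \<longleftrightarrow> (\<exists>g\<in>SO. K = (\<lambda>h. g ** h ** transpose g) ` H)"

definition normal_form :: "real^3 \<Rightarrow> real^6^6" where
  "normal_form l = l$1 *\<^sub>R e2 1 2 + l$2 *\<^sub>R e2 3 4 + l$3 *\<^sub>R e2 5 6"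

definition Pfaffian :: "real^6^6 \<Rightarrow> real" where
  "Pfaffian A = (\<Sum>p | p permutes (UNIV :: 6 set).
      of_int (sign p) * (A $ p 1 $ p 2 * A $ p 3 $ p 4 * A $ p 5 $ p 6)) / (2 ^ 3 * fact 3)"


section \<open>The spherical triangle\<close>

definition Delta :: "(real^3) set" where
  "Delta = {l. l$1 \<ge> l$2 \<and> l$2 \<ge> \<bar>l$3\<bar> \<and> (l$1)\<^sup>2 + (l$2)\<^sup>2 + (l$3)\<^sup>2 = 1}"

text \<open>
  Spherical simplices are radial projections (sgn x = x / norm x) of flat ones; their open faces are
  the projections of the relatively open faces.
\<close>

definition spherical_triangle :: "(real^3) set \<Rightarrow> (real^3) set \<Rightarrow> bool" where
  "spherical_triangle V T \<longleftrightarrow>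
     card V = 3 \<and> V \<subseteq> sphere 0 1 \<and> independent V \<and> T = sgn ` (convex hull V)"

definition open_spherical_face :: "(real^3) set \<Rightarrow> (real^3) set" where
  "open_spherical_face W = sgn ` rel_interior (convex hull W)"


section \<open>Quotients\<close>

definition quotient_topology :: "'a topology \<Rightarrow> ('a \<Rightarrow> 'b) \<Rightarrow> 'b topology" where
  "quotient_topology X p =
     topology (\<lambda>U. U \<subseteq> p ` topspace X \<and> openin X {x \<in> topspace X. p x \<in> U})"

lemma openin_quotient_topology:
  "openin (quotient_topology X p) U \<longleftrightarrow>
     U \<subseteq> p ` topspace X \<and> openin X {x \<in> topspace X. p x \<in> U}"
proof -
  have "istopology (\<lambda>U. U \<subseteq> p ` topspace X \<and> openin X {x \<in> topspace X. p x \<in> U})"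
    (is "istopology ?P")
    unfolding istopology_def
  proof (intro conjI allI impI)
    fix S T assume S: "?P S" and T: "?P T"
    show "S \<inter> T \<subseteq> p ` topspace X" using S by blast
    have "{x \<in> topspace X. p x \<in> S \<inter> T} =
        {x \<in> topspace X. p x \<in> S} \<inter> {x \<in> topspace X. p x \<in> T}" by blast
    then show "openin X {x \<in> topspace X. p x \<in> S \<inter> T}"
      using S T by (simp only: openin_Int)
  next
    fix K assume K: "\<forall>S\<in>K. ?P S"
    show "\<Union>K \<subseteq> p ` topspace X" using K by blast
    have "{x \<in> topspace X. p x \<in> \<Union>K} = (\<Union>S\<in>K. {x \<in> topspace X. p x \<in> S})" by blast
    then show "openin X {x \<in> topspace X. p x \<in> \<Union>K}" using K by auto
  qed
  then show ?thesis by (simp add: quotient_topology_def)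
qed

lemma quotient_map_quotient_topology: "quotient_map X (quotient_topology X p) p"
proof -
  have "{x \<in> topspace X. p x \<in> p ` topspace X} = topspace X" by blast
  then have "openin (quotient_topology X p) (p ` topspace X)"
    by (simp add: openin_quotient_topology)
  then have "topspace (quotient_topology X p) = p ` topspace X"
    by (meson openin_quotient_topology openin_subset openin_topspace subset_antisym)
  then show ?thesis by (simp add: quotient_map_def openin_quotient_topology)
qed

text \<open>C^k on an open set U.\<close>

primrec Ck_on ::
  "nat \<Rightarrow> 'a::euclidean_space set \<Rightarrow> ('a \<Rightarrow> 'b::euclidean_space) \<Rightarrow> bool" where
  "Ck_on 0 U f \<longleftrightarrow> continuous_on U f"
| "Ck_on (Suc k) U f \<longleftrightarrow>
     f differentiable_on U \<and> (\<forall>v. Ck_on k U (\<lambda>x. frechet_derivative f (at x) v))"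

text \<open>C^\<infinity> on an arbitrary subset of a Euclidean space: local restriction of C^\<infinity> maps.\<close>

definition smooth_map :: "'a::euclidean_space set \<Rightarrow> ('a \<Rightarrow> 'b::euclidean_space) \<Rightarrow> bool" where
  "smooth_map M f \<longleftrightarrow>
     (\<forall>x\<in>M. \<exists>U h. open U \<and> x \<in> U \<and> (\<forall>k. Ck_on k U h) \<and> (\<forall>y\<in>M \<inter> U. h y = f y))"

text \<open>
  Let M and N be submanifolds of Euclidean spaces, p : M \<rightarrow> Q = p ` M a projection onto a quotient, and
  let Q carry the smooth structure that makes p a submersion. A map f out of Q is then smooth iff
  f \<circ> p is, and a map into Q is smooth iff it locally lifts smoothly to M. So f : Q \<rightarrow> N is a
  diffeomorphism iff the following holds.
\<close>

definition quotient_diffeomorphism ::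
  "'a::euclidean_space set \<Rightarrow> ('a \<Rightarrow> 'q) \<Rightarrow> 'b::euclidean_space set \<Rightarrow> ('q \<Rightarrow> 'b) \<Rightarrow> bool" where
  "quotient_diffeomorphism M p N f \<longleftrightarrow>
     bij_betw f (p ` M) N \<and>
     smooth_map M (f \<circ> p) \<and>
     (\<forall>y\<in>N. \<exists>V s. open V \<and> y \<in> V \<and> smooth_map (N \<inter> V) s \<and>
        (\<forall>w\<in>N \<inter> V. s w \<in> M \<and> f (p (s w)) = w))"

definition left_coset :: "(real^6^6) set \<Rightarrow> real^6^6 \<Rightarrow> (real^6^6) set" where
  "left_coset H g = (\<lambda>h. g ** h) ` H"

text \<open>N is SO(6)-equivariantly diffeomorphic to SO(6)/H.\<close>

definition homogeneous_diffeo :: "(real^6^6) set \<Rightarrow> (real^6^6) set \<Rightarrow> bool" where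
  "homogeneous_diffeo N H \<longleftrightarrow>
     (\<exists>f. quotient_diffeomorphism SO (left_coset H) N f \<and>
        (\<forall>g\<in>SO. \<forall>k\<in>SO. f (left_coset H (g ** k)) = act g (f (left_coset H k))))"

definition complex_line :: "complex^4 \<Rightarrow> (complex^4) set" where
  "complex_line z = range (\<lambda>c. c *s z)"

definition diffeo_CP3 :: "(real^6^6) set \<Rightarrow> bool" where
  "diffeo_CP3 N \<longleftrightarrow> (\<exists>f. quotient_diffeomorphism (- {0}) complex_line N f)"

text \<open>
  An oriented 2-plane is given by the set of its positively oriented ordered bases; the Grassmannian
  is the image of bases_2 under oriented_plane.
\<close>

definition bases_2 :: "((real^6) \<times> (real^6)) set" where
  "bases_2 = {(u, v). u \<noteq> v \<and> independent {u, v}}"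

definition oriented_plane :: "(real^6) \<times> (real^6) \<Rightarrow> ((real^6) \<times> (real^6)) set" where
  "oriented_plane = (\<lambda>(u, v).
     {(a *\<^sub>R u + b *\<^sub>R v, c *\<^sub>R u + d *\<^sub>R v) | a b c d. a * d - b * c > 0})"

definition diffeo_Gr2 :: "(real^6^6) set \<Rightarrow> bool" where
  "diffeo_Gr2 N \<longleftrightarrow>
     (\<exists>f. quotient_diffeomorphism bases_2 oriented_plane N f \<and>
        (\<forall>g\<in>SO. \<forall>(u, v)\<in>bases_2.
           f (oriented_plane (g *v u, g *v v)) = act g (f (oriented_plane (u, v)))))"


section \<open>The standard subgroups\<close>

definition unitary_group :: "(complex^'n^'n) set" where
  "unitary_group = {U. U ** (\<chi> i j. cnj (U $ j $ i)) = mat 1}"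

definition R2_R2_R2 :: "real^2 \<Rightarrow> real^2 \<Rightarrow> real^2 \<Rightarrow> real^6" where
  "R2_R2_R2 x y z = vector [x$1, x$2, y$1, y$2, z$1, z$2]"

definition R4_R2 :: "real^4 \<Rightarrow> real^2 \<Rightarrow> real^6" where
  "R4_R2 x y = vector [x$1, x$2, x$3, x$4, y$1, y$2]"

definition R2_R4 :: "real^2 \<Rightarrow> real^4 \<Rightarrow> real^6" where
  "R2_R4 x y = vector [x$1, x$2, y$1, y$2, y$3, y$4]"

definition real_of_C2 :: "complex^2 \<Rightarrow> real^4" where
  "real_of_C2 z = vector [Re (z$1), Im (z$1), Re (z$2), Im (z$2)]"

definition real_of_C3 :: "complex^3 \<Rightarrow> real^6" where
  "real_of_C3 z = vector [Re (z$1), Im (z$1), Re (z$2), Im (z$2), Re (z$3), Im (z$3)]"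

definition T3 :: "(real^6^6) set" where
  "T3 = {A. \<exists>P\<in>SO. \<exists>Q\<in>SO. \<exists>R\<in>SO. \<forall>x y z.
     A *v R2_R2_R2 x y z = R2_R2_R2 (P *v x) (Q *v y) (R *v z)}"

definition U2 :: "(real^4^4) set" where
  "U2 = {A. \<exists>U\<in>unitary_group. \<forall>z. A *v real_of_C2 z = real_of_C2 (U *v z)}"

definition U3 :: "(real^6^6) set" where
  "U3 = {A. \<exists>U\<in>unitary_group. \<forall>z. A *v real_of_C3 z = real_of_C3 (U *v z)}"

definition U2_SO2 :: "(real^6^6) set" where
  "U2_SO2 = {A. \<exists>P\<in>U2. \<exists>Q\<in>SO. \<forall>x y. A *v R4_R2 x y = R4_R2 (P *v x) (Q *v y)}"

definition SO2_SO4 :: "(real^6^6) set" where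
  "SO2_SO4 = {A. \<exists>P\<in>SO. \<exists>Q\<in>SO. \<forall>x y. A *v R2_R4 x y = R2_R4 (P *v x) (Q *v y)}"

end

theory Submission
  imports Defs
begin

text \<open>
  A bivector is brought to normal form by a variational argument. On a compact set of bivectors that is
  invariant under the products of two reflections, the linear functional \<open>M \<mapsto> M \<bullet> C\<close> has a maximum.
  If C is a normal form with decreasing positive parameters, then stationarity says that M commutes
  with C, so that M is a normal form as well, and comparing M with its Weyl conjugates puts the
  parameters of M in the chamber of C (\<open>invariant_compact_set_meets_chamber\<close>). For an orbit this is
  the existence of the normal form. Its parameters are recovered by the operator norm, the norm and
  the Pfaffian (\<open>Delta_unique\<close>), so the triangle maps bijectively to the orbit space; this map is
  closed because SO(6) is compact, hence it is a homeomorphism.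

  The Pfaffian is multiplied by det g under the action of a matrix g (\<open>Pfaffian_act\<close>). It separates the two
  vertices with stabilizer U(3), and it also controls orientations throughout: an orthogonal matrix that
  fixes a bivector with nonzero Pfaffian has determinant 1. So unitary maps belong to SO(6), and the
  stabilizers can be computed as centralizers, one block at a time (\<open>centralizer_block\<close>).

  The map induced by \<open>g \<mapsto> act g B\<close> on the cosets of the stabilizer is smooth and bijective onto the
  orbit; it is a diffeomorphism because it has smooth local sections (\<open>quotient_diffeomorphismI\<close>). A
  section near a normal form maps w to an orthonormal frame that follows the eigenspaces of \<open>w\<^sup>2\<close>, made
  by the Gram--Schmidt process (\<open>local_section_normal_form\<close>); equivariance carries it to the other
  points.

  The isomorphism of the orbits at the U(3) vertices with CP^3 is the twistor correspondence. The moment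
  map of the half-spin representation on C^4 is a quadratic map to bivectors, constant on lines up to
  scale, and reflections lift to Clifford multiplication (\<open>act_reflection_twistor\<close>). The rotations that
  preserve its image form a compact group that contains the products of two reflections, so the
  variational argument applies to this group in place of SO(6) and identifies the image with
  the orbit (\<open>twistors_orbit\<close>). The inverse is affine: the bivector determines the
  Hermitian projection to the line. For the remaining vertex, an oriented plane corresponds to the
  normalized wedge product of an oriented basis.
\<close>

section \<open>Smooth maps\<close>

lemma Ck_on_subset: "Ck_on k U f \<Longrightarrow> V \<subseteq> U \<Longrightarrow> Ck_on k V f"
  by (induction k arbitrary: f) (auto intro: continuous_on_subset differentiable_on_subset)

lemma Ck_on_cong:
  assumes "open U" "Ck_on k U f" "\<And>x. x \<in> U \<Longrightarrow> f x = g x"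
  shows "Ck_on k U g"
  using assms(2,3)
proof (induction k arbitrary: f g)
  case 0
  then show ?case by (auto cong: continuous_on_cong)
next
  case (Suc k)
  have g: "(g has_derivative frechet_derivative f (at x)) (at x)" if "x \<in> U" for x
  proof -
    have "f differentiable (at x)"
      using Suc.prems(1) that \<open>open U\<close> by (auto simp: differentiable_on_eq_differentiable_at)
    then have "(f has_derivative frechet_derivative f (at x)) (at x)"
      by (simp add: frechet_derivative_works)
    then show ?thesis
      using \<open>open U\<close> that Suc.prems(2) has_derivative_transform_within_open by blast
  qed
  have "g differentiable_on U"
    using g \<open>open U\<close> by (auto simp: differentiable_on_eq_differentiable_at differentiable_def)
  moreover have "Ck_on k U (\<lambda>x. frechet_derivative g (at x) v)" for v
  proof (rule Suc.IH)
    show "Ck_on k U (\<lambda>x. frechet_derivative f (at x) v)"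
      using Suc.prems(1) by simp
    show "frechet_derivative f (at x) v = frechet_derivative g (at x) v" if "x \<in> U" for x
      using frechet_derivative_at[OF g[OF that]] by (rule fun_cong)
  qed
  ultimately show ?case by simp
qed

lemma Ck_on_Suc_imp: "Ck_on (Suc k) U f \<Longrightarrow> Ck_on k U f"
  by (induction k arbitrary: f) (auto intro: differentiable_imp_continuous_on)

lemma Ck_on_SucI:
  assumes "open U" "\<And>x. x \<in> U \<Longrightarrow> (f has_derivative f' x) (at x)"
    and "\<And>v. Ck_on k U (\<lambda>x. f' x v)"
  shows "Ck_on (Suc k) U f"
proof -
  have "f differentiable_on U"
    using assms(1,2) by (auto simp: differentiable_on_eq_differentiable_at differentiable_def)
  moreover have "Ck_on k U (\<lambda>x. frechet_derivative f (at x) v)" for v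
  proof (rule Ck_on_cong[OF assms(1) assms(3)[of v]])
    show "f' x v = frechet_derivative f (at x) v" if "x \<in> U" for x
      using frechet_derivative_at[OF assms(2)[OF that]] by (rule fun_cong)
  qed
  ultimately show ?thesis by simp
qed

lemma Ck_on_Suc_has_derivative:
  assumes "open U" "Ck_on (Suc k) U f" "x \<in> U"
  shows "(f has_derivative frechet_derivative f (at x)) (at x)"
  using assms by (auto simp: differentiable_on_eq_differentiable_at frechet_derivative_works)

lemma Ck_on_imp_continuous_on: "Ck_on k U f \<Longrightarrow> continuous_on U f"
  by (cases k) (auto intro: differentiable_imp_continuous_on)

lemma Ck_on_const: "open U \<Longrightarrow> Ck_on k U (\<lambda>x. c)"
  by (induction k arbitrary: c) (auto intro: Ck_on_SucI derivative_eq_intros)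

lemma Ck_on_linear:
  assumes "open U" "bounded_linear f" shows "Ck_on k U f"
proof (cases k)
  case 0
  then show ?thesis using assms by (simp add: linear_continuous_on)
next
  case (Suc n)
  then show ?thesis
    using assms bounded_linear_imp_has_derivative
    by (auto intro!: Ck_on_SucI[where f' = "\<lambda>x. f"] Ck_on_const simp del: Ck_on.simps)
qed

lemma Ck_on_add:
  assumes "open U" shows "Ck_on k U f \<Longrightarrow> Ck_on k U g \<Longrightarrow> Ck_on k U (\<lambda>x. f x + g x)"
proof (induction k arbitrary: f g)
  case 0
  then show ?case by (auto intro: continuous_on_add)
next
  case (Suc k)
  note d = Ck_on_Suc_has_derivative[OF assms]
  show ?case
  proof (rule Ck_on_SucI[OF assms])
    show "((\<lambda>x. f x + g x) has_derivative
        (\<lambda>v. frechet_derivative f (at x) v + frechet_derivative g (at x) v)) (at x)" if "x \<in> U" for x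
      by (rule has_derivative_add[OF d[OF Suc.prems(1) that] d[OF Suc.prems(2) that]])
    show "Ck_on k U (\<lambda>x. frechet_derivative f (at x) v + frechet_derivative g (at x) v)" for v
      using Suc.prems by (intro Suc.IH) auto
  qed
qed

lemma Ck_on_sum:
  assumes "open U" "\<And>i. i \<in> I \<Longrightarrow> Ck_on k U (f i)"
  shows "Ck_on k U (\<lambda>x. \<Sum>i\<in>I. f i x)"
  using assms(2)
  by (induction I rule: infinite_finite_induct) (auto intro: Ck_on_add Ck_on_const assms(1))

text \<open>The product rule expresses the derivative of a product through products of one order less.\<close>

lemma Ck_on_bilinear:
  assumes "open U" "bounded_bilinear h"
  shows "Ck_on k U f \<Longrightarrow> Ck_on k U g \<Longrightarrow> Ck_on k U (\<lambda>x. h (f x) (g x))"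
proof (induction k arbitrary: f g)
  case 0
  then show ?case using bounded_bilinear.continuous_on[OF assms(2)] by simp
next
  case (Suc k)
  note d = Ck_on_Suc_has_derivative[OF assms(1)]
  show ?case
  proof (rule Ck_on_SucI[OF assms(1)])
    show "((\<lambda>x. h (f x) (g x)) has_derivative (\<lambda>v. h (f x) (frechet_derivative g (at x) v) +
        h (frechet_derivative f (at x) v) (g x))) (at x)" if "x \<in> U" for x
      by (rule bounded_bilinear.FDERIV[OF assms(2) d[OF Suc.prems(1) that] d[OF Suc.prems(2) that]])
  next
    fix v
    have "Ck_on k U f" "Ck_on k U g"
      using Suc.prems by (blast intro: Ck_on_Suc_imp)+
    then show "Ck_on k U (\<lambda>x. h (f x) (frechet_derivative g (at x) v) +
        h (frechet_derivative f (at x) v) (g x))"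
      using Suc.prems by (intro Ck_on_add[OF assms(1)] Suc.IH) auto
  qed
qed

text \<open>
  By the chain rule the derivative of a composition is bilinear in the two derivatives; an
  orthonormal basis turns it into a sum of products of functions of one order less.
\<close>

lemma Ck_on_compose:
  assumes "open U" "open V" "h ` U \<subseteq> V"
  shows "Ck_on k V f \<Longrightarrow> Ck_on k U h \<Longrightarrow> Ck_on k U (\<lambda>x. f (h x))"
proof (induction k arbitrary: f)
  case 0
  then show ?case using assms(3) by (auto intro: continuous_on_compose2)
next
  case (Suc k)
  have d: "(f has_derivative frechet_derivative f (at (h x))) (at (h x))" if "x \<in> U" for x
    using Ck_on_Suc_has_derivative[OF assms(2) Suc.prems(1)] that assms(3) by blast
  have eq: "(\<Sum>b\<in>Basis. (frechet_derivative h (at x) v \<bullet> b) *\<^sub>R frechet_derivative f (at (h x)) b) =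
      frechet_derivative f (at (h x)) (frechet_derivative h (at x) v)" if "x \<in> U" for x v
  proof -
    have L: "linear (frechet_derivative f (at (h x)))"
      using d[OF that] has_derivative_linear by blast
    have "frechet_derivative f (at (h x)) (\<Sum>b\<in>Basis. (frechet_derivative h (at x) v \<bullet> b) *\<^sub>R b) =
        (\<Sum>b\<in>Basis. (frechet_derivative h (at x) v \<bullet> b) *\<^sub>R frechet_derivative f (at (h x)) b)"
      by (simp add: linear_sum[OF L] linear_scale[OF L])
    then show ?thesis by (simp only: euclidean_representation)
  qed
  show ?case
  proof (rule Ck_on_SucI[OF assms(1)])
    fix x assume "x \<in> U"
    show "((\<lambda>x. f (h x)) has_derivative
        (\<lambda>v. frechet_derivative f (at (h x)) (frechet_derivative h (at x) v))) (at x)"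
      using has_derivative_compose[OF Ck_on_Suc_has_derivative[OF assms(1) Suc.prems(2) \<open>x \<in> U\<close>] d[OF \<open>x \<in> U\<close>]]
      by simp
  next
    fix v
    have "Ck_on k U (\<lambda>x. \<Sum>b\<in>Basis. (frechet_derivative h (at x) v \<bullet> b) *\<^sub>R
        frechet_derivative f (at (h x)) b)"
    proof (intro Ck_on_sum[OF assms(1)] Ck_on_bilinear[OF assms(1) bounded_bilinear_scaleR])
      fix b :: 'b
      show "Ck_on k U (\<lambda>x. frechet_derivative h (at x) v \<bullet> b)"
        using Suc.prems(2) by (intro Ck_on_bilinear[OF assms(1) bounded_bilinear_inner] Ck_on_const assms) auto
      show "Ck_on k U (\<lambda>x. frechet_derivative f (at (h x)) b)"
        using Suc.prems Ck_on_Suc_imp by (intro Suc.IH) auto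
    qed
    then show "Ck_on k U (\<lambda>x. frechet_derivative f (at (h x)) (frechet_derivative h (at x) v))"
      by (rule Ck_on_cong[OF assms(1)]) (simp add: eq)
  qed
qed

text \<open>
  The derivative is again a power up to a factor, so all exponents are treated at once.
\<close>

lemma Ck_on_powr: "Ck_on k {0<..} (\<lambda>t::real. t powr a)"
proof (induction k arbitrary: a)
  case 0
  then show ?case by (auto intro!: continuous_intros)
next
  case (Suc k)
  show ?case
  proof (rule Ck_on_SucI)
    fix t :: real assume "t \<in> {0<..}"
    then show "((\<lambda>t. t powr a) has_derivative (\<lambda>v. (a * v) * t powr (a - 1))) (at t)"
      by (auto intro!: derivative_eq_intros simp: powr_diff field_simps)
  next
    fix v
    show "Ck_on k {0<..} (\<lambda>t. (a * v) * t powr (a - 1))"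
      by (intro Ck_on_bilinear[OF _ bounded_bilinear_mult] Suc.IH Ck_on_const) auto
  qed auto
qed

text \<open>
  Smoothness of a germ. It composes without any bookkeeping of domains, and it yields both the
  smoothness of maps on subsets and the shrinking of domains needed for local sections.
\<close>

definition smooth_at :: "'a::euclidean_space \<Rightarrow> ('a \<Rightarrow> 'b::euclidean_space) \<Rightarrow> bool" where
  "smooth_at x f \<longleftrightarrow> (\<exists>U. open U \<and> x \<in> U \<and> (\<forall>k. Ck_on k U f))"

named_theorems smooth_intros

lemma smooth_map_if_smooth_at: "(\<And>x. x \<in> M \<Longrightarrow> smooth_at x f) \<Longrightarrow> smooth_map M f"
  unfolding smooth_map_def smooth_at_def by metis

lemma smooth_at_isCont: "smooth_at x f \<Longrightarrow> isCont f x"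
  unfolding smooth_at_def using Ck_on_imp_continuous_on continuous_on_eq_continuous_at by blast

lemma smooth_at_const [smooth_intros]: "smooth_at x (\<lambda>x. c)"
  unfolding smooth_at_def by (blast intro: Ck_on_const)

lemma smooth_at_linear: "linear f \<Longrightarrow> smooth_at x f"
  unfolding smooth_at_def
  by (metis Ck_on_linear UNIV_I linear_conv_bounded_linear open_UNIV)

lemma smooth_at_id [smooth_intros]: "smooth_at x (\<lambda>x. x)"
  by (rule smooth_at_linear) (simp add: linear_id[unfolded id_def])

lemma smooth_at_bilinear:
  assumes "bounded_bilinear h" "smooth_at x f" "smooth_at x g"
  shows "smooth_at x (\<lambda>x. h (f x) (g x))"
proof -
  obtain U V where "open U" "x \<in> U" "\<forall>k. Ck_on k U f" "open V" "x \<in> V" "\<forall>k. Ck_on k V g"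
    using assms(2,3) unfolding smooth_at_def by blast
  then have "open (U \<inter> V)" "x \<in> U \<inter> V" "\<forall>k. Ck_on k (U \<inter> V) f \<and> Ck_on k (U \<inter> V) g"
    by (auto intro: Ck_on_subset)
  then show ?thesis
    unfolding smooth_at_def using Ck_on_bilinear[OF _ assms(1)] by blast
qed

lemma smooth_at_compose:
  assumes "smooth_at (h x) f" "smooth_at x h"
  shows "smooth_at x (\<lambda>x. f (h x))"
proof -
  obtain U V where U: "open U" "x \<in> U" "\<forall>k. Ck_on k U h" and V: "open V" "h x \<in> V" "\<forall>k. Ck_on k V f"
    using assms unfolding smooth_at_def by blast
  let ?W = "U \<inter> h -` V"
  have "open ?W"
    using U(1) U(3)[rule_format, THEN Ck_on_imp_continuous_on] V(1) continuous_open_preimage by blast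
  moreover have "Ck_on k ?W (\<lambda>x. f (h x))" for k
  proof (rule Ck_on_compose[OF \<open>open ?W\<close> V(1)])
    show "h ` ?W \<subseteq> V" by blast
    show "Ck_on k V f" using V(3) by blast
    show "Ck_on k ?W h" using U(3) Ck_on_subset[of k U h ?W] by blast
  qed
  ultimately show ?thesis
    unfolding smooth_at_def using U(2) V(2) by blast
qed

lemma smooth_at_linear_compose: "linear f \<Longrightarrow> smooth_at x h \<Longrightarrow> smooth_at x (\<lambda>x. f (h x))"
  by (rule smooth_at_compose) (rule smooth_at_linear)

lemma smooth_at_add [smooth_intros]:
  assumes "smooth_at x f" "smooth_at x g" shows "smooth_at x (\<lambda>x. f x + g x)"
proof -
  obtain U V where "open U" "x \<in> U" "\<forall>k. Ck_on k U f" "open V" "x \<in> V" "\<forall>k. Ck_on k V g"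
    using assms unfolding smooth_at_def by blast
  then have "open (U \<inter> V)" "x \<in> U \<inter> V" "\<forall>k. Ck_on k (U \<inter> V) f \<and> Ck_on k (U \<inter> V) g"
    by (auto intro: Ck_on_subset)
  then show ?thesis unfolding smooth_at_def using Ck_on_add by blast
qed

lemma smooth_at_minus [smooth_intros]: "smooth_at x f \<Longrightarrow> smooth_at x (\<lambda>x. - f x)"
  by (rule smooth_at_linear_compose) (simp add: linear_iff)

lemma smooth_at_diff [smooth_intros]:
  "smooth_at x f \<Longrightarrow> smooth_at x g \<Longrightarrow> smooth_at x (\<lambda>x. f x - g x)"
  using smooth_at_add[of x f "\<lambda>x. - g x"] smooth_at_minus[of x g] by simp

lemma smooth_at_sum [smooth_intros]:
  "(\<And>i. i \<in> I \<Longrightarrow> smooth_at x (f i)) \<Longrightarrow> smooth_at x (\<lambda>x. \<Sum>i\<in>I. f i x)"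
  by (induction I rule: infinite_finite_induct) (auto intro: smooth_at_add smooth_at_const)

lemmas smooth_at_scaleR [smooth_intros] = smooth_at_bilinear[OF bounded_bilinear_scaleR]
lemmas smooth_at_inner [smooth_intros] = smooth_at_bilinear[OF bounded_bilinear_inner]

lemma smooth_at_mult [smooth_intros]:
  fixes f g :: "'a::euclidean_space \<Rightarrow> real"
  shows "smooth_at x f \<Longrightarrow> smooth_at x g \<Longrightarrow> smooth_at x (\<lambda>x. f x * g x)"
  by (rule smooth_at_bilinear[OF bounded_bilinear_mult])

lemma smooth_at_prod [smooth_intros]:
  fixes f :: "'i \<Rightarrow> 'a::euclidean_space \<Rightarrow> real"
  shows "(\<And>i. i \<in> I \<Longrightarrow> smooth_at x (f i)) \<Longrightarrow> smooth_at x (\<lambda>x. \<Prod>i\<in>I. f i x)"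
  by (induction I rule: infinite_finite_induct) (auto intro: smooth_at_mult smooth_at_const)

lemma smooth_at_powr [smooth_intros]:
  fixes f :: "'a::euclidean_space \<Rightarrow> real"
  assumes "smooth_at x f" "f x > 0" shows "smooth_at x (\<lambda>x. f x powr a)"
proof (rule smooth_at_compose[OF _ assms(1)])
  show "smooth_at (f x) (\<lambda>t. t powr a)"
    unfolding smooth_at_def using assms(2) Ck_on_powr
    by (metis greaterThan_iff open_greaterThan)
qed

lemma smooth_at_vec_nth [smooth_intros]:
  "smooth_at x f \<Longrightarrow> smooth_at x (\<lambda>x. f x $ i)"
  by (rule smooth_at_linear_compose) (simp_all add: linear_iff)

lemma smooth_at_vec_lambda [smooth_intros]:
  fixes f :: "'i::finite \<Rightarrow> 'a::euclidean_space \<Rightarrow> 'b::euclidean_space"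
  assumes "\<And>i. smooth_at x (f i)" shows "smooth_at x (\<lambda>x. \<chi> i. f i x)"
proof -
  have "linear (axis i :: 'b \<Rightarrow> 'b^'i)" for i
    by (auto simp: linear_iff axis_def vec_eq_iff)
  then have "smooth_at x (\<lambda>x. \<Sum>i\<in>UNIV. axis i (f i x))"
    using assms by (intro smooth_at_sum) (rule smooth_at_linear_compose)
  moreover have "(\<Sum>i\<in>UNIV. axis i (f i x)) = (\<chi> i. f i x)" for x
    by (simp add: vec_eq_iff axis_def if_distrib sum.delta cong: if_cong)
  ultimately show ?thesis by simp
qed

lemma smooth_at_Pair [smooth_intros]:
  fixes f :: "'a::euclidean_space \<Rightarrow> 'b::euclidean_space" and g :: "'a \<Rightarrow> 'c::euclidean_space"
  assumes "smooth_at x f" "smooth_at x g" shows "smooth_at x (\<lambda>x. (f x, g x))"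
proof -
  have "smooth_at x (\<lambda>x. (f x, 0) + (0, g x))"
    using assms by (intro smooth_at_add smooth_at_linear_compose[where f = "\<lambda>y. (y, 0)"]
        smooth_at_linear_compose[where f = "\<lambda>y. (0, y)"]) (simp_all add: linear_iff)
  then show ?thesis by simp
qed

lemma smooth_at_fst [smooth_intros]: "smooth_at x f \<Longrightarrow> smooth_at x (\<lambda>x. fst (f x))"
  and smooth_at_snd [smooth_intros]: "smooth_at x f \<Longrightarrow> smooth_at x (\<lambda>x. snd (f x))"
  by (rule smooth_at_linear_compose; simp add: linear_iff)+

lemma bounded_bilinear_matrix_mult: "bounded_bilinear ((**) :: real^'n^'m \<Rightarrow> real^'k^'n \<Rightarrow> real^'k^'m)"
  unfolding bilinear_conv_bounded_bilinear[symmetric] bilinear_def linear_iff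
  by (simp add: matrix_add_ldistrib matrix_matrix_mult_def vec_eq_iff sum.distrib algebra_simps
      sum_distrib_left)

lemma bounded_bilinear_matrix_vector_mult: "bounded_bilinear ((*v) :: real^'n^'m \<Rightarrow> real^'n \<Rightarrow> real^'m)"
  unfolding bilinear_conv_bounded_bilinear[symmetric] bilinear_def linear_iff
  by (simp add: matrix_vector_mult_def vec_eq_iff sum.distrib algebra_simps
      sum_distrib_left)

lemmas smooth_at_matrix_mult [smooth_intros] = smooth_at_bilinear[OF bounded_bilinear_matrix_mult]
lemmas smooth_at_matrix_vector_mult [smooth_intros] =
  smooth_at_bilinear[OF bounded_bilinear_matrix_vector_mult]

lemma smooth_at_transpose [smooth_intros]:
  "smooth_at x f \<Longrightarrow> smooth_at x (\<lambda>x. transpose (f x :: real^'n^'m))"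
  by (rule smooth_at_linear_compose) (simp_all add: linear_iff transpose_def vec_eq_iff)

lemma smooth_at_det:
  fixes f :: "'a::euclidean_space \<Rightarrow> real^'n^'n"
  shows "smooth_at x f \<Longrightarrow> smooth_at x (\<lambda>x. det (f x))"
  unfolding det_def by (intro smooth_intros)

lemma smooth_at_act [smooth_intros]:
  "smooth_at x f \<Longrightarrow> smooth_at x g \<Longrightarrow> smooth_at x (\<lambda>x. act (f x) (g x))"
  unfolding act_def by (intro smooth_intros)


section \<open>Diffeomorphisms out of a quotient\<close>

text \<open>
  The inverse of the induced bijection lifts through the sections. They are required in germ form, and
  only have to be right at the points of N, so that they may come from formulas on the ambient space.
\<close>

lemma quotient_diffeomorphismI:
  fixes F :: "'a::euclidean_space \<Rightarrow> 'b::euclidean_space"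
  assumes fibres: "\<And>x y. x \<in> M \<Longrightarrow> y \<in> M \<Longrightarrow> F x = F y \<longleftrightarrow> p x = p y"
    and image: "F ` M = N"
    and smooth: "\<And>x. x \<in> M \<Longrightarrow> smooth_at x F"
    and sections: "\<And>y. y \<in> N \<Longrightarrow> \<exists>s. smooth_at y s \<and>
      eventually (\<lambda>w. w \<in> N \<longrightarrow> s w \<in> M \<and> F (s w) = w) (nhds y)"
  shows "\<exists>f. quotient_diffeomorphism M p N f \<and> (\<forall>x\<in>M. f (p x) = F x)"
proof -
  define f where "f = (\<lambda>c. F (SOME x. x \<in> M \<and> p x = c))"
  have f: "f (p x) = F x" if "x \<in> M" for x
  proof -
    have "(SOME y. y \<in> M \<and> p y = p x) \<in> M \<and> p (SOME y. y \<in> M \<and> p y = p x) = p x"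
      using that by (rule_tac someI) blast
    then show ?thesis using fibres that unfolding f_def by blast
  qed
  have "bij_betw f (p ` M) N"
    unfolding bij_betw_def inj_on_def using f fibres image by (force simp: image_image)
  moreover have "smooth_map M (f \<circ> p)"
    using smooth_map_if_smooth_at[OF smooth, of M] f unfolding smooth_map_def by simp
  moreover have "\<exists>V s. open V \<and> y \<in> V \<and> smooth_map (N \<inter> V) s \<and>
      (\<forall>w\<in>N \<inter> V. s w \<in> M \<and> f (p (s w)) = w)" if "y \<in> N" for y
  proof -
    from sections[OF that] obtain s where s: "smooth_at y s"
      "eventually (\<lambda>w. w \<in> N \<longrightarrow> s w \<in> M \<and> F (s w) = w) (nhds y)" by blast
    obtain U where U: "open U" "y \<in> U" "\<forall>k. Ck_on k U s"
      using s(1) unfolding smooth_at_def by blast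
    obtain V where V: "open V" "y \<in> V" "\<forall>w\<in>V. w \<in> N \<longrightarrow> s w \<in> M \<and> F (s w) = w"
      using s(2) unfolding eventually_nhds by blast
    have "smooth_map (N \<inter> (U \<inter> V)) s"
      using U by (intro smooth_map_if_smooth_at) (auto simp: smooth_at_def)
    then show ?thesis
      using U V f by (intro exI[of _ "U \<inter> V"] exI[of _ s]) auto
  qed
  ultimately have "quotient_diffeomorphism M p N f"
    unfolding quotient_diffeomorphism_def by blast
  then show ?thesis using f by blast
qed


section \<open>Coordinates in six dimensions\<close>

lemma exhaust_6:
  fixes x :: 6
  shows "x = 1 \<or> x = 2 \<or> x = 3 \<or> x = 4 \<or> x = 5 \<or> x = 6"
proof (induct x)
  case (of_int z)
  then have "0 \<le> z" and "z < 6" by simp_all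
  then have "z = 0 \<or> z = 1 \<or> z = 2 \<or> z = 3 \<or> z = 4 \<or> z = 5" by arith
  then show ?case by auto
qed

lemma UNIV_6: "(UNIV :: 6 set) = {1, 2, 3, 4, 5, 6}"
  using exhaust_6 by auto

lemma forall_6: "(\<forall>i::6. P i) \<longleftrightarrow> P 1 \<and> P 2 \<and> P 3 \<and> P 4 \<and> P 5 \<and> P 6"
  by (metis exhaust_6)

lemma sum_6: "sum f (UNIV :: 6 set) = f 1 + f 2 + f 3 + f 4 + f 5 + f 6"
  unfolding UNIV_6 by (simp add: ac_simps)

lemma prod_6: "prod f (UNIV :: 6 set) = f 1 * f 2 * f 3 * f 4 * f 5 * f 6"
  unfolding UNIV_6 by (simp add: ac_simps)

lemma vector_6 [simp]:
  "(vector [a, b, c, d, e, f] :: 'a::zero^6) $ 1 = a"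
  "(vector [a, b, c, d, e, f] :: 'a::zero^6) $ 2 = b"
  "(vector [a, b, c, d, e, f] :: 'a::zero^6) $ 3 = c"
  "(vector [a, b, c, d, e, f] :: 'a::zero^6) $ 4 = d"
  "(vector [a, b, c, d, e, f] :: 'a::zero^6) $ 5 = e"
  "(vector [a, b, c, d, e, f] :: 'a::zero^6) $ 6 = f"
  by (simp_all add: vector_def)

lemma vector_4 [simp]:
  "(vector [a, b, c, d] :: 'a::zero^4) $ 1 = a"
  "(vector [a, b, c, d] :: 'a::zero^4) $ 2 = b"
  "(vector [a, b, c, d] :: 'a::zero^4) $ 3 = c"
  "(vector [a, b, c, d] :: 'a::zero^4) $ 4 = d"
  by (simp_all add: vector_def)

lemma wedge_mult_vec: "wedge u v *v x = (v \<bullet> x) *\<^sub>R u - (u \<bullet> x) *\<^sub>R v"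
  by (simp add: vec_eq_iff wedge_def matrix_vector_mult_def inner_vec_def left_diff_distrib
      sum_subtractf sum_distrib_left mult.assoc algebra_simps)

lemma wedge_bivector: "wedge u v \<in> bivectors"
  by (simp add: bivectors_def wedge_def transpose_def vec_eq_iff)

lemma bivectors_iff: "B \<in> bivectors \<longleftrightarrow> (\<forall>i j. B $ i $ j = - B $ j $ i)"
  unfolding bivectors_def vec_eq_iff transpose_def mem_Collect_eq vec_lambda_beta uminus_vec_def
  by metis

lemma bivectors_nth: "B \<in> bivectors \<Longrightarrow> B $ i $ j = - B $ j $ i"
  using iffD1[OF bivectors_iff] by metis

lemma linear_transpose: "linear (transpose :: real^'n^'m \<Rightarrow> real^'m^'n)"
  by (simp add: linear_iff transpose_def vec_eq_iff)

lemma subspace_bivectors: "subspace bivectors"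
  unfolding subspace_def bivectors_def
  by (simp add: linear_0[OF linear_transpose] linear_add[OF linear_transpose]
      linear_scale[OF linear_transpose])

lemma bivector_mult_inner:
  assumes "B \<in> bivectors" shows "(B *v x) \<bullet> y = - (x \<bullet> (B *v y))"
proof -
  have "transpose B = - B" using assms by (simp add: bivectors_def)
  then have "x \<bullet> (B *v y) = ((- B) *v x) \<bullet> y"
    by (metis dot_lmul_matrix transpose_matrix_vector)
  moreover have "(- B) *v x = - (B *v x)"
    by (simp add: vec_eq_iff matrix_vector_mult_def sum_negf)
  ultimately show ?thesis by simp
qed

lemma bivector_mult_orthogonal: "B \<in> bivectors \<Longrightarrow> x \<bullet> (B *v x) = 0"
  using bivector_mult_inner[of B x x] by (simp add: inner_commute)

lemma wedge_inner:
  assumes "B \<in> bivectors" shows "wedge u v \<bullet> B = 2 * (u \<bullet> (B *v v))"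
proof -
  have "wedge u v \<bullet> B = u \<bullet> (B *v v) - v \<bullet> (B *v u)"
    by (simp add: wedge_def inner_vec_def matrix_vector_mult_def sum_subtractf sum_distrib_left
        algebra_simps)
  then show ?thesis
    using bivector_mult_inner[OF assms, of v u] by (simp add: inner_commute)
qed

lemma normal_form_matrix:
  "normal_form l = vector [
     vector [0, l$1, 0, 0, 0, 0], vector [- l$1, 0, 0, 0, 0, 0],
     vector [0, 0, 0, l$2, 0, 0], vector [0, 0, - l$2, 0, 0, 0],
     vector [0, 0, 0, 0, 0, l$3], vector [0, 0, 0, 0, - l$3, 0]]"
  by (simp add: normal_form_def e2_def wedge_def vec_eq_iff forall_6 axis_def)

lemma normal_form_bivector: "normal_form l \<in> bivectors"
  by (simp add: bivectors_def normal_form_matrix transpose_def vec_eq_iff forall_6)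

lemma normal_form_mult_vec:
  "normal_form l *v x = vector [l$1 * x$2, - l$1 * x$1, l$2 * x$4, - l$2 * x$3, l$3 * x$6, - l$3 * x$5]"
  by (simp add: normal_form_matrix matrix_vector_mult_def vec_eq_iff forall_6 sum_6)

lemma normal_form_inner: "normal_form l \<bullet> normal_form k = 2 * (l$1 * k$1 + l$2 * k$2 + l$3 * k$3)"
  by (simp add: normal_form_matrix inner_vec_def sum_6)

lemma normal_form_unit: "normal_form l \<in> unit_bivectors \<longleftrightarrow> (l$1)\<^sup>2 + (l$2)\<^sup>2 + (l$3)\<^sup>2 = 1"
  by (auto simp: unit_bivectors_def normal_form_bivector bivector_inner_def normal_form_inner
      power2_eq_square)


declare transpose_matrix_vector [simp del]


section \<open>The action of the special orthogonal group\<close>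

lemma SO_iff: "g \<in> SO \<longleftrightarrow> orthogonal_matrix g \<and> det g = 1"
  by (simp add: SO_def rotation_matrix_def)

lemma mat_1_SO: "mat 1 \<in> SO"
  by (simp add: SO_iff orthogonal_matrix_id)

lemma SO_mult: "g \<in> SO \<Longrightarrow> h \<in> SO \<Longrightarrow> g ** h \<in> SO"
  by (simp add: SO_iff orthogonal_matrix_mul det_mul)

lemma SO_transpose: "g \<in> SO \<Longrightarrow> transpose g \<in> SO"
  by (simp add: SO_iff)

lemma orthogonal_matrix_cancel:
  "orthogonal_matrix g \<Longrightarrow> g ** transpose g = mat 1"
  "orthogonal_matrix g \<Longrightarrow> transpose g ** g = mat 1"
  by (simp_all add: orthogonal_matrix_def)

lemma SO_cancel:
  "g \<in> SO \<Longrightarrow> g ** transpose g = mat 1" "g \<in> SO \<Longrightarrow> transpose g ** g = mat 1"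
  by (simp_all add: SO_iff orthogonal_matrix_def)

lemma act_act: "act g (act h B) = act (g ** h) B"
  by (simp add: act_def matrix_transpose_mul matrix_mul_assoc)

lemma act_1 [simp]: "act (mat 1) B = B"
  by (simp add: act_def transpose_mat)

lemma act_transpose_act:
  "g \<in> SO \<Longrightarrow> act (transpose g) (act g B) = B" "g \<in> SO \<Longrightarrow> act g (act (transpose g) B) = B"
  by (simp_all add: act_act SO_cancel)

lemma linear_act: "linear (act g)"
  unfolding linear_iff act_def
  by (simp add: bounded_bilinear.add_left[OF bounded_bilinear_matrix_mult]
      bounded_bilinear.add_right[OF bounded_bilinear_matrix_mult]
      bounded_bilinear.scaleR_left[OF bounded_bilinear_matrix_mult]
      bounded_bilinear.scaleR_right[OF bounded_bilinear_matrix_mult])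

lemma act_mult_vec: "act g B *v x = g *v (B *v (transpose g *v x))"
  by (simp add: act_def matrix_vector_mul_assoc matrix_mul_assoc)

lemma act_bivector: assumes "B \<in> bivectors" shows "act g B \<in> bivectors"
proof -
  have "transpose (act g B) = act g (transpose B)"
    by (simp add: act_def matrix_transpose_mul matrix_mul_assoc)
  also have "\<dots> = - act g B"
    using assms by (simp add: bivectors_def linear_neg[OF linear_act])
  finally show ?thesis by (simp add: bivectors_def)
qed

lemma matrix_vector_inner: "(A *v x) \<bullet> y = x \<bullet> (transpose A *v y)" for A :: "real^'n^'m"
  by (metis dot_lmul_matrix inner_commute transpose_matrix_vector)

lemma SO_inner: "g \<in> SO \<Longrightarrow> (g *v x) \<bullet> (g *v y) = x \<bullet> y"
  by (simp add: matrix_vector_inner matrix_vector_mul_assoc SO_cancel)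

lemma inner_matrix_mult_left:
  fixes A :: "real^'n^'m"
  shows "(g ** A) \<bullet> B = A \<bullet> (transpose g ** B)"
proof -
  have "(g ** A) \<bullet> B = (\<Sum>i\<in>UNIV. \<Sum>j\<in>UNIV. \<Sum>k\<in>UNIV. g$i$k * A$k$j * B$i$j)"
    by (simp add: inner_vec_def matrix_matrix_mult_def sum_distrib_right)
  also have "\<dots> = (\<Sum>k\<in>UNIV. \<Sum>j\<in>UNIV. \<Sum>i\<in>UNIV. g$i$k * A$k$j * B$i$j)"
    by (subst (2) sum.swap, subst sum.swap, subst (2) sum.swap) simp
  also have "\<dots> = A \<bullet> (transpose g ** B)"
    by (simp add: inner_vec_def matrix_matrix_mult_def transpose_def sum_distrib_left mult_ac)
  finally show ?thesis .
qed

lemma inner_transpose: "transpose A \<bullet> transpose B = A \<bullet> (B :: real^'n^'m)"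
  unfolding inner_vec_def transpose_def by (simp add: inner_vec_def) (rule sum.swap)

lemma inner_matrix_mult_right:
  fixes A :: "real^'n^'m"
  shows "(A ** g) \<bullet> B = A \<bullet> (B ** transpose g)"
  using inner_matrix_mult_left[of "transpose g" "transpose A" "transpose B"]
  by (simp add: inner_transpose flip: matrix_transpose_mul)
    (metis inner_transpose matrix_transpose_mul transpose_transpose)

lemma act_inner: "act g A \<bullet> B = A \<bullet> act (transpose g) B"
  unfolding act_def
  by (subst inner_matrix_mult_right, subst inner_matrix_mult_left) (simp add: matrix_mul_assoc)

lemma act_inner_act: "g \<in> SO \<Longrightarrow> act g A \<bullet> act g B = A \<bullet> B"
  by (simp add: act_inner act_transpose_act)

lemma orbit_trans: "B' \<in> orbit B \<Longrightarrow> orbit B' = orbit B"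
proof -
  assume "B' \<in> orbit B"
  then obtain g where g: "g \<in> SO" "B' = act g B" by (auto simp: orbit_def)
  show "orbit B' = orbit B"
  proof
    show "orbit B' \<subseteq> orbit B"
      using g SO_mult by (auto simp: orbit_def act_act)
    show "orbit B \<subseteq> orbit B'"
    proof
      fix C assume "C \<in> orbit B"
      then obtain h where "h \<in> SO" "C = act h B" by (auto simp: orbit_def)
      then have "C = act (h ** transpose g) B'" "h ** transpose g \<in> SO"
        using g by (simp_all add: SO_mult SO_transpose act_transpose_act flip: act_act)
      then show "C \<in> orbit B'" by (auto simp: orbit_def)
    qed
  qed
qed

lemma orbit_refl: "B \<in> orbit B"
  using mat_1_SO by (force simp: orbit_def)

lemma orbit_eq_iff: "orbit B = orbit C \<longleftrightarrow> B \<in> orbit C"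
  using orbit_refl orbit_trans by blast

lemma act_orbit: "g \<in> SO \<Longrightarrow> act g B \<in> orbit B"
  by (simp add: orbit_def)

lemma compact_SO: "compact (SO :: (real^'n^'n) set)"
proof -
  have cont: "continuous_on UNIV (\<lambda>A::real^'n^'n. transpose A ** A)"
    and cont_det: "continuous_on UNIV (\<lambda>A::real^'n^'n. det A)"
    by (intro continuous_at_imp_continuous_on ballI smooth_at_isCont smooth_intros smooth_at_det)+
  have "SO = {A::real^'n^'n. transpose A ** A = mat 1} \<inter> {A. det A = 1}"
    by (auto simp: SO_iff orthogonal_matrix)
  moreover have c: "closed {A::real^'n^'n. transpose A ** A = mat 1}" "closed {A::real^'n^'n. det A = 1}"
    using cont cont_det by (auto intro!: closed_Collect_eq continuous_on_const)
  moreover have "bounded (SO :: (real^'n^'n) set)"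
  proof (rule boundedI)
    fix A :: "real^'n^'n" assume "A \<in> SO"
    then have "A \<bullet> A = mat 1 \<bullet> (mat 1 :: real^'n^'n)"
      using inner_matrix_mult_left[of A "mat 1" A] by (simp add: SO_cancel)
    then show "norm A \<le> norm (mat 1 :: real^'n^'n)" by (simp add: norm_eq_sqrt_inner)
  qed
  ultimately show ?thesis
    using closed_Int[OF c] by (simp only: compact_eq_bounded_closed)
qed

lemma continuous_on_act: "continuous_on S (\<lambda>x. act (f x) (g x))"
  if "continuous_on S f" "continuous_on S g"
proof -
  have "continuous_on UNIV (\<lambda>(g, B). act g B)"
    unfolding case_prod_unfold
    by (intro continuous_at_imp_continuous_on ballI smooth_at_isCont smooth_intros)
  from continuous_on_compose2[OF this continuous_on_Pair[OF that]] show ?thesis by simp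
qed

lemma compact_orbit: "compact (orbit B)"
  unfolding orbit_def
  by (intro compact_continuous_image compact_SO continuous_on_act continuous_on_id continuous_on_const)


section \<open>Reflections\<close>

definition reflection :: "real^'n \<Rightarrow> real^'n^'n" where
  "reflection n = mat 1 - (\<chi> i j. 2 * n$i * n$j)"

lemma reflection_mult_vec: "reflection n *v x = x - (2 * (n \<bullet> x)) *\<^sub>R n"
proof -
  have "(\<chi> i j. 2 * n$i * n$j) *v x = (2 * (n \<bullet> x)) *\<^sub>R n"
    by (simp add: vec_eq_iff matrix_vector_mult_def inner_vec_def sum_distrib_left sum_distrib_right mult_ac)
  then show ?thesis by (simp add: reflection_def matrix_vector_mult_diff_rdistrib)
qed

lemma transpose_reflection [simp]: "transpose (reflection n) = reflection n"
  by (simp add: reflection_def transpose_def vec_eq_iff mat_def)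

lemma reflection_reflection:
  assumes "norm n = 1" shows "reflection n ** reflection n = mat 1"
proof -
  have "n \<bullet> (x - (2 * (n \<bullet> x)) *\<^sub>R n) = - (n \<bullet> x)" for x
    using assms by (simp add: inner_diff_right norm_eq_1)
  then show ?thesis
    unfolding matrix_eq by (simp add: reflection_mult_vec flip: matrix_vector_mul_assoc)
qed

lemma orthogonal_reflection: "norm n = 1 \<Longrightarrow> orthogonal_matrix (reflection n)"
  by (simp add: orthogonal_matrix_def reflection_reflection)

lemma reflection_conj:
  "orthogonal_matrix g \<Longrightarrow> reflection (g *v n) = g ** reflection n ** transpose g"
  unfolding matrix_eq
  by (simp add: reflection_mult_vec matrix_vector_mult_diff_distrib matrix_vector_mult_scaleR
      orthogonal_matrix_def flip: matrix_vector_mul_assoc dot_lmul_matrix transpose_matrix_vector)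
    (simp add: matrix_vector_mul_assoc dot_lmul_matrix flip: transpose_matrix_vector)

text \<open>
  All reflections are conjugate to the reflection in a basis vector, which is diagonal.
\<close>

lemma det_reflection: assumes "norm n = 1" shows "det (reflection (n :: real^'n)) = -1"
proof -
  fix k :: 'n
  obtain g where g: "orthogonal_matrix g" "g *v axis k 1 = n"
    using orthogonal_matrix_exists_basis[OF assms] by metis
  have "det (reflection (axis k 1 :: real^'n)) = (\<Prod>i\<in>UNIV. reflection (axis k 1 :: real^'n) $ i $ i)"
    by (rule det_diagonal) (auto simp: reflection_def mat_def axis_def)
  also have "\<dots> = (\<Prod>i\<in>UNIV. if i = k then -1 else 1)"
    by (rule prod.cong) (auto simp: reflection_def mat_def axis_def)
  also have "\<dots> = -1" by (simp add: prod.delta)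
  finally have "det (reflection (axis k 1 :: real^'n)) = -1" .
  moreover have "det g * det g = 1"
    using g(1) det_orthogonal_matrix by force
  ultimately show ?thesis
    using reflection_conj[OF g(1), of "axis k 1"] g(2) by (simp add: det_mul det_transpose)
qed

lemma reflections_SO: "norm n = 1 \<Longrightarrow> norm m = 1 \<Longrightarrow> reflection n ** reflection m \<in> SO"
  by (simp add: SO_iff det_mul det_reflection orthogonal_matrix_mul orthogonal_reflection)

text \<open>
  The term of fourth order in n vanishes, since n is orthogonal to its image under a skew matrix.
\<close>

lemma act_reflection:
  assumes "norm n = 1" "B \<in> bivectors"
  shows "act (reflection n) B = B + 2 *\<^sub>R wedge n (B *v n)"
  unfolding matrix_eq
proof
  fix x
  have "n \<bullet> (B *v x) = - ((B *v n) \<bullet> x)"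
    using bivector_mult_inner[OF assms(2), of n x] by simp
  then show "act (reflection n) B *v x = (B + 2 *\<^sub>R wedge n (B *v n)) *v x"
    using bivector_mult_orthogonal[OF assms(2)]
    by (simp add: act_mult_vec reflection_mult_vec wedge_mult_vec algebra_simps
        scaleR_matrix_vector_assoc[symmetric] matrix_vector_mult_scaleR inner_diff_right)
qed


section \<open>The Pfaffian\<close>

definition rows_det :: "real^6 \<Rightarrow> real^6 \<Rightarrow> real^6 \<Rightarrow> real^6 \<Rightarrow> real^6 \<Rightarrow> real^6 \<Rightarrow> real" where
  "rows_det a b c d e f = det (vector [a, b, c, d, e, f] :: real^6^6)"

lemma rows_det_sum:
  "rows_det a b c d e f = (\<Sum>p | p permutes (UNIV :: 6 set).
     of_int (sign p) * (a $ p 1 * b $ p 2 * c $ p 3 * d $ p 4 * e $ p 5 * f $ p 6))"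
  by (simp add: rows_det_def det_def prod_6)

text \<open>
  The Pfaffian is a cubic form; its polarization turns a triple of decomposable bivectors into a
  determinant.
\<close>

definition Pfaffian_polar :: "real^6^6 \<Rightarrow> real^6^6 \<Rightarrow> real^6^6 \<Rightarrow> real" where
  "Pfaffian_polar A B C = (\<Sum>p | p permutes (UNIV :: 6 set).
     of_int (sign p) * (A $ p 1 $ p 2 * B $ p 3 $ p 4 * C $ p 5 $ p 6))"

lemma Pfaffian_polar: "Pfaffian A = Pfaffian_polar A A A / 48"
  by (simp add: Pfaffian_def Pfaffian_polar_def fact_numeral)

lemma sum_product3:
  fixes f g h :: "_ \<Rightarrow> 'a::comm_semiring_0"
  shows "sum f A * sum g B * sum h C = (\<Sum>x\<in>A. \<Sum>y\<in>B. \<Sum>z\<in>C. f x * g y * h z)"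
proof -
  have "sum f A * sum g B * sum h C = sum f A * (\<Sum>y\<in>B. \<Sum>z\<in>C. g y * h z)"
    by (simp only: mult.assoc sum_product[of g B h C])
  also have "\<dots> = (\<Sum>x\<in>A. \<Sum>y\<in>B. f x * (\<Sum>z\<in>C. g y * h z))"
    by (rule sum_product)
  finally show ?thesis by (simp add: sum_distrib_left mult.assoc)
qed

lemma act_nth:
  "act g B $ i $ j = (\<Sum>x\<in>UNIV. g $ i $ fst x * g $ j $ snd x * B $ fst x $ snd x)"
proof -
  have "act g B $ i $ j = (\<Sum>b\<in>UNIV. \<Sum>a\<in>UNIV. g $ i $ a * g $ j $ b * B $ a $ b)"
    by (simp add: act_def matrix_matrix_mult_def transpose_def sum_distrib_left mult_ac)
  also have "\<dots> = (\<Sum>a\<in>UNIV. \<Sum>b\<in>UNIV. g $ i $ a * g $ j $ b * B $ a $ b)"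
    by (rule sum.swap)
  also have "\<dots> = (\<Sum>x\<in>UNIV \<times> UNIV. g $ i $ fst x * g $ j $ snd x * B $ fst x $ snd x)"
    by (simp add: sum.cartesian_product case_prod_unfold)
  finally show ?thesis by simp
qed

lemma rows_det_columns:
  "rows_det (column a g) (column b g) (column c g) (column d g) (column e g) (column f g) =
     det g * rows_det (axis a 1) (axis b 1) (axis c 1) (axis d 1) (axis e 1) (axis f 1)"
proof -
  have "(vector [column a g, column b g, column c g, column d g, column e g, column f g] :: real^6^6) =
      vector [axis a 1, axis b 1, axis c 1, axis d 1, axis e 1, axis f 1] ** transpose g"
    by (simp add: vec_eq_iff forall_6 matrix_matrix_mult_def column_def transpose_def axis_def
        if_distrib[of "\<lambda>x. x * _"] sum.delta' cong: if_cong)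
  then show ?thesis by (simp add: rows_det_def det_mul det_transpose)
qed

text \<open>
  Expanding the three entries of act g B, the sum over the permutations is a determinant of columns
  of g for every choice of the six summation indices, so that det g factors out.
\<close>

lemma Pfaffian_polar_act:
  "Pfaffian_polar (act g B) (act g B) (act g B) = det g * Pfaffian_polar B B B"
proof -
  have expand: "Pfaffian_polar (act g B) (act g B) (act g B) =
      (\<Sum>x\<in>UNIV. \<Sum>y\<in>UNIV. \<Sum>z\<in>UNIV.
         B $ fst x $ snd x * B $ fst y $ snd y * B $ fst z $ snd z *
         rows_det (column (fst x) g) (column (snd x) g) (column (fst y) g) (column (snd y) g)
           (column (fst z) g) (column (snd z) g))" (is "_ = ?R g") for g
  proof -
    let ?P = "{p. p permutes (UNIV :: 6 set)}"
    let ?t = "\<lambda>p x y z. of_int (sign p) *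
        ((g $ p 1 $ fst x * g $ p 2 $ snd x * B $ fst x $ snd x) *
         (g $ p 3 $ fst y * g $ p 4 $ snd y * B $ fst y $ snd y) *
         (g $ p 5 $ fst z * g $ p 6 $ snd z * B $ fst z $ snd z))"
    have "Pfaffian_polar (act g B) (act g B) (act g B) =
        (\<Sum>p\<in>?P. \<Sum>x\<in>UNIV. \<Sum>y\<in>UNIV. \<Sum>z\<in>UNIV. ?t p x y z)"
      unfolding Pfaffian_polar_def act_nth sum_product3 by (simp add: sum_distrib_left)
    also have "\<dots> = (\<Sum>x\<in>UNIV. \<Sum>p\<in>?P. \<Sum>y\<in>UNIV. \<Sum>z\<in>UNIV. ?t p x y z)"
      by (rule sum.swap)
    also have "\<dots> = (\<Sum>x\<in>UNIV. \<Sum>y\<in>UNIV. \<Sum>p\<in>?P. \<Sum>z\<in>UNIV. ?t p x y z)"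
      by (intro sum.cong refl sum.swap)
    also have "\<dots> = (\<Sum>x\<in>UNIV. \<Sum>y\<in>UNIV. \<Sum>z\<in>UNIV. \<Sum>p\<in>?P. ?t p x y z)"
      by (intro sum.cong refl sum.swap)
    also have "\<dots> = ?R g"
      by (simp add: rows_det_sum column_def sum_distrib_left mult_ac)
    finally show ?thesis .
  qed
  have "Pfaffian_polar (act g B) (act g B) (act g B) = det g * ?R (mat 1)"
    unfolding expand[of g] rows_det_columns[of _ g] rows_det_columns[of _ "mat 1"]
    by (simp add: sum_distrib_left mult_ac)
  then show ?thesis using expand[of "mat 1"] by simp
qed

lemma Pfaffian_act: "Pfaffian (act g B) = det g * Pfaffian B"
  by (simp add: Pfaffian_polar Pfaffian_polar_act)

lemma rows_det_swap:
  "rows_det b a c d e f = - rows_det a b c d e f"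
  "rows_det a b d c e f = - rows_det a b c d e f"
  "rows_det a b c d f e = - rows_det a b c d e f"
proof -
  have swap: "det (\<chi> k. A $ Transposition.transpose i j k) = - det A" if "i \<noteq> j"
    for i j :: 6 and A :: "real^6^6"
    using that by (subst det_permute_rows) (simp_all add: permutes_swap_id sign_swap_id)
  have "(vector [b, a, c, d, e, f] :: real^6^6) = (\<chi> k. vector [a, b, c, d, e, f] $ Transposition.transpose 1 2 k)"
    "(vector [a, b, d, c, e, f] :: real^6^6) = (\<chi> k. vector [a, b, c, d, e, f] $ Transposition.transpose 3 4 k)"
    "(vector [a, b, c, d, f, e] :: real^6^6) = (\<chi> k. vector [a, b, c, d, e, f] $ Transposition.transpose 5 6 k)"
    by (simp_all add: vec_eq_iff forall_6 Transposition.transpose_def)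
  then show "rows_det b a c d e f = - rows_det a b c d e f"
    "rows_det a b d c e f = - rows_det a b c d e f"
    "rows_det a b c d f e = - rows_det a b c d e f"
    unfolding rows_det_def by (simp_all only: swap) (simp_all add: swap)
qed

lemma rows_det_swap_pairs:
  "rows_det c d a b e f = rows_det a b c d e f"
  "rows_det a b e f c d = rows_det a b c d e f"
proof -
  have swap: "det (\<chi> k. A $ (Transposition.transpose i j \<circ> Transposition.transpose m n) k) = det A"
    if "i \<noteq> j" "m \<noteq> n" for i j m n :: 6 and A :: "real^6^6"
    using that
    by (subst det_permute_rows)
      (simp_all add: permutes_swap_id permutes_compose sign_compose sign_swap_id permutation_swap_id)
  have "(vector [c, d, a, b, e, f] :: real^6^6) = (\<chi> k. vector [a, b, c, d, e, f] $
      (Transposition.transpose 1 3 \<circ> Transposition.transpose 2 4) k)"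
    "(vector [a, b, e, f, c, d] :: real^6^6) = (\<chi> k. vector [a, b, c, d, e, f] $
      (Transposition.transpose 3 5 \<circ> Transposition.transpose 4 6) k)"
    by (simp_all add: vec_eq_iff forall_6 Transposition.transpose_def)
  then show "rows_det c d a b e f = rows_det a b c d e f"
    "rows_det a b e f c d = rows_det a b c d e f"
    unfolding rows_det_def by (simp_all add: swap del: o_apply)
qed

lemma rows_det_repeat: "rows_det a b a b e f = 0" "rows_det a b c d a b = 0" "rows_det a b c d c d = 0"
  unfolding rows_det_def
  by (rule det_identical_rows[of 1 3] det_identical_rows[of 1 5] det_identical_rows[of 3 5];
      simp add: row_def)+

lemma Pfaffian_polar_wedge:
  "Pfaffian_polar (wedge a b) (wedge c d) (wedge e f) = 8 * rows_det a b c d e f"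
proof -
  have "Pfaffian_polar (wedge a b) (wedge c d) (wedge e f) =
      rows_det a b c d e f - rows_det b a c d e f - rows_det a b d c e f + rows_det b a d c e f
      - rows_det a b c d f e + rows_det b a c d f e + rows_det a b d c f e - rows_det b a d c f e"
    unfolding Pfaffian_polar_def rows_det_sum sum_subtractf[symmetric] sum.distrib[symmetric]
    by (rule sum.cong) (simp_all add: wedge_def algebra_simps)
  also have "\<dots> = 8 * rows_det a b c d e f"
    by (simp add: rows_det_swap(1)[of b a] rows_det_swap(2)[of _ _ d c] rows_det_swap(3)[of _ _ _ _ f e])
  finally show ?thesis .
qed

lemma Pfaffian_polar_add:
  "Pfaffian_polar (A + A') B C = Pfaffian_polar A B C + Pfaffian_polar A' B C"
  "Pfaffian_polar A (B + B') C = Pfaffian_polar A B C + Pfaffian_polar A B' C"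
  "Pfaffian_polar A B (C + C') = Pfaffian_polar A B C + Pfaffian_polar A B C'"
  by (simp_all add: Pfaffian_polar_def algebra_simps sum.distrib)

text \<open>
  Of the 27 terms in the trilinear expansion only those with three different planes survive; there are
  six of them, all equal, since exchanging two planes is an even permutation of the basis vectors.
\<close>

lemma Pfaffian_standard: "Pfaffian (normal_form (vector [1, 1, 1])) = 1"
proof -
  let ?D = "rows_det (axis 1 1) (axis 2 1) (axis 3 1) (axis 4 1) (axis 5 1) (axis 6 1)"
  have perms:
    "rows_det a b e f c d = rows_det a b c d e f"
    "rows_det c d a b e f = rows_det a b c d e f"
    "rows_det c d e f a b = rows_det a b c d e f"
    "rows_det e f a b c d = rows_det a b c d e f"
    "rows_det e f c d a b = rows_det a b c d e f" for a b c d e f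
    by (metis rows_det_swap_pairs)+
  have "Pfaffian (normal_form (vector [1, 1, 1])) = ?D"
    unfolding Pfaffian_polar normal_form_def vector_3 scaleR_one e2_def
      Pfaffian_polar_add Pfaffian_polar_wedge rows_det_repeat
      perms[where a = "axis 1 1" and b = "axis 2 1" and c = "axis 3 1" and d = "axis 4 1"
        and e = "axis 5 1" and f = "axis 6 1"]
    by simp
  also have "?D = 1"
  proof -
    have "vector [axis 1 1, axis 2 1, axis 3 1, axis 4 1, axis 5 1, axis 6 1] = (mat 1 :: real^6^6)"
      by (simp add: vec_eq_iff forall_6 mat_def axis_def)
    then show ?thesis by (simp add: rows_det_def)
  qed
  finally show ?thesis .
qed

text \<open>A normal form is the image of the standard complex structure under a diagonal matrix.\<close>

lemma Pfaffian_normal_form: "Pfaffian (normal_form l) = l$1 * l$2 * l$3"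
proof -
  define v :: "real^6" where "v = vector [l$1, 1, l$2, 1, l$3, 1]"
  define D :: "real^6^6" where "D = (\<chi> i j. if i = j then v $ i else 0)"
  have "act D B $ i $ j = v $ i * v $ j * B $ i $ j" for B i j
    by (simp add: act_def D_def matrix_matrix_mult_def transpose_def if_distrib[of "\<lambda>x. x * _"]
        if_distrib[of "\<lambda>x. _ * x"] sum.delta sum.delta' cong: if_cong)
  then have "normal_form l = act D (normal_form (vector [1, 1, 1]))"
    by (simp add: vec_eq_iff forall_6 normal_form_matrix v_def)
  moreover have "det D = l$1 * l$2 * l$3"
    by (subst det_diagonal) (simp_all add: D_def prod_6 v_def)
  ultimately show ?thesis by (simp add: Pfaffian_act Pfaffian_standard)
qed

text \<open>
  The nonzero Pfaffian of the fixed bivector is cancelled in the transformation law.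
\<close>

lemma det_eq_1_if_act_fixed:
  "act g (normal_form l) = normal_form l \<Longrightarrow> l$1 * l$2 * l$3 \<noteq> 0 \<Longrightarrow> det g = 1"
  using Pfaffian_act[of g "normal_form l"] by (simp add: Pfaffian_normal_form)


section \<open>Normal forms\<close>

text \<open>
  On the unit circle the form exceeds its value at the pole to first order unless b vanishes.
\<close>

lemma quadratic_form_max_at_pole:
  fixes a b c :: real
  assumes "\<And>x y. x\<^sup>2 + y\<^sup>2 = 1 \<Longrightarrow> a * x\<^sup>2 + b * (x * y) + c * y\<^sup>2 \<le> a"
  shows "b = 0"
proof -
  have *: "(c - a) * s\<^sup>2 + b * s \<le> 0" for s
  proof -
    define r where "r = sqrt (1 + s\<^sup>2)"
    have r: "r > 0" "r\<^sup>2 = 1 + s\<^sup>2"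
      unfolding r_def by (simp_all add: add_pos_nonneg)
    have "(1 / r)\<^sup>2 + (s / r)\<^sup>2 = 1"
      using r(1) by (simp add: power_divide add_divide_distrib[symmetric] flip: r(2))
    from assms[OF this] have "a / r\<^sup>2 + b * (s / r\<^sup>2) + c * (s\<^sup>2 / r\<^sup>2) \<le> a"
      by (simp add: power_divide power2_eq_square)
    then have "(a + b * s + c * s\<^sup>2) / r\<^sup>2 \<le> a" by (simp add: add_divide_distrib)
    then have "a + b * s + c * s\<^sup>2 \<le> a * r\<^sup>2" using r(1) by (simp add: divide_le_eq)
    then show ?thesis unfolding r(2) by (simp add: algebra_simps)
  qed
  \<comment> \<open>The slope b / D is so small that the linear term dominates the quadratic one.\<close>
  define D where "D = \<bar>c - a\<bar> + 1"
  have D: "D > 0" "c - a \<ge> 1 - D" unfolding D_def by auto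
  have "(1 - D) * (b / D)\<^sup>2 + b * (b / D) \<le> 0"
    using *[of "b / D"] mult_right_mono[OF D(2), of "(b / D)\<^sup>2"] by simp
  moreover have "(1 - D) * (b / D)\<^sup>2 + b * (b / D) = (b / D)\<^sup>2"
    using D(1) by (simp add: field_simps power2_eq_square)
  ultimately show ?thesis using D(1) by simp
qed

text \<open>
  Let the curve through M be given by the products of the reflection in a basis vector with the
  reflections in the unit vectors of a coordinate plane. Along it the functional is a quadratic form in
  the second vector, and its critical points are described by a single matrix entry.
\<close>

lemma critical_point_commutes:
  assumes M: "M \<in> bivectors" and C: "C \<in> bivectors"
    and max: "\<And>n m. norm n = 1 \<Longrightarrow> norm m = 1 \<Longrightarrow>
      act (reflection n ** reflection m) M \<bullet> C \<le> M \<bullet> C"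
  shows "(C ** M) $ i $ j = (C ** M) $ j $ i"
proof (cases "i = j")
  case False
  define e f :: "real^6" where "e = axis i 1" and "f = axis j 1"
  have ef: "e \<bullet> e = 1" "f \<bullet> f = 1" "e \<bullet> f = 0" "f \<bullet> e = 0"
    using False by (simp_all add: e_def f_def inner_axis_axis)
  have e1: "norm e = 1" by (simp add: e_def)
  define C' where "C' = act (reflection e) C"
  have C': "C' \<in> bivectors" by (simp add: C'_def act_bivector C)
  define q where "q = (\<lambda>m. m \<bullet> (C' *v (M *v m)))"
  have val: "act (reflection e ** reflection m) M \<bullet> C = M \<bullet> C' + 4 * q m" if "norm m = 1" for m
  proof -
    have "act (reflection e ** reflection m) M \<bullet> C = act (reflection m) M \<bullet> C'"
      by (simp add: C'_def act_inner flip: act_act)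
    also have "\<dots> = M \<bullet> C' + 2 * (wedge m (M *v m) \<bullet> C')"
      by (simp add: act_reflection[OF that M] inner_add_left)
    also have "\<dots> = M \<bullet> C' + 4 * q m" by (simp add: wedge_inner[OF C'] q_def)
    finally show ?thesis .
  qed
  have "M \<bullet> C = M \<bullet> C' + 4 * q e"
    using val[OF e1] by (simp add: reflection_reflection e1)
  then have q_le: "q m \<le> q e" if "norm m = 1" for m
    using max[OF e1 that] val[OF that] by simp
  have refl_e: "reflection e *v e = - e" and refl_f: "reflection e *v f = f"
    by (simp_all add: reflection_mult_vec ef vec_eq_iff)
  have orth: "reflection e *v (B *v e) = B *v e" if "B \<in> bivectors" for B
    using bivector_mult_orthogonal[OF that, of e] by (simp add: reflection_mult_vec)
  have "f \<bullet> (C' *v (M *v e)) = f \<bullet> (C *v (M *v e))"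
    using matrix_vector_inner[of "reflection e" f "C *v (M *v e)"]
    by (simp add: C'_def act_mult_vec orth[OF M] refl_f)
  moreover have "e \<bullet> (C' *v (M *v f)) = - (e \<bullet> (C *v (M *v f)))"
  proof -
    have "e \<bullet> (C' *v (M *v f)) = - (e \<bullet> (C *v (reflection e *v (M *v f))))"
      using matrix_vector_inner[of "reflection e" e "C *v (reflection e *v (M *v f))"]
      by (simp add: C'_def act_mult_vec refl_e)
    also have "\<dots> = (C *v e) \<bullet> (reflection e *v (M *v f))"
      using bivector_mult_inner[OF C, of e] by simp
    also have "\<dots> = (C *v e) \<bullet> (M *v f)"
      using matrix_vector_inner[of "reflection e" "C *v e" "M *v f"] by (simp add: orth[OF C])
    also have "\<dots> = - (e \<bullet> (C *v (M *v f)))"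
      using bivector_mult_inner[OF C, of e] by simp
    finally show ?thesis .
  qed
  moreover have "e \<bullet> (C' *v (M *v f)) + f \<bullet> (C' *v (M *v e)) = 0"
  proof (rule quadratic_form_max_at_pole)
    fix x y :: real assume xy: "x\<^sup>2 + y\<^sup>2 = 1"
    have "norm (x *\<^sub>R e + y *\<^sub>R f) = 1"
      using xy by (simp add: norm_eq_1 inner_add_left inner_add_right ef power2_eq_square)
    moreover have "q (x *\<^sub>R e + y *\<^sub>R f) = q e * x\<^sup>2 +
        (e \<bullet> (C' *v (M *v f)) + f \<bullet> (C' *v (M *v e))) * (x * y) + q f * y\<^sup>2"
      by (simp add: q_def matrix_vector_right_distrib matrix_vector_mult_scaleR inner_add_left
          inner_add_right power2_eq_square algebra_simps)
    ultimately show "q e * x\<^sup>2 + (e \<bullet> (C' *v (M *v f)) + f \<bullet> (C' *v (M *v e))) * (x * y) + q f * y\<^sup>2 \<le> q e"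
      using q_le by metis
  qed
  moreover have "(C ** M) $ a $ b = axis a 1 \<bullet> (C *v (M *v axis b 1))" for a b
    unfolding matrix_vector_mul_assoc by (simp add: inner_axis' matrix_vector_mult_basis column_def)
  ultimately show ?thesis unfolding e_def f_def by simp
qed simp

lemma act_reflection_scaled:
  assumes "x \<bullet> x = 2" "B \<in> bivectors"
  shows "norm ((1 / sqrt 2) *\<^sub>R x) = 1"
    and "act (reflection ((1 / sqrt 2) *\<^sub>R x)) B = B + wedge x (B *v x)"
proof -
  show n: "norm ((1 / sqrt 2) *\<^sub>R x) = 1"
    using assms(1) by (simp add: norm_eq_sqrt_inner)
  have "2 *\<^sub>R wedge (c *\<^sub>R u) (c *\<^sub>R v) = (2 * (c * c)) *\<^sub>R wedge u v" for c :: real and u v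
    by (simp add: wedge_def vec_eq_iff algebra_simps)
  then show "act (reflection ((1 / sqrt 2) *\<^sub>R x)) B = B + wedge x (B *v x)"
    by (simp add: act_reflection[OF n assms(2)] matrix_vector_mult_scaleR)
qed

text \<open>
  These permutations, one of them with two changes of sign, generate the Weyl group of SO(6). Each is
  realized by two reflections along sums or differences of two basis vectors.
\<close>

lemma Weyl_moves:
  assumes "\<And>n m. norm n = 1 \<Longrightarrow> norm m = 1 \<Longrightarrow> act (reflection n ** reflection m) (normal_form l) \<in> X"
  shows "normal_form (vector [l$2, l$1, l$3]) \<in> X"
    and "normal_form (vector [l$1, l$3, l$2]) \<in> X"
    and "normal_form (vector [l$1, - l$3, - l$2]) \<in> X"
proof -
  let ?move = "\<lambda>x y. (normal_form l + wedge y (normal_form l *v y)) +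
      wedge x ((normal_form l + wedge y (normal_form l *v y)) *v x)"
  have move: "?move x y \<in> X"
    if "x \<bullet> x = 2" "y \<bullet> y = 2" for x y
  proof -
    have B: "normal_form l + wedge y (normal_form l *v y) \<in> bivectors"
      by (intro subspace_add subspace_bivectors normal_form_bivector wedge_bivector)
    show ?thesis
      using assms[OF act_reflection_scaled(1)[OF that(1) B] act_reflection_scaled(1)[OF that(2) B]]
      by (simp only: act_reflection_scaled(2)[OF that(1) B] flip: act_act)
        (simp only: act_reflection_scaled(2)[OF that(2) normal_form_bivector]
          act_reflection_scaled(2)[OF that(1) B])
  qed
  have inner_6: "v \<bullet> w = v$1 * w$1 + v$2 * w$2 + v$3 * w$3 + v$4 * w$4 + v$5 * w$5 + v$6 * w$6"
    for v w :: "real^6" by (simp add: inner_vec_def sum_6)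
  have "?move (vector [1, 0, -1, 0, 0, 0]) (vector [0, 1, 0, -1, 0, 0]) = normal_form (vector [l$2, l$1, l$3])"
    unfolding normal_form_mult_vec matrix_vector_mult_add_rdistrib wedge_mult_vec
    by (simp add: vec_eq_iff forall_6 wedge_def normal_form_matrix inner_6)
  then show "normal_form (vector [l$2, l$1, l$3]) \<in> X"
    using move[of "vector [1, 0, -1, 0, 0, 0]" "vector [0, 1, 0, -1, 0, 0]"] by (simp add: inner_6)
  have "?move (vector [0, 0, 1, 0, -1, 0]) (vector [0, 0, 0, 1, 0, -1]) = normal_form (vector [l$1, l$3, l$2])"
    unfolding normal_form_mult_vec matrix_vector_mult_add_rdistrib wedge_mult_vec
    by (simp add: vec_eq_iff forall_6 wedge_def normal_form_matrix inner_6)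
  then show "normal_form (vector [l$1, l$3, l$2]) \<in> X"
    using move[of "vector [0, 0, 1, 0, -1, 0]" "vector [0, 0, 0, 1, 0, -1]"] by (simp add: inner_6)
  have "?move (vector [0, 0, 1, 0, -1, 0]) (vector [0, 0, 0, 1, 0, 1]) = normal_form (vector [l$1, - l$3, - l$2])"
    unfolding normal_form_mult_vec matrix_vector_mult_add_rdistrib wedge_mult_vec
    by (simp add: vec_eq_iff forall_6 wedge_def normal_form_matrix inner_6)
  then show "normal_form (vector [l$1, - l$3, - l$2]) \<in> X"
    using move[of "vector [0, 0, 1, 0, -1, 0]" "vector [0, 0, 0, 1, 0, 1]"] by (simp add: inner_6)
qed

text \<open>
  A maximum of a regular linear functional on the set commutes with it, hence lies in the maximal
  torus, and by comparison with its Weyl conjugates it lies in the closed chamber of the functional.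
\<close>

lemma invariant_compact_set_meets_chamber:
  assumes "compact X" "X \<noteq> {}" "X \<subseteq> bivectors"
    and inv: "\<And>M n m. M \<in> X \<Longrightarrow> norm n = 1 \<Longrightarrow> norm m = 1 \<Longrightarrow>
      act (reflection n ** reflection m) M \<in> X"
  obtains l where "normal_form l \<in> X" "l$1 \<ge> l$2" "l$2 \<ge> \<bar>l$3\<bar>"
proof -
  \<comment> \<open>The parameters 3, 2, 1 have different squares, so only normal forms commute with C.\<close>
  define C where "C = normal_form (vector [3, 2, 1])"
  have "continuous_on X (\<lambda>M. M \<bullet> C)" by (intro continuous_intros)
  with assms(1,2) obtain M where M: "M \<in> X" "\<And>M'. M' \<in> X \<Longrightarrow> M' \<bullet> C \<le> M \<bullet> C"
    using continuous_attains_sup by metis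
  have MB: "M \<in> bivectors" using M(1) assms(3) by blast
  have comm: "(C ** M) $ i $ j = (C ** M) $ j $ i" for i j
    by (rule critical_point_commutes[OF MB]) (use M inv in \<open>auto simp: C_def normal_form_bivector\<close>)
  note skew = bivectors_nth[OF MB]
  have row: "(C ** M) $ 1 $ k = 3 * M $ 2 $ k" "(C ** M) $ 2 $ k = - 3 * M $ 1 $ k"
    "(C ** M) $ 3 $ k = 2 * M $ 4 $ k" "(C ** M) $ 4 $ k = - 2 * M $ 3 $ k"
    "(C ** M) $ 5 $ k = M $ 6 $ k" "(C ** M) $ 6 $ k = - M $ 5 $ k" for k
    by (simp_all add: C_def normal_form_matrix matrix_matrix_mult_def sum_6)
  have diag: "M $ i $ i = 0" for i using skew[of i i] by simp
  have blocks: "M $ 1 $ 3 = 0" "M $ 2 $ 4 = 0" "M $ 1 $ 4 = 0" "M $ 2 $ 3 = 0"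
    "M $ 1 $ 5 = 0" "M $ 2 $ 6 = 0" "M $ 1 $ 6 = 0" "M $ 2 $ 5 = 0"
    "M $ 3 $ 5 = 0" "M $ 4 $ 6 = 0" "M $ 3 $ 6 = 0" "M $ 4 $ 5 = 0"
    using comm[of 1 3] comm[of 2 4] comm[of 1 4] comm[of 2 3]
      comm[of 1 5] comm[of 2 6] comm[of 1 6] comm[of 2 5]
      comm[of 3 5] comm[of 4 6] comm[of 3 6] comm[of 4 5]
      skew[of 3 1] skew[of 4 2] skew[of 4 1] skew[of 3 2]
      skew[of 5 1] skew[of 6 2] skew[of 6 1] skew[of 5 2]
      skew[of 5 3] skew[of 6 4] skew[of 6 3] skew[of 5 4]
    unfolding row by linarith+
  define l :: "real^3" where "l = vector [M $ 1 $ 2, M $ 3 $ 4, M $ 5 $ 6]"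
  have l: "M = normal_form l"
    using skew[of 3 1] skew[of 4 2] skew[of 4 1] skew[of 3 2]
      skew[of 5 1] skew[of 6 2] skew[of 6 1] skew[of 5 2]
      skew[of 5 3] skew[of 6 4] skew[of 6 3] skew[of 5 4] skew[of 2 1] skew[of 4 3] skew[of 6 5]
    by (simp add: vec_eq_iff forall_6 normal_form_matrix l_def blocks diag)
  have moves: "normal_form (vector [l$2, l$1, l$3]) \<in> X"
    "normal_form (vector [l$1, l$3, l$2]) \<in> X" "normal_form (vector [l$1, - l$3, - l$2]) \<in> X"
    using Weyl_moves[of l X] inv[OF M(1)[unfolded l]] by blast+
  have "l$1 \<ge> l$2" "l$2 \<ge> \<bar>l$3\<bar>"
    using moves[THEN M(2)] by (simp_all add: l C_def normal_form_inner)
  then show ?thesis using that M(1) l by blast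
qed

lemma Delta_if_unit:
  "normal_form l \<in> unit_bivectors \<Longrightarrow> l$1 \<ge> l$2 \<Longrightarrow> l$2 \<ge> \<bar>l$3\<bar> \<Longrightarrow> l \<in> Delta"
  by (simp add: Delta_def normal_form_unit)

lemma normal_form_Delta: "l \<in> Delta \<Longrightarrow> normal_form l \<in> unit_bivectors"
  by (simp add: Delta_def normal_form_unit)

lemma act_unit_bivector: "g \<in> SO \<Longrightarrow> B \<in> unit_bivectors \<Longrightarrow> act g B \<in> unit_bivectors"
  by (simp add: unit_bivectors_def bivector_inner_def act_inner_act act_bivector)

lemma normal_form_exists:
  assumes "B \<in> unit_bivectors"
  shows "\<exists>l\<in>Delta. \<exists>g\<in>SO. act g B = normal_form l"
proof -
  have sub: "orbit B \<subseteq> unit_bivectors"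
    using assms by (auto simp: orbit_def act_unit_bivector)
  then have "orbit B \<subseteq> bivectors" by (auto simp: unit_bivectors_def)
  moreover have "act (reflection n ** reflection m) M \<in> orbit B"
    if "M \<in> orbit B" "norm n = 1" "norm m = 1" for M n m
    using that act_orbit[OF reflections_SO, of n m M] orbit_trans[of M B] by simp
  ultimately obtain l where l: "normal_form l \<in> orbit B" "l$1 \<ge> l$2" "l$2 \<ge> \<bar>l$3\<bar>"
    using invariant_compact_set_meets_chamber[OF compact_orbit, of B] orbit_refl by blast
  then have "l \<in> Delta" using sub Delta_if_unit by blast
  then show ?thesis using l(1) unfolding orbit_def by (metis imageE)
qed

lemma norm_orthogonal_mult_vec: "orthogonal_matrix g \<Longrightarrow> norm (g *v x) = norm (x :: real^'n)"
  unfolding norm_eq_sqrt_inner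
  by (simp add: matrix_vector_inner matrix_vector_mul_assoc orthogonal_matrix_cancel)

text \<open>The three parameters are determined by the operator norm, the norm and the Pfaffian.\<close>

lemma Delta_unique:
  assumes l: "l \<in> Delta" and k: "k \<in> Delta" and orb: "normal_form k \<in> orbit (normal_form l)"
  shows "k = l"
proof -
  have le: "k$1 \<le> l$1" if "l \<in> Delta" "k \<in> Delta" "g \<in> SO" "normal_form k = act g (normal_form l)" for l k g
  proof -
    have l: "0 \<le> l$1" "\<bar>l$2\<bar> \<le> l$1" "\<bar>l$3\<bar> \<le> l$1" and k: "0 \<le> k$1"
      using that(1,2) unfolding Delta_def by auto
    define v where "v = transpose g *v axis 1 1"
    have "norm v = 1"
      using that(3) by (simp add: v_def norm_orthogonal_mult_vec SO_iff)
    have "(norm (normal_form l *v v))\<^sup>2 = (l$1)\<^sup>2 * ((v$1)\<^sup>2 + (v$2)\<^sup>2) + (l$2)\<^sup>2 * ((v$3)\<^sup>2 + (v$4)\<^sup>2)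
        + (l$3)\<^sup>2 * ((v$5)\<^sup>2 + (v$6)\<^sup>2)"
      unfolding power2_norm_eq_inner
      by (simp add: normal_form_mult_vec inner_vec_def sum_6 power2_eq_square algebra_simps)
    also have "\<dots> \<le> (l$1)\<^sup>2 * ((v$1)\<^sup>2 + (v$2)\<^sup>2) + (l$1)\<^sup>2 * ((v$3)\<^sup>2 + (v$4)\<^sup>2)
        + (l$1)\<^sup>2 * ((v$5)\<^sup>2 + (v$6)\<^sup>2)"
      using l by (intro add_mono mult_right_mono order_refl) (auto simp: abs_le_square_iff[symmetric])
    also have "\<dots> = (l$1)\<^sup>2 * (norm v)\<^sup>2"
      unfolding power2_norm_eq_inner
      by (simp add: inner_vec_def sum_6 power2_eq_square algebra_simps)
    finally have "norm (normal_form l *v v) \<le> l$1"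
      using l(1) \<open>norm v = 1\<close> by (simp add: power2_le_iff_abs_le)
    moreover have "normal_form k *v axis 1 1 = g *v (normal_form l *v v)"
      by (simp add: that(4) act_mult_vec v_def)
    then have "norm (normal_form k *v axis 1 1) = norm (normal_form l *v v)"
      using that(3) by (simp add: norm_orthogonal_mult_vec SO_iff)
    moreover have "normal_form k *v axis 1 1 = (- k$1) *\<^sub>R axis 2 1"
      by (simp add: normal_form_mult_vec vec_eq_iff forall_6 axis_def)
    ultimately show ?thesis using k by simp
  qed
  obtain g where g: "g \<in> SO" "normal_form k = act g (normal_form l)"
    using orb by (auto simp: orbit_def)
  have "normal_form l = act (transpose g) (normal_form k)"
    using g by (simp add: act_transpose_act)
  then have eq1: "k$1 = l$1"
    using le[OF l k g] le[OF k l SO_transpose[OF g(1)]] by simp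
  have "l$1 > 0"
  proof (rule ccontr)
    assume "\<not> l$1 > 0"
    then have "l$1 = 0" "l$2 = 0" "l$3 = 0" using l unfolding Delta_def by auto
    then show False using l unfolding Delta_def by simp
  qed
  moreover have "k$1 * k$2 * k$3 = l$1 * l$2 * l$3"
    using Pfaffian_act[of g "normal_form l", folded g(2)] g(1)
    by (simp add: Pfaffian_normal_form SO_iff)
  ultimately have prod: "k$2 * k$3 = l$2 * l$3" using eq1 by simp
  have sum: "(k$2)\<^sup>2 + (k$3)\<^sup>2 = (l$2)\<^sup>2 + (l$3)\<^sup>2"
    using l k eq1 unfolding Delta_def by auto
  have "(k$2 + k$3)\<^sup>2 = (l$2 + l$3)\<^sup>2" "(k$2 - k$3)\<^sup>2 = (l$2 - l$3)\<^sup>2"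
    using prod sum by (simp_all add: power2_sum power2_diff)
  moreover have "k$2 + k$3 \<ge> 0" "l$2 + l$3 \<ge> 0" "k$2 - k$3 \<ge> 0" "l$2 - l$3 \<ge> 0"
    using l k unfolding Delta_def by auto
  ultimately have "k$2 + k$3 = l$2 + l$3" "k$2 - k$3 = l$2 - l$3"
    by (simp_all add: power2_eq_iff_nonneg)
  then have "k$2 = l$2" "k$3 = l$3" by linarith+
  then show "k = l" using eq1 by (simp add: vec_eq_iff forall_3)
qed


section \<open>The orbit space\<close>

lemma continuous_on_normal_form: "continuous_on S normal_form"
proof -
  have "linear normal_form"
    by (simp add: linear_iff normal_form_def algebra_simps)
  then show ?thesis by (rule linear_continuous_on[OF linear_conv_bounded_linear[THEN iffD1]])
qed

lemma compact_Delta: "compact Delta"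
proof -
  have "Delta = sphere 0 1 \<inter> {l. l$2 \<le> l$1} \<inter> {l. \<bar>l$3\<bar> \<le> l$2}"
    by (auto simp: Delta_def norm_eq_1 inner_vec_def sum_3 power2_eq_square)
  moreover have closed: "closed {l::real^3. l$2 \<le> l$1}" "closed {l::real^3. \<bar>l$3\<bar> \<le> l$2}"
    by (intro closed_Collect_le continuous_intros)+
  ultimately show ?thesis
    using compact_Int_closed[OF compact_Int_closed[OF compact_sphere[of 0 1] closed(1)] closed(2)]
    by (simp only:)
qed

text \<open>
  A closed subset of the triangle sweeps out a compact, hence closed, set of bivectors. So the
  triangle maps onto the orbit space by a closed continuous bijection.
\<close>

lemma orbit_space_homeomorphic:
  "homeomorphic_map (top_of_set Delta) (quotient_topology (top_of_set unit_bivectors) orbit)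
     (\<lambda>l. orbit (normal_form l))"
proof -
  let ?X = "top_of_set unit_bivectors" and ?T = "top_of_set Delta"
  let ?Y = "quotient_topology ?X orbit" and ?f = "\<lambda>l. orbit (normal_form l)"
  have q: "quotient_map ?X ?Y orbit" by (rule quotient_map_quotient_topology)
  have top: "topspace ?Y = orbit ` unit_bivectors"
    using quotient_imp_surjective_map[OF q] by simp
  have "continuous_map ?T ?X normal_form"
    using normal_form_Delta by (auto simp: continuous_on_normal_form)
  from continuous_map_compose[OF this quotient_imp_continuous_map[OF q]]
  have cont: "continuous_map ?T ?Y ?f" by (simp only: o_def)
  have surj: "?f ` topspace ?T = topspace ?Y"
  proof
    show "?f ` topspace ?T \<subseteq> topspace ?Y" by (auto simp: top normal_form_Delta)
    show "topspace ?Y \<subseteq> ?f ` topspace ?T"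
    proof
      fix U assume "U \<in> topspace ?Y"
      then obtain B where B: "B \<in> unit_bivectors" "U = orbit B" by (auto simp: top)
      obtain l where "l \<in> Delta" "normal_form l \<in> orbit B"
        using normal_form_exists[OF B(1)] by (metis act_orbit)
      then show "U \<in> ?f ` topspace ?T" using orbit_trans B(2) by force
    qed
  qed
  have inj: "inj_on ?f (topspace ?T)"
    by (rule inj_onI) (simp add: orbit_eq_iff Delta_unique)
  have "closed_map ?T ?Y ?f"
    unfolding closed_map_def
  proof (intro allI impI)
    fix C assume "closedin ?T C"
    then have C: "C \<subseteq> Delta" "compact C"
      using closedin_compact[OF compact_Delta] closedin_subset by fastforce+
    have "{B \<in> topspace ?X. orbit B \<in> ?f ` C} = (\<lambda>(g, l). act g (normal_form l)) ` (SO \<times> C)"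
    proof
      show "{B \<in> topspace ?X. orbit B \<in> ?f ` C} \<subseteq> (\<lambda>(g, l). act g (normal_form l)) ` (SO \<times> C)"
      proof
        fix B assume "B \<in> {B \<in> topspace ?X. orbit B \<in> ?f ` C}"
        then obtain l where "l \<in> C" "B \<in> orbit (normal_form l)" by (auto simp: orbit_eq_iff)
        then show "B \<in> (\<lambda>(g, l). act g (normal_form l)) ` (SO \<times> C)"
          by (auto simp: orbit_def)
      qed
      show "(\<lambda>(g, l). act g (normal_form l)) ` (SO \<times> C) \<subseteq> {B \<in> topspace ?X. orbit B \<in> ?f ` C}"
        using C(1) by (auto simp: act_unit_bivector normal_form_Delta subset_iff orbit_trans[OF act_orbit])
    qed
    moreover have "compact ((\<lambda>(g, l). act g (normal_form l)) ` (SO \<times> C))"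
      unfolding case_prod_unfold
      by (intro compact_continuous_image compact_Times compact_SO C continuous_on_act
          continuous_on_compose2[OF continuous_on_normal_form] continuous_intros) auto
    ultimately have "closedin ?X {B \<in> topspace ?X. orbit B \<in> ?f ` C}"
      by (metis (no_types, lifting) closed_subset compact_imp_closed mem_Collect_eq subsetI
          topspace_euclidean_subtopology)
    moreover have "?f ` C \<subseteq> topspace ?Y"
      using C(1) surj by auto
    ultimately show "closedin ?Y (?f ` C)"
      using q unfolding quotient_map_closedin by blast
  qed
  then show ?thesis
    using bijective_closed_imp_homeomorphic_map cont surj inj by blast
qed

lemma e2_inner: "e2 i j \<bullet> e2 k n = 2 * (of_bool (i = k \<and> j = n) - of_bool (i = n \<and> j = k))"
  using bivector_inner_wedge[of "axis i 1" "axis j 1" "axis k 1" "axis n 1"]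
  by (auto simp: e2_def bivector_inner_def inner_axis_axis)

lemma dim_bivectors: "dim bivectors = 15"
proof -
  define P :: "(6 \<times> 6) set" where "P = {(1, 2), (1, 3), (1, 4), (1, 5), (1, 6), (2, 3), (2, 4),
    (2, 5), (2, 6), (3, 4), (3, 5), (3, 6), (4, 5), (4, 6), (5, 6)}"
  define b where "b = (\<lambda>(i, j). e2 i j)"
  have P: "(j, i) \<notin> P" "i \<noteq> j" if "(i, j) \<in> P" for i j
    using that unfolding P_def by (elim insertE emptyE Pair_inject; simp)+
  have b_inner: "b x \<bullet> b y = (if x = y then 2 else 0)" if "x \<in> P" "y \<in> P" for x y
    using that P by (cases x; cases y) (auto simp: b_def e2_inner)
  have inj: "inj_on b P"
    by (rule inj_onI) (metis b_inner zero_neq_numeral)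
  have "independent (b ` P)"
    by (rule pairwise_orthogonal_independent)
      (use b_inner in \<open>force simp: pairwise_def orthogonal_def\<close>)+
  moreover have "card (b ` P) = 15"
    using inj by (simp add: card_image) (simp add: P_def)
  moreover have "b ` P \<subseteq> bivectors"
    by (auto simp: b_def e2_def wedge_bivector)
  moreover have "bivectors \<subseteq> span (b ` P)"
  proof
    fix B assume B: "B \<in> bivectors"
    note skew = bivectors_nth[OF B]
    have diag: "B $ i $ i = 0" for i using skew[of i i] by simp
    have "B = (\<Sum>x\<in>P. (B $ fst x $ snd x) *\<^sub>R b x)"
      using skew[of 2 1] skew[of 3 1] skew[of 4 1] skew[of 5 1] skew[of 6 1] skew[of 3 2] skew[of 4 2]
        skew[of 5 2] skew[of 6 2] skew[of 4 3] skew[of 5 3] skew[of 6 3] skew[of 5 4] skew[of 6 4]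
        skew[of 6 5] diag
      by (simp add: P_def b_def vec_eq_iff forall_6 e2_def wedge_def axis_def)
    also have "\<dots> \<in> span (b ` P)"
      by (intro span_sum span_scale span_base imageI)
    finally show "B \<in> span (b ` P)" .
  qed
  ultimately show ?thesis using dim_unique by blast
qed


section \<open>Local sections of the orbit maps\<close>

lemma mult_vec_minus: "A *v (- x) = - (A *v x)" for A :: "real^'n^'m"
  by (rule linear_neg[OF matrix_vector_mul_linear])

lemma eventually_nhds_isCont:
  assumes "isCont f x" "eventually P (nhds (f x))"
  shows "eventually (\<lambda>w. P (f w)) (nhds x)"
proof -
  have "eventually (\<lambda>w. P (f w)) (at x)"
    using assms unfolding isCont_def filterlim_iff by blast
  then show ?thesis
    using eventually_nhds_x_imp_x[OF assms(2)] by (simp add: eventually_nhds_conv_at)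
qed

lemma smooth_at_eventually_pos:
  fixes f :: "'a::euclidean_space \<Rightarrow> real"
  assumes "smooth_at x f" "f x > 0" shows "eventually (\<lambda>w. f w > 0) (nhds x)"
proof (rule eventually_nhds_isCont[OF smooth_at_isCont[OF assms(1)]])
  show "eventually (\<lambda>t. t > 0) (nhds (f x))"
    using eventually_nhds_in_open[of "{0<..}" "f x"] assms(2) by simp
qed

text \<open>
  Part of a moving orthonormal frame along a set N near b, equal to the standard frame at b. The
  frames below are adapted to the bivector that they depend on.
\<close>

definition smooth_frame ::
  "real^6^6 \<Rightarrow> (real^6^6) set \<Rightarrow> 6 set \<Rightarrow> (6 \<Rightarrow> real^6^6 \<Rightarrow> real^6) \<Rightarrow> bool" where
  "smooth_frame b N I a \<longleftrightarrow>
     (\<forall>i\<in>I. smooth_at b (a i) \<and> a i b = axis i 1) \<and>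
     eventually (\<lambda>w. w \<in> N \<longrightarrow> (\<forall>i\<in>I. \<forall>j\<in>I. a i w \<bullet> a j w = of_bool (i = j))) (nhds b)"

lemma smooth_frame_empty: "smooth_frame b N {} a"
  by (simp add: smooth_frame_def)

lemma smooth_frame_insert:
  assumes "smooth_frame b N I a" "k \<notin> I" "smooth_at b y" "y b = axis k 1"
    and "eventually (\<lambda>w. w \<in> N \<longrightarrow> y w \<bullet> y w = 1 \<and> (\<forall>i\<in>I. a i w \<bullet> y w = 0)) (nhds b)"
  shows "smooth_frame b N (insert k I) (a(k := y))"
proof -
  have "eventually (\<lambda>w. w \<in> N \<longrightarrow> (\<forall>i\<in>insert k I. \<forall>j\<in>insert k I.
      (a(k := y)) i w \<bullet> (a(k := y)) j w = of_bool (i = j))) (nhds b)"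
    using assms(1)[unfolded smooth_frame_def, THEN conjunct2] assms(5)
  proof eventually_elim
    case (elim w)
    then show ?case using assms(2) by (auto simp: inner_commute)
  qed
  moreover have "\<forall>i\<in>insert k I. smooth_at b ((a(k := y)) i) \<and> (a(k := y)) i b = axis i 1"
    using assms(1,3,4) unfolding smooth_frame_def by auto
  ultimately show ?thesis unfolding smooth_frame_def by blast
qed

definition residual :: "6 set \<Rightarrow> (6 \<Rightarrow> 'w \<Rightarrow> real^6) \<Rightarrow> ('w \<Rightarrow> real^6) \<Rightarrow> 'w \<Rightarrow> real^6" where
  "residual I a x w = x w - (\<Sum>i\<in>I. (a i w \<bullet> x w) *\<^sub>R a i w)"

lemma smooth_frame_Gram_Schmidt:
  assumes a: "smooth_frame b N I a" and k: "k \<notin> I" and x: "smooth_at b x" "x b = axis k 1"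
  shows "\<exists>c. smooth_frame b N (insert k I) (a(k := (\<lambda>w. c w *\<^sub>R residual I a x w)))"
proof -
  let ?r = "residual I a x"
  define c where "c = (\<lambda>w. (?r w \<bullet> ?r w) powr (-1/2))"
  have r: "smooth_at b ?r"
    unfolding residual_def using a x by (auto simp: smooth_frame_def intro!: smooth_intros)
  have "(\<Sum>i\<in>I. (a i b \<bullet> x b) *\<^sub>R a i b) = 0"
    using a k x(2) by (intro sum.neutral) (auto simp: smooth_frame_def inner_axis_axis)
  then have rb: "?r b = axis k 1" by (simp add: residual_def x(2))
  then have "?r b \<bullet> ?r b > 0" by (simp add: inner_axis_axis)
  then have pos: "eventually (\<lambda>w. ?r w \<bullet> ?r w > 0) (nhds b)"
    by (intro smooth_at_eventually_pos smooth_intros r)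
  have "smooth_frame b N (insert k I) (a(k := (\<lambda>w. c w *\<^sub>R ?r w)))"
  proof (rule smooth_frame_insert[OF a k])
    show "smooth_at b (\<lambda>w. c w *\<^sub>R ?r w)"
      unfolding c_def using r rb by (intro smooth_intros) (simp_all add: inner_axis_axis)
    show "c b *\<^sub>R ?r b = axis k 1" by (simp add: c_def rb inner_axis_axis)
    show "eventually (\<lambda>w. w \<in> N \<longrightarrow> (c w *\<^sub>R ?r w) \<bullet> (c w *\<^sub>R ?r w) = 1 \<and>
        (\<forall>i\<in>I. a i w \<bullet> (c w *\<^sub>R ?r w) = 0)) (nhds b)"
      using a[unfolded smooth_frame_def, THEN conjunct2] pos
    proof eventually_elim
      case (elim w)
      show ?case
      proof (intro impI conjI ballI)
        have "c w * c w = (?r w \<bullet> ?r w) powr (- 1)"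
          by (simp add: c_def flip: powr_add)
        then show "(c w *\<^sub>R ?r w) \<bullet> (c w *\<^sub>R ?r w) = 1"
          using elim(2) by (simp add: powr_minus_divide mult.assoc[symmetric])
      next
        fix i assume "w \<in> N" "i \<in> I"
        have "a i w \<bullet> ?r w = a i w \<bullet> x w - (\<Sum>j\<in>I. (a j w \<bullet> x w) * (a i w \<bullet> a j w))"
          by (simp add: residual_def inner_diff_right inner_sum_right)
        also have "(\<Sum>j\<in>I. (a j w \<bullet> x w) * (a i w \<bullet> a j w)) =
            (\<Sum>j\<in>I. if i = j then a j w \<bullet> x w else 0)"
          using elim(1) \<open>w \<in> N\<close> \<open>i \<in> I\<close> by (intro sum.cong) auto
        also have "\<dots> = a i w \<bullet> x w" using \<open>i \<in> I\<close> by (simp add: sum.delta')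
        finally show "a i w \<bullet> (c w *\<^sub>R ?r w) = 0" by simp
      qed
    qed
  qed
  then show ?thesis by blast
qed

text \<open>
  The standard basis vectors that are still missing are appended one after the other.
\<close>

lemma smooth_frame_complete:
  assumes "smooth_frame b N I a"
  shows "\<exists>a'. smooth_frame b N UNIV a' \<and> (\<forall>i\<in>I. a' i = a i)"
  using assms
proof (induction "card (- I)" arbitrary: I a)
  case 0
  then have "I = UNIV" by auto
  then show ?case using 0 by blast
next
  case (Suc n)
  then obtain k where k: "k \<notin> I" by (metis Compl_UNIV_eq UNIV_eq_I card.empty nat.distinct(1))
  obtain c where c: "smooth_frame b N (insert k I)
      (a(k := (\<lambda>w. c w *\<^sub>R residual I a (\<lambda>_. axis k 1) w)))"
    using smooth_frame_Gram_Schmidt[OF Suc.prems k smooth_at_const refl] by blast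
  have "- insert k I = - I - {k}" by auto
  then have "n = card (- insert k I)" using Suc.hyps(2) k by simp
  from Suc.hyps(1)[OF this c] show ?case using k by auto
qed

text \<open>
  For \<open>\<rho>\<close> among the squares of the parameters of l and w in the orbit of the normal form, the product of
  the three factors is the orthogonal projection onto the kernel of \<open>w\<^sup>2 + \<rho>\<close>, as a Lagrange polynomial
  in \<open>w\<^sup>2\<close>.
\<close>

definition spectral_factor :: "real \<Rightarrow> real \<Rightarrow> real^6^6 \<Rightarrow> real^6 \<Rightarrow> real^6" where
  "spectral_factor m \<rho> w v = (if m = \<rho> then v else (1 / (m - \<rho>)) *\<^sub>R (w *v (w *v v) + m *\<^sub>R v))"

definition spectral_projection :: "real^3 \<Rightarrow> real \<Rightarrow> real^6^6 \<Rightarrow> real^6 \<Rightarrow> real^6" where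
  "spectral_projection l \<rho> w v = spectral_factor ((l$1)\<^sup>2) \<rho> w
     (spectral_factor ((l$2)\<^sup>2) \<rho> w (spectral_factor ((l$3)\<^sup>2) \<rho> w v))"

lemma smooth_at_spectral_projection: "smooth_at b (\<lambda>w. spectral_projection l \<rho> w v)"
proof -
  have "smooth_at b (\<lambda>w. spectral_factor m \<rho> w (f w))" if "smooth_at b f" for f m
    using that by (cases "m = \<rho>") (simp_all add: spectral_factor_def smooth_intros)
  then show ?thesis unfolding spectral_projection_def by (simp add: smooth_at_const)
qed

lemma spectral_projection_act:
  assumes "g \<in> SO"
  shows "spectral_projection l \<rho> (act g w) (g *v v) = g *v spectral_projection l \<rho> w v"
proof -
  have "act g w *v (g *v v) = g *v (w *v v)" for v
    using assms by (simp add: act_mult_vec matrix_vector_mul_assoc[of "transpose g"] SO_cancel)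
  then have "spectral_factor m \<rho> (act g w) (g *v v) = g *v spectral_factor m \<rho> w v" for v m
    by (simp add: spectral_factor_def matrix_vector_mult_scaleR matrix_vector_right_distrib)
  then show ?thesis by (simp add: spectral_projection_def)
qed

lemma normal_form_square:
  "normal_form l *v (normal_form l *v x) =
     - vector [(l$1)\<^sup>2 * x$1, (l$1)\<^sup>2 * x$2, (l$2)\<^sup>2 * x$3, (l$2)\<^sup>2 * x$4, (l$3)\<^sup>2 * x$5, (l$3)\<^sup>2 * x$6]"
  by (simp add: normal_form_mult_vec vec_eq_iff forall_6 power2_eq_square)

lemma spectral_projection_eigenvector:
  assumes w: "w \<in> orbit (normal_form l)" and \<rho>: "\<rho> \<in> {(l$1)\<^sup>2, (l$2)\<^sup>2, (l$3)\<^sup>2}"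
  shows "w *v (w *v spectral_projection l \<rho> w v) = - \<rho> *\<^sub>R spectral_projection l \<rho> w v"
proof -
  obtain g where g: "g \<in> SO" "w = act g (normal_form l)" using w by (auto simp: orbit_def)
  have sq: "w *v (w *v (g *v x)) = g *v (normal_form l *v (normal_form l *v x))" for x
    using g by (simp add: act_mult_vec matrix_vector_mul_assoc[of "transpose g"] SO_cancel)
  have fac: "spectral_factor m \<rho> (normal_form l) x =
     (\<chi> i. (if m = \<rho> then 1 else (m - (vector [l$1, l$1, l$2, l$2, l$3, l$3] $ i)\<^sup>2) / (m - \<rho>)) * x $ i)" for m x
    by (cases "m = \<rho>")
      (simp_all add: spectral_factor_def normal_form_square vec_eq_iff forall_6 left_diff_distrib)
  have "normal_form l *v (normal_form l *v spectral_projection l \<rho> (normal_form l) x) =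
      - \<rho> *\<^sub>R spectral_projection l \<rho> (normal_form l) x" for x
    unfolding spectral_projection_def fac normal_form_square
    using \<rho> by (auto simp: vec_eq_iff forall_6)
  moreover have "spectral_projection l \<rho> w v =
      g *v spectral_projection l \<rho> (normal_form l) (transpose g *v v)"
    using spectral_projection_act[OF g(1), of l \<rho> "normal_form l" "transpose g *v v"] g
    by (simp add: matrix_vector_mul_assoc SO_cancel)
  ultimately show ?thesis by (simp add: sq matrix_vector_mult_scaleR mult_vec_minus)
qed

lemma spectral_projection_fixes:
  assumes "w *v (w *v v) = - \<rho> *\<^sub>R v" shows "spectral_projection l \<rho> w v = v"
proof -
  have "spectral_factor m \<rho> w v = v" for m
    using assms by (simp add: spectral_factor_def flip: scaleR_left.diff)
  then show ?thesis by (simp add: spectral_projection_def)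
qed

text \<open>
  The square of a skew matrix is symmetric, so its eigenspaces are orthogonal.
\<close>

lemma bivector_commutes_inner:
  assumes "w \<in> bivectors" "w *v (w *v x) = - \<rho> *\<^sub>R x" "w *v (w *v y) = - \<sigma> *\<^sub>R y" "\<rho> \<noteq> \<sigma>"
  shows "x \<bullet> y = 0"
proof -
  have "(w *v (w *v x)) \<bullet> y = x \<bullet> (w *v (w *v y))"
    using bivector_mult_inner[OF assms(1)] by simp
  then have "\<rho> * (x \<bullet> y) = \<sigma> * (x \<bullet> y)" using assms(2,3) by simp
  then show ?thesis using assms(4) by simp
qed

text \<open>
  This is how the frames follow w: in an invariant plane the second vector is determined by the first
  one.
\<close>

lemma bivector_rotates_plane:
  assumes "w \<in> bivectors" "w *v (w *v a) = - (m\<^sup>2) *\<^sub>R a" "a \<bullet> a = 1" "m \<noteq> 0"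
  defines "a' \<equiv> (- 1 / m) *\<^sub>R (w *v a)"
  shows "w *v a = - m *\<^sub>R a'" "w *v a' = m *\<^sub>R a" "a' \<bullet> a' = 1" "a \<bullet> a' = 0"
proof -
  show 1: "w *v a = - m *\<^sub>R a'" using assms(4) by (simp add: a'_def)
  have "w *v a' = (m\<^sup>2 / m) *\<^sub>R a" by (simp add: a'_def matrix_vector_mult_scaleR mult_vec_minus assms(2))
  then show 2: "w *v a' = m *\<^sub>R a" using assms(4) by (simp add: power2_eq_square)
  have "(w *v a') \<bullet> a = - (a' \<bullet> (w *v a))" by (rule bivector_mult_inner[OF assms(1)])
  then show "a' \<bullet> a' = 1" using assms(3,4) unfolding 1 2 by simp
  show "a \<bullet> a' = 0" using bivector_mult_orthogonal[OF assms(1), of a] by (simp add: a'_def)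
qed

text \<open>
  The rotated vector stays orthogonal to the others if w maps these into the complement of the vector
  that is rotated.
\<close>

lemma smooth_frame_rotate:
  assumes a: "smooth_frame b N I a" and i: "i \<in> I" "k \<notin> I" and m: "m \<noteq> 0"
    and N: "N \<subseteq> bivectors" and b: "b *v axis i 1 = - m *\<^sub>R axis k 1"
    and sq: "eventually (\<lambda>w. w \<in> N \<longrightarrow> w *v (w *v a i w) = - (m\<^sup>2) *\<^sub>R a i w) (nhds b)"
    and inv: "eventually (\<lambda>w. w \<in> N \<longrightarrow> (\<forall>j\<in>I - {i}. (w *v a j w) \<bullet> a i w = 0)) (nhds b)"
  shows "smooth_frame b N (insert k I) (a(k := (\<lambda>w. (- 1 / m) *\<^sub>R (w *v a i w))))"
proof (rule smooth_frame_insert[OF a i(2)])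
  have ai: "smooth_at b (a i)" "a i b = axis i 1" using a i by (auto simp: smooth_frame_def)
  show "smooth_at b (\<lambda>w. (- 1 / m) *\<^sub>R (w *v a i w))" by (intro smooth_intros ai)
  show "(- 1 / m) *\<^sub>R (b *v a i b) = axis k 1" using m by (simp add: ai b)
  show "eventually (\<lambda>w. w \<in> N \<longrightarrow>
      ((- 1 / m) *\<^sub>R (w *v a i w)) \<bullet> ((- 1 / m) *\<^sub>R (w *v a i w)) = 1 \<and>
      (\<forall>j\<in>I. a j w \<bullet> ((- 1 / m) *\<^sub>R (w *v a i w)) = 0)) (nhds b)"
    using a[unfolded smooth_frame_def, THEN conjunct2] sq inv
  proof eventually_elim
    case (elim w)
    show ?case
    proof (intro impI conjI ballI)
      assume w: "w \<in> N"
      then have wb: "w \<in> bivectors" using N by blast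
      have "a i w \<bullet> a i w = 1" using elim(1) i w by simp
      note rot = bivector_rotates_plane[OF wb _ this m]
      show "((- 1 / m) *\<^sub>R (w *v a i w)) \<bullet> ((- 1 / m) *\<^sub>R (w *v a i w)) = 1"
        using rot(3) elim(2) w by blast
      fix j assume j: "j \<in> I"
      show "a j w \<bullet> ((- 1 / m) *\<^sub>R (w *v a i w)) = 0"
      proof (cases "j = i")
        case True
        then show ?thesis using rot(4) elim(2) w by blast
      next
        case False
        then have "(w *v a j w) \<bullet> a i w = 0" using elim(3) w j by blast
        then show ?thesis using bivector_mult_inner[OF wb, of "a j w" "a i w"] by simp
      qed
    qed
  qed
qed

text \<open>
  The determinant of the frame is 1 at b and stays positive near b, so the frame is a rotation.
\<close>

lemma section_of_frame:
  assumes a: "smooth_frame b N UNIV a" and N: "N \<subseteq> bivectors"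
    and eq: "eventually (\<lambda>w. w \<in> N \<longrightarrow>
      (\<forall>g. g \<in> SO \<and> (\<forall>i. g *v axis i 1 = a i w) \<longrightarrow> act (transpose g) w = b)) (nhds b)"
  shows "\<exists>s. smooth_at b s \<and>
    eventually (\<lambda>w. w \<in> N \<longrightarrow> s w \<in> SO \<and> act (s w) b = w) (nhds b)"
proof -
  define s :: "real^6^6 \<Rightarrow> real^6^6" where "s = (\<lambda>w. \<chi> i j. a j w $ i)"
  have smooth: "smooth_at b s"
    unfolding s_def using a by (auto simp: smooth_frame_def intro!: smooth_intros)
  have "s b = mat 1"
    using a by (simp add: s_def smooth_frame_def vec_eq_iff mat_def axis_def)
  then have "eventually (\<lambda>w. det (s w) > 0) (nhds b)"
    by (intro smooth_at_eventually_pos smooth_at_det smooth) simp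
  with a[unfolded smooth_frame_def, THEN conjunct2] eq
  have "eventually (\<lambda>w. w \<in> N \<longrightarrow> s w \<in> SO \<and> act (s w) b = w) (nhds b)"
  proof eventually_elim
    case (elim w)
    show ?case
    proof
      assume w: "w \<in> N"
      have "(transpose (s w) ** s w) $ i $ j = a i w \<bullet> a j w" for i j
        by (simp add: s_def matrix_matrix_mult_def transpose_def inner_vec_def)
      then have "transpose (s w) ** s w = mat 1"
        using elim(1) w by (simp add: vec_eq_iff mat_def)
      then have "orthogonal_matrix (s w)" by (simp add: orthogonal_matrix)
      moreover from this have "det (s w) = 1"
        using det_orthogonal_matrix elim(3) by force
      ultimately have SO: "s w \<in> SO" by (simp add: SO_iff)
      have "s w *v axis i 1 = a i w" for i
        by (simp add: matrix_vector_mult_basis column_def s_def)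
      then have "act (transpose (s w)) w = b" using elim(2) w SO by blast
      then have "act (s w) b = w" using act_transpose_act(2)[OF SO, of w] by simp
      then show "s w \<in> SO \<and> act (s w) b = w" using SO by blast
    qed
  qed
  then show ?thesis using smooth by blast
qed

lemma act_transpose_nth:
  "act (transpose g) w $ i $ j = (g *v axis i 1) \<bullet> (w *v (g *v axis j 1))"
proof -
  have "act (transpose g) w $ i $ j = axis i 1 \<bullet> (act (transpose g) w *v axis j 1)"
    by (simp add: inner_axis' matrix_vector_mult_basis column_def)
  then show ?thesis by (simp add: act_mult_vec matrix_vector_inner)
qed

lemma orbit_bivectors: "B \<in> bivectors \<Longrightarrow> orbit B \<subseteq> bivectors"
  by (auto simp: orbit_def act_bivector)

lemma normal_form_axis:
  "normal_form l *v axis 1 1 = - (l$1) *\<^sub>R axis 2 1" "normal_form l *v axis 2 1 = l$1 *\<^sub>R axis 1 1"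
  "normal_form l *v axis 3 1 = - (l$2) *\<^sub>R axis 4 1" "normal_form l *v axis 4 1 = l$2 *\<^sub>R axis 3 1"
  by (simp_all add: normal_form_mult_vec vec_eq_iff forall_6 axis_def)

lemma Delta_pos: "l \<in> Delta \<Longrightarrow> l$1 > 0"
  by (smt (verit) Delta_def mem_Collect_eq power_zero_numeral)

text \<open>
  The frame starts with the planes on which w is a known nonzero multiple of a rotation by a right angle,
  one if l$2 vanishes and two otherwise. The remaining vectors only have to be orthonormal: w preserves
  their span, and what it does there is determined by the norm in the first case and by the Pfaffian in
  the second one.
\<close>

lemma local_section_normal_form:
  assumes l: "l \<in> Delta"
  shows "\<exists>s. smooth_at (normal_form l) s \<and>
    eventually (\<lambda>w. w \<in> orbit (normal_form l) \<longrightarrow> s w \<in> SO \<and> act (s w) (normal_form l) = w)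
      (nhds (normal_form l))"
proof -
  define b where "b = normal_form l"
  define N where "N = orbit b"
  have N: "N \<subseteq> bivectors" by (simp add: N_def b_def orbit_bivectors normal_form_bivector)
  have l1: "l$1 \<noteq> 0" using Delta_pos[OF l] by simp
  define x1 where "x1 = (\<lambda>w. spectral_projection l ((l$1)\<^sup>2) w (axis 1 1))"
  have "b *v (b *v axis 1 1) = - ((l$1)\<^sup>2) *\<^sub>R axis 1 1"
    by (simp add: b_def normal_form_square vec_eq_iff forall_6 axis_def)
  then have "x1 b = axis 1 1"
    unfolding x1_def by (rule spectral_projection_fixes)
  moreover have "smooth_at b x1"
    unfolding x1_def by (rule smooth_at_spectral_projection)
  ultimately have x1: "smooth_at b x1" "x1 b = axis 1 1" by blast+
  have x1_sq: "w *v (w *v x1 w) = - ((l$1)\<^sup>2) *\<^sub>R x1 w" if "w \<in> N" for w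
    using that unfolding x1_def N_def b_def by (intro spectral_projection_eigenvector) auto
  \<comment> \<open>With respect to an empty frame, the residual of x1 is x1 itself.\<close>
  obtain c where f1: "smooth_frame b N {1} ((\<lambda>_ _. 0)(1 := (\<lambda>w. c w *\<^sub>R residual {} (\<lambda>_ _. 0) x1 w)))"
    using smooth_frame_Gram_Schmidt[OF smooth_frame_empty _ x1] by blast
  define a1 where "a1 = (\<lambda>w. c w *\<^sub>R x1 w)"
  define a2 where "a2 = (\<lambda>w. (- 1 / l$1) *\<^sub>R (w *v a1 w))"
  define A1 :: "6 \<Rightarrow> real^6^6 \<Rightarrow> real^6" where "A1 = (\<lambda>_ _. 0)(1 := a1)"
  define A2 where "A2 = A1(2 := a2)"
  have f1: "smooth_frame b N {1} A1"
    using f1 by (simp add: A1_def a1_def residual_def)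
  have a1_sq: "w *v (w *v a1 w) = - ((l$1)\<^sup>2) *\<^sub>R a1 w" if "w \<in> N" for w
    using x1_sq[OF that] by (simp add: a1_def matrix_vector_mult_scaleR)
  have f2: "smooth_frame b N {1, 2} A2"
    using smooth_frame_rotate[OF f1 _ _ l1 N, of 1 2] a1_sq
    by (simp add: A1_def A2_def a2_def b_def normal_form_axis insert_commute fun_upd_def)
  have a12: "w *v a1 w = - (l$1) *\<^sub>R a2 w" "w *v a2 w = l$1 *\<^sub>R a1 w" if "w \<in> N" "a1 w \<bullet> a1 w = 1" for w
    using bivector_rotates_plane[of w "a1 w" "l$1"] a1_sq that l1 N unfolding a2_def by auto
  show ?thesis
  proof (cases "l$2 = 0")
    case True
    then have l0: "l$3 = 0" using l unfolding Delta_def by simp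
    obtain A where f: "smooth_frame b N UNIV A" and A: "\<forall>i\<in>{1, 2}. A i = A2 i"
      using smooth_frame_complete[OF f2] by blast
    have A12: "A 1 = a1" "A 2 = a2" using A by (simp_all add: A2_def A1_def)
    show ?thesis
      unfolding b_def[symmetric] N_def[symmetric]
    proof (rule section_of_frame[OF f N])
      show "eventually (\<lambda>w. w \<in> N \<longrightarrow> (\<forall>g. g \<in> SO \<and> (\<forall>i. g *v axis i 1 = A i w) \<longrightarrow>
          act (transpose g) w = b)) (nhds b)"
        using f[unfolded smooth_frame_def, THEN conjunct2]
      proof eventually_elim
        case (elim w)
        show ?case
        proof (intro impI allI, elim conjE)
          fix g assume w: "w \<in> N" and g: "g \<in> SO" "\<forall>i. g *v axis i 1 = A i w"
          let ?M = "act (transpose g) w"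
          have "a1 w \<bullet> a1 w = 1" using elim w A12 by auto
          note rot = a12[OF w this]
          have "?M $ 1 $ 2 = l$1" "?M $ 2 $ 1 = - (l$1)"
            using elim w g(2) rot A12 by (auto simp: act_transpose_nth)
          then have "?M \<bullet> b = 2 * (l$1)\<^sup>2"
            by (simp add: b_def normal_form_matrix inner_vec_def sum_6 True l0 power2_eq_square)
          moreover have "?M \<bullet> ?M = b \<bullet> b"
          proof -
            obtain h where "h \<in> SO" "w = act h b" using w by (auto simp: N_def orbit_def)
            then show ?thesis by (simp add: act_inner_act g SO_transpose)
          qed
          moreover have "b \<bullet> b = 2 * (l$1)\<^sup>2"
            by (simp add: b_def normal_form_inner True l0 power2_eq_square)
          ultimately have "(?M - b) \<bullet> (?M - b) = 0"
            by (simp add: inner_diff_left inner_diff_right inner_commute)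
          then show "?M = b" by simp
        qed
      qed
    qed
  next
    case False
    define x3 where "x3 = (\<lambda>w. spectral_projection l ((l$2)\<^sup>2) w (axis 3 1))"
    have "b *v (b *v axis 3 1) = - ((l$2)\<^sup>2) *\<^sub>R axis 3 1"
      by (simp add: b_def normal_form_square vec_eq_iff forall_6 axis_def)
    then have "x3 b = axis 3 1"
      unfolding x3_def by (rule spectral_projection_fixes)
    moreover have "smooth_at b x3"
      unfolding x3_def by (rule smooth_at_spectral_projection)
    ultimately have x3: "smooth_at b x3" "x3 b = axis 3 1" by blast+
    have x3_sq: "w *v (w *v x3 w) = - ((l$2)\<^sup>2) *\<^sub>R x3 w" if "w \<in> N" for w
      using that unfolding x3_def N_def b_def by (intro spectral_projection_eigenvector) auto
    obtain d where f3: "smooth_frame b N (insert 3 {1, 2}) (A2(3 := (\<lambda>w. d w *\<^sub>R residual {1, 2} A2 x3 w)))"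
      using smooth_frame_Gram_Schmidt[OF f2 _ x3] by auto
    define a3 where "a3 = (\<lambda>w. d w *\<^sub>R residual {1, 2} A2 x3 w)"
    define a4 where "a4 = (\<lambda>w. (- 1 / l$2) *\<^sub>R (w *v a3 w))"
    define A3 where "A3 = A2(3 := a3)"
    define A4 where "A4 = A3(4 := a4)"
    have f3: "smooth_frame b N (insert 3 {1, 2}) A3" using f3 by (simp add: A3_def a3_def)
    have A3: "A3 1 = a1" "A3 2 = a2" "A3 3 = a3" by (simp_all add: A3_def A2_def A1_def)
    \<comment> \<open>The residual stays in the eigenspace of x3: the vectors a1 and a2 either belong to the same\<close>
    \<comment> \<open>eigenspace or are orthogonal to x3.\<close>
    have a3_sq: "w *v (w *v a3 w) = - ((l$2)\<^sup>2) *\<^sub>R a3 w" if w: "w \<in> N" "a1 w \<bullet> a1 w = 1" for w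
    proof -
      let ?r = "x3 w - (a1 w \<bullet> x3 w) *\<^sub>R a1 w - (a2 w \<bullet> x3 w) *\<^sub>R a2 w"
      have r: "residual {1, 2} A2 x3 w = ?r"
        by (simp add: residual_def A2_def A1_def algebra_simps)
      have a2_sq: "w *v (w *v a2 w) = - ((l$1)\<^sup>2) *\<^sub>R a2 w"
        by (simp add: a12[OF w] matrix_vector_mult_scaleR power2_eq_square)
      have "w *v (w *v ?r) = - ((l$2)\<^sup>2) *\<^sub>R ?r"
      proof (cases "(l$1)\<^sup>2 = (l$2)\<^sup>2")
        case True
        then show ?thesis
          using a1_sq[OF w(1)] a2_sq x3_sq[OF w(1)]
          by (simp add: matrix_vector_mult_diff_distrib matrix_vector_mult_scaleR algebra_simps)
      next
        case False
        have "a1 w \<bullet> x3 w = 0" "a2 w \<bullet> x3 w = 0"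
          using bivector_commutes_inner[OF _ a1_sq[OF w(1)] x3_sq[OF w(1)] False]
            bivector_commutes_inner[OF _ a2_sq x3_sq[OF w(1)] False] N w(1) by auto
        then show ?thesis by (simp add: x3_sq[OF w(1)])
      qed
      then show ?thesis by (simp add: a3_def r matrix_vector_mult_scaleR)
    qed
    note ev3 = f3[unfolded smooth_frame_def, THEN conjunct2]
    have f4: "smooth_frame b N (insert 4 (insert 3 {1, 2})) A4"
      unfolding A4_def a4_def A3(3)[symmetric]
    proof (rule smooth_frame_rotate[OF f3 _ _ False N])
      show "b *v axis 3 1 = - (l $ 2) *\<^sub>R axis 4 1" by (simp add: b_def normal_form_axis)
      show "eventually (\<lambda>w. w \<in> N \<longrightarrow> w *v (w *v A3 3 w) = - ((l $ 2)\<^sup>2) *\<^sub>R A3 3 w) (nhds b)"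
        using ev3
      proof eventually_elim
        case (elim w)
        then show ?case using a3_sq[of w] A3 by auto
      qed
      show "eventually (\<lambda>w. w \<in> N \<longrightarrow> (\<forall>j\<in>insert 3 {1, 2} - {3}. (w *v A3 j w) \<bullet> A3 3 w = 0)) (nhds b)"
        using ev3
      proof eventually_elim
        case (elim w)
        show ?case
        proof
          assume w: "w \<in> N"
          have o: "a1 w \<bullet> a1 w = 1" "a1 w \<bullet> a3 w = 0" "a2 w \<bullet> a3 w = 0"
            using elim w A3 by auto
          show "\<forall>j\<in>insert 3 {1, 2} - {3}. (w *v A3 j w) \<bullet> A3 3 w = 0"
            using a12[OF w o(1)] o(2,3) A3 by auto
        qed
      qed
    qed auto
    have a34: "w *v a3 w = - (l$2) *\<^sub>R a4 w" "w *v a4 w = l$2 *\<^sub>R a3 w"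
      if "w \<in> N" "a1 w \<bullet> a1 w = 1" "a3 w \<bullet> a3 w = 1" for w
      using bivector_rotates_plane[of w "a3 w" "l$2"] a3_sq that False N unfolding a4_def by auto
    obtain A where f: "smooth_frame b N UNIV A" and A: "\<forall>i\<in>insert 4 (insert 3 {1, 2}). A i = A4 i"
      using smooth_frame_complete[OF f4] by blast
    have A: "A 1 = a1" "A 2 = a2" "A 3 = a3" "A 4 = a4"
      using A by (simp_all add: A4_def A3_def A2_def A1_def)
    show ?thesis
      unfolding b_def[symmetric] N_def[symmetric]
    proof (rule section_of_frame[OF f N])
      show "eventually (\<lambda>w. w \<in> N \<longrightarrow> (\<forall>g. g \<in> SO \<and> (\<forall>i. g *v axis i 1 = A i w) \<longrightarrow>
          act (transpose g) w = b)) (nhds b)"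
        using f[unfolded smooth_frame_def, THEN conjunct2]
      proof eventually_elim
        case (elim w)
        show ?case
        proof (intro impI allI, elim conjE)
          fix g assume w: "w \<in> N" and g: "g \<in> SO" "\<forall>i. g *v axis i 1 = A i w"
          let ?M = "act (transpose g) w"
          have on: "A i w \<bullet> A j w = of_bool (i = j)" for i j using elim w by simp
          have "a1 w \<bullet> a1 w = 1" "a3 w \<bullet> a3 w = 1" using on[of 1 1] on[of 3 3] A by auto
          note rot = a12[OF w this(1)] a34[OF w this]
          have "w *v A 1 w = - (l$1) *\<^sub>R A 2 w" "w *v A 2 w = l$1 *\<^sub>R A 1 w"
            "w *v A 3 w = - (l$2) *\<^sub>R A 4 w" "w *v A 4 w = l$2 *\<^sub>R A 3 w"
            using rot A by simp_all
          then have col: "?M $ j $ 1 = - (l$1) * of_bool (j = 2)" "?M $ j $ 2 = l$1 * of_bool (j = 1)"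
            "?M $ j $ 3 = - (l$2) * of_bool (j = 4)" "?M $ j $ 4 = l$2 * of_bool (j = 3)" for j
            using g(2) on by (simp_all add: act_transpose_nth)
          have "?M \<in> bivectors" using w N by (auto intro: act_bivector)
          note skew = bivectors_nth[OF this]
          define k :: "real^3" where "k = vector [l$1, l$2, ?M $ 5 $ 6]"
          have M: "?M = normal_form k"
            using skew[of 1 5] skew[of 1 6] skew[of 2 5] skew[of 2 6] skew[of 3 5] skew[of 3 6]
              skew[of 4 5] skew[of 4 6] skew[of 5 5] skew[of 6 6] skew[of 6 5]
            by (simp add: vec_eq_iff forall_6 normal_form_matrix k_def col)
          obtain h where h: "h \<in> SO" "w = act h b" using w by (auto simp: N_def orbit_def)
          have "Pfaffian ?M = Pfaffian b"
            using g(1) h by (simp add: Pfaffian_act SO_iff)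
          then have "k$3 = l$3"
            using l1 False unfolding M b_def by (simp add: Pfaffian_normal_form k_def)
          then have "k = l" by (simp add: k_def vec_eq_iff forall_3)
          then show "?M = b" by (simp add: M b_def)
        qed
      qed
    qed
  qed
qed

lemma stabilizer_act:
  assumes "k \<in> SO"
  shows "stabilizer (act k B) = (\<lambda>h. k ** h ** transpose k) ` stabilizer B"
proof
  show "(\<lambda>h. k ** h ** transpose k) ` stabilizer B \<subseteq> stabilizer (act k B)"
  proof clarify
    fix h assume "h \<in> stabilizer B"
    then have h: "h \<in> SO" "act h B = B" by (auto simp: stabilizer_def)
    have "act (k ** h ** transpose k) (act k B) = act k (act h (act (transpose k) (act k B)))"
      by (simp only: act_act matrix_mul_assoc)
    then show "k ** h ** transpose k \<in> stabilizer (act k B)"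
      using h assms by (simp add: stabilizer_def SO_mult SO_transpose act_transpose_act)
  qed
  show "stabilizer (act k B) \<subseteq> (\<lambda>h. k ** h ** transpose k) ` stabilizer B"
  proof
    fix g assume "g \<in> stabilizer (act k B)"
    then have g: "g \<in> SO" "act g (act k B) = act k B" by (auto simp: stabilizer_def)
    have "act (transpose k ** g ** k) B = act (transpose k) (act g (act k B))"
      by (simp only: act_act matrix_mul_assoc)
    then have "transpose k ** g ** k \<in> stabilizer B"
      using g assms by (simp add: stabilizer_def SO_mult SO_transpose act_transpose_act)
    moreover have "k ** (transpose k ** g ** k) ** transpose k = (k ** transpose k) ** g ** (k ** transpose k)"
      by (simp only: matrix_mul_assoc)
    then have "g = k ** (transpose k ** g ** k) ** transpose k"
      using assms by (simp add: SO_cancel)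
    ultimately show "g \<in> (\<lambda>h. k ** h ** transpose k) ` stabilizer B" by blast
  qed
qed

lemma left_coset_stabilizer_eq_iff:
  assumes "x \<in> SO" "y \<in> SO"
  shows "left_coset (stabilizer B) x = left_coset (stabilizer B) y \<longleftrightarrow> act x B = act y B"
proof
  assume "left_coset (stabilizer B) x = left_coset (stabilizer B) y"
  moreover have "x \<in> left_coset (stabilizer B) x"
    unfolding left_coset_def by (rule image_eqI[of _ _ "mat 1"]) (simp_all add: stabilizer_def mat_1_SO)
  ultimately obtain h where "h \<in> stabilizer B" "x = y ** h" by (auto simp: left_coset_def)
  then show "act x B = act y B" by (simp add: stabilizer_def flip: act_act)
next
  have sub: "left_coset (stabilizer B) x \<subseteq> left_coset (stabilizer B) y"
    if "x \<in> SO" "y \<in> SO" "act x B = act y B" for x y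
  proof
    fix z assume "z \<in> left_coset (stabilizer B) x"
    then obtain h where h: "h \<in> SO" "act h B = B" "z = x ** h"
      by (auto simp: left_coset_def stabilizer_def)
    have "act (transpose y ** (x ** h)) B = act (transpose y) (act y B)"
      using h(2) that(3) by (simp flip: act_act)
    then have "transpose y ** (x ** h) \<in> stabilizer B"
      using h(1) that by (simp add: stabilizer_def SO_mult SO_transpose act_transpose_act)
    moreover have "z = y ** (transpose y ** (x ** h))"
      using that(2) h(3) by (simp add: matrix_mul_assoc SO_cancel)
    ultimately show "z \<in> left_coset (stabilizer B) y" by (auto simp: left_coset_def)
  qed
  assume "act x B = act y B"
  then show "left_coset (stabilizer B) x = left_coset (stabilizer B) y"
    using sub[OF assms] sub[OF assms(2,1)] by auto
qed

text \<open>
  The section near the normal form is carried to all other points of the orbit by equivariance.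
\<close>

lemma orbit_type:
  assumes l: "l \<in> Delta" and k: "k \<in> SO" and H: "stabilizer (act k (normal_form l)) = H"
  shows "conjugate_in_SO6 (stabilizer (normal_form l)) H \<and>
    homogeneous_diffeo (orbit (normal_form l)) H"
proof
  let ?B = "act k (normal_form l)" and ?N = "orbit (normal_form l)"
  have "stabilizer (normal_form l) = (\<lambda>h. transpose k ** h ** transpose (transpose k)) ` H"
    using stabilizer_act[OF SO_transpose[OF k], of ?B] k by (simp add: H act_transpose_act)
  then show "conjugate_in_SO6 (stabilizer (normal_form l)) H"
    unfolding conjugate_in_SO6_def using SO_transpose[OF k] by blast
  have N: "?N = orbit ?B" using orbit_trans[OF act_orbit[OF k]] by simp
  obtain s where s: "smooth_at (normal_form l) s"
    "eventually (\<lambda>w. w \<in> ?N \<longrightarrow> s w \<in> SO \<and> act (s w) (normal_form l) = w) (nhds (normal_form l))"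
    using local_section_normal_form[OF l] by blast
  have "\<exists>f. quotient_diffeomorphism SO (left_coset H) ?N f \<and>
      (\<forall>x\<in>SO. f (left_coset H x) = act x ?B)"
  proof (rule quotient_diffeomorphismI)
    show "(act x ?B = act y ?B) = (left_coset H x = left_coset H y)" if "x \<in> SO" "y \<in> SO" for x y
      using left_coset_stabilizer_eq_iff[OF that, of ?B] by (simp add: H)
    show "(\<lambda>x. act x ?B) ` SO = ?N" unfolding N by (simp only: orbit_def)
    show "smooth_at x (\<lambda>x. act x ?B)" for x by (intro smooth_intros)
    fix y assume "y \<in> ?N"
    then obtain m where m: "m \<in> SO" "y = act m (normal_form l)" by (auto simp: orbit_def)
    define t where "t = (\<lambda>w. act (transpose m) w)"
    have t: "smooth_at y t" "t y = normal_form l"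
      unfolding t_def using m by (auto simp: act_transpose_act intro!: smooth_intros)
    have "smooth_at y (\<lambda>w. s (t w))"
      by (rule smooth_at_compose) (simp_all add: s(1) t)
    then have "smooth_at y (\<lambda>w. m ** s (t w) ** transpose k)"
      by (intro smooth_at_matrix_mult smooth_at_const)
    moreover have "eventually (\<lambda>w. w \<in> ?N \<longrightarrow> m ** s (t w) ** transpose k \<in> SO \<and>
        act (m ** s (t w) ** transpose k) ?B = w) (nhds y)"
      using eventually_nhds_isCont[OF smooth_at_isCont[OF t(1)], unfolded t(2), OF s(2)]
    proof eventually_elim
      case (elim w)
      show ?case
      proof
        assume "w \<in> ?N"
        then have "t w \<in> ?N"
          unfolding t_def using act_orbit[OF SO_transpose[OF m(1)], of w] orbit_trans by blast
        with elim have "s (t w) \<in> SO" "act (s (t w)) (normal_form l) = t w" by blast+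
        then show "m ** s (t w) ** transpose k \<in> SO \<and> act (m ** s (t w) ** transpose k) ?B = w"
          using m(1) k by (simp add: SO_mult SO_transpose act_transpose_act t_def flip: act_act)
      qed
    qed
    ultimately show "\<exists>s. smooth_at y s \<and>
        eventually (\<lambda>w. w \<in> ?N \<longrightarrow> s w \<in> SO \<and> act (s w) ?B = w) (nhds y)" by blast
  qed
  then obtain f where f: "quotient_diffeomorphism SO (left_coset H) ?N f"
    "\<forall>x\<in>SO. f (left_coset H x) = act x ?B" by blast
  moreover have "f (left_coset H (g ** x)) = act g (f (left_coset H x))" if "g \<in> SO" "x \<in> SO" for g x
    using f(2) that SO_mult[OF that] by (simp add: act_act matrix_mul_assoc)
  ultimately show "homogeneous_diffeo ?N H" unfolding homogeneous_diffeo_def by blast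
qed


section \<open>The standard subgroups as block matrices\<close>

definition block_2_2_2 :: "real^2^2 \<Rightarrow> real^2^2 \<Rightarrow> real^2^2 \<Rightarrow> real^6^6" where
  "block_2_2_2 P Q R = vector [
     vector [P$1$1, P$1$2, 0, 0, 0, 0], vector [P$2$1, P$2$2, 0, 0, 0, 0],
     vector [0, 0, Q$1$1, Q$1$2, 0, 0], vector [0, 0, Q$2$1, Q$2$2, 0, 0],
     vector [0, 0, 0, 0, R$1$1, R$1$2], vector [0, 0, 0, 0, R$2$1, R$2$2]]"

definition block_4_2 :: "real^4^4 \<Rightarrow> real^2^2 \<Rightarrow> real^6^6" where
  "block_4_2 P Q = vector [
     vector [P$1$1, P$1$2, P$1$3, P$1$4, 0, 0], vector [P$2$1, P$2$2, P$2$3, P$2$4, 0, 0],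
     vector [P$3$1, P$3$2, P$3$3, P$3$4, 0, 0], vector [P$4$1, P$4$2, P$4$3, P$4$4, 0, 0],
     vector [0, 0, 0, 0, Q$1$1, Q$1$2], vector [0, 0, 0, 0, Q$2$1, Q$2$2]]"

definition block_2_4 :: "real^2^2 \<Rightarrow> real^4^4 \<Rightarrow> real^6^6" where
  "block_2_4 P Q = vector [
     vector [P$1$1, P$1$2, 0, 0, 0, 0], vector [P$2$1, P$2$2, 0, 0, 0, 0],
     vector [0, 0, Q$1$1, Q$1$2, Q$1$3, Q$1$4], vector [0, 0, Q$2$1, Q$2$2, Q$2$3, Q$2$4],
     vector [0, 0, Q$3$1, Q$3$2, Q$3$3, Q$3$4], vector [0, 0, Q$4$1, Q$4$2, Q$4$3, Q$4$4]]"

lemma block_2_2_2_iff: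
  "(\<forall>x y z. A *v R2_R2_R2 x y z = R2_R2_R2 (P *v x) (Q *v y) (R *v z)) \<longleftrightarrow> A = block_2_2_2 P Q R"
proof -
  have mult: "block_2_2_2 P Q R *v R2_R2_R2 x y z = R2_R2_R2 (P *v x) (Q *v y) (R *v z)" for x y z
    by (simp add: block_2_2_2_def R2_R2_R2_def matrix_vector_mult_def vec_eq_iff forall_6 sum_6 sum_2)
  have "v = R2_R2_R2 (vector [v$1, v$2]) (vector [v$3, v$4]) (vector [v$5, v$6])" for v
    by (simp add: R2_R2_R2_def vec_eq_iff forall_6)
  then show ?thesis by (metis matrix_eq mult)
qed

lemma block_4_2_iff:
  "(\<forall>x y. A *v R4_R2 x y = R4_R2 (P *v x) (Q *v y)) \<longleftrightarrow> A = block_4_2 P Q"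
proof -
  have mult: "block_4_2 P Q *v R4_R2 x y = R4_R2 (P *v x) (Q *v y)" for x y
    by (simp add: block_4_2_def R4_R2_def matrix_vector_mult_def vec_eq_iff forall_6 sum_6 sum_2 sum_4)
  have "v = R4_R2 (vector [v$1, v$2, v$3, v$4]) (vector [v$5, v$6])" for v
    by (simp add: R4_R2_def vec_eq_iff forall_6)
  then show ?thesis by (metis matrix_eq mult)
qed

lemma block_2_4_iff:
  "(\<forall>x y. A *v R2_R4 x y = R2_R4 (P *v x) (Q *v y)) \<longleftrightarrow> A = block_2_4 P Q"
proof -
  have mult: "block_2_4 P Q *v R2_R4 x y = R2_R4 (P *v x) (Q *v y)" for x y
    by (simp add: block_2_4_def R2_R4_def matrix_vector_mult_def vec_eq_iff forall_6 sum_6 sum_2 sum_4)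
  have "v = R2_R4 (vector [v$1, v$2]) (vector [v$3, v$4, v$5, v$6])" for v
    by (simp add: R2_R4_def vec_eq_iff forall_6)
  then show ?thesis by (metis matrix_eq mult)
qed

lemma block_mult:
  "block_2_2_2 P Q R ** block_2_2_2 P' Q' R' = block_2_2_2 (P ** P') (Q ** Q') (R ** R')"
  "block_4_2 S Q ** block_4_2 S' Q' = block_4_2 (S ** S') (Q ** Q')"
  "block_2_4 P S ** block_2_4 P' S' = block_2_4 (P ** P') (S ** S')"
  by (simp_all add: block_2_2_2_def block_4_2_def block_2_4_def matrix_matrix_mult_def vec_eq_iff
      forall_6 sum_6 sum_2 sum_4)

lemma block_transpose:
  "transpose (block_2_2_2 P Q R) = block_2_2_2 (transpose P) (transpose Q) (transpose R)"
  "transpose (block_4_2 S Q) = block_4_2 (transpose S) (transpose Q)"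
  "transpose (block_2_4 P S) = block_2_4 (transpose P) (transpose S)"
  by (simp_all add: block_2_2_2_def block_4_2_def block_2_4_def transpose_def vec_eq_iff forall_6)

lemma block_mat_1:
  "block_2_2_2 P Q R = mat 1 \<longleftrightarrow> P = mat 1 \<and> Q = mat 1 \<and> R = mat 1"
  "block_4_2 S Q = mat 1 \<longleftrightarrow> S = mat 1 \<and> Q = mat 1"
  "block_2_4 P S = mat 1 \<longleftrightarrow> P = mat 1 \<and> S = mat 1"
  by (auto simp: block_2_2_2_def block_4_2_def block_2_4_def mat_def vec_eq_iff
      forall_6 forall_4 forall_2)

lemma orthogonal_matrix_iff: "orthogonal_matrix A \<longleftrightarrow> A ** transpose A = mat 1" for A :: "real^'n^'n"
  using matrix_left_right_inverse[of A "transpose A"] by (auto simp: orthogonal_matrix_def)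

lemma orthogonal_block:
  "orthogonal_matrix (block_2_2_2 P Q R) \<longleftrightarrow>
     orthogonal_matrix P \<and> orthogonal_matrix Q \<and> orthogonal_matrix R"
  "orthogonal_matrix (block_4_2 S Q) \<longleftrightarrow> orthogonal_matrix S \<and> orthogonal_matrix Q"
  "orthogonal_matrix (block_2_4 P S) \<longleftrightarrow> orthogonal_matrix P \<and> orthogonal_matrix S"
  by (simp_all add: orthogonal_matrix_iff block_mult block_transpose block_mat_1)

definition real_matrix_2 :: "complex^2^2 \<Rightarrow> real^4^4" where
  "real_matrix_2 U = vector [
     vector [Re (U$1$1), - Im (U$1$1), Re (U$1$2), - Im (U$1$2)],
     vector [Im (U$1$1), Re (U$1$1), Im (U$1$2), Re (U$1$2)],
     vector [Re (U$2$1), - Im (U$2$1), Re (U$2$2), - Im (U$2$2)],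
     vector [Im (U$2$1), Re (U$2$1), Im (U$2$2), Re (U$2$2)]]"

definition real_matrix_3 :: "complex^3^3 \<Rightarrow> real^6^6" where
  "real_matrix_3 U = vector [
     vector [Re (U$1$1), - Im (U$1$1), Re (U$1$2), - Im (U$1$2), Re (U$1$3), - Im (U$1$3)],
     vector [Im (U$1$1), Re (U$1$1), Im (U$1$2), Re (U$1$2), Im (U$1$3), Re (U$1$3)],
     vector [Re (U$2$1), - Im (U$2$1), Re (U$2$2), - Im (U$2$2), Re (U$2$3), - Im (U$2$3)],
     vector [Im (U$2$1), Re (U$2$1), Im (U$2$2), Re (U$2$2), Im (U$2$3), Re (U$2$3)],
     vector [Re (U$3$1), - Im (U$3$1), Re (U$3$2), - Im (U$3$2), Re (U$3$3), - Im (U$3$3)],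
     vector [Im (U$3$1), Re (U$3$1), Im (U$3$2), Re (U$3$2), Im (U$3$3), Re (U$3$3)]]"

lemma real_matrix_2_iff:
  "(\<forall>z. A *v real_of_C2 z = real_of_C2 (U *v z)) \<longleftrightarrow> A = real_matrix_2 U"
proof -
  have mult: "real_matrix_2 U *v real_of_C2 z = real_of_C2 (U *v z)" for z
    by (simp add: real_matrix_2_def real_of_C2_def matrix_vector_mult_def vec_eq_iff forall_4 sum_4 sum_2)
  have "v = real_of_C2 (vector [Complex (v$1) (v$2), Complex (v$3) (v$4)])" for v
    by (simp add: real_of_C2_def vec_eq_iff forall_4)
  then show ?thesis by (metis matrix_eq mult)
qed

lemma real_matrix_3_iff:
  "(\<forall>z. A *v real_of_C3 z = real_of_C3 (U *v z)) \<longleftrightarrow> A = real_matrix_3 U"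
proof -
  have mult: "real_matrix_3 U *v real_of_C3 z = real_of_C3 (U *v z)" for z
    by (simp add: real_matrix_3_def real_of_C3_def matrix_vector_mult_def vec_eq_iff forall_6 sum_6 sum_3)
  have "v = real_of_C3 (vector [Complex (v$1) (v$2), Complex (v$3) (v$4), Complex (v$5) (v$6)])" for v
    by (simp add: real_of_C3_def vec_eq_iff forall_6)
  then show ?thesis by (metis matrix_eq mult)
qed

lemma orthogonal_real_matrix_2: "orthogonal_matrix (real_matrix_2 U) \<longleftrightarrow> U \<in> unitary_group"
proof -
  let ?V = "\<chi> i j. cnj (U $ j $ i)"
  have "real_matrix_2 U ** transpose (real_matrix_2 U) = real_matrix_2 (U ** ?V)"
    by (simp add: real_matrix_2_def matrix_matrix_mult_def transpose_def vec_eq_iff forall_4 sum_4 sum_2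
        algebra_simps)
  moreover have "real_matrix_2 W = mat 1 \<longleftrightarrow> W = mat 1" for W
    by (auto simp: real_matrix_2_def mat_def vec_eq_iff forall_4 forall_2 complex_eq_iff)
  ultimately show ?thesis by (simp add: orthogonal_matrix_iff unitary_group_def)
qed

lemma orthogonal_real_matrix_3: "orthogonal_matrix (real_matrix_3 U) \<longleftrightarrow> U \<in> unitary_group"
proof -
  let ?V = "\<chi> i j. cnj (U $ j $ i)"
  have "real_matrix_3 U ** transpose (real_matrix_3 U) = real_matrix_3 (U ** ?V)"
    by (simp add: real_matrix_3_def matrix_matrix_mult_def transpose_def vec_eq_iff forall_6 sum_6 sum_3
        algebra_simps)
  moreover have "real_matrix_3 W = mat 1 \<longleftrightarrow> W = mat 1" for W
    by (auto simp: real_matrix_3_def mat_def vec_eq_iff forall_6 forall_3 complex_eq_iff)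
  ultimately show ?thesis by (simp add: orthogonal_matrix_iff unitary_group_def)
qed

lemma T3_iff: "A \<in> T3 \<longleftrightarrow> (\<exists>P\<in>SO. \<exists>Q\<in>SO. \<exists>R\<in>SO. A = block_2_2_2 P Q R)"
  by (simp add: T3_def block_2_2_2_iff)

lemma U3_iff: "A \<in> U3 \<longleftrightarrow> (\<exists>U. A = real_matrix_3 U \<and> orthogonal_matrix A)"
  by (auto simp: U3_def real_matrix_3_iff orthogonal_real_matrix_3)

lemma U2_SO2_iff:
  "A \<in> U2_SO2 \<longleftrightarrow> (\<exists>U. \<exists>Q\<in>SO. A = block_4_2 (real_matrix_2 U) Q \<and> orthogonal_matrix (real_matrix_2 U))"
  by (auto simp: U2_SO2_def U2_def block_4_2_iff real_matrix_2_iff orthogonal_real_matrix_2)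

lemma SO2_SO4_iff: "A \<in> SO2_SO4 \<longleftrightarrow> (\<exists>P\<in>SO. \<exists>Q\<in>SO. A = block_2_4 P Q)"
  by (simp add: SO2_SO4_def block_2_4_iff)

lemma orthogonal_2_iff:
  "orthogonal_matrix (P :: real^2^2) \<longleftrightarrow>
     (P$1$1)\<^sup>2 + (P$2$1)\<^sup>2 = 1 \<and> P$1$1 * P$1$2 + P$2$1 * P$2$2 = 0 \<and> (P$1$2)\<^sup>2 + (P$2$2)\<^sup>2 = 1"
  by (auto simp: orthogonal_matrix matrix_matrix_mult_def transpose_def vec_eq_iff forall_2 sum_2
      mat_def power2_eq_square mult.commute)

lemma SO_2_iff:
  "(P :: real^2^2) \<in> SO \<longleftrightarrow> orthogonal_matrix P \<and> P$1$1 = P$2$2 \<and> P$1$2 = - P$2$1"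
proof
  assume "P \<in> SO"
  then have o: "orthogonal_matrix P" and d: "P$1$1 * P$2$2 - P$1$2 * P$2$1 = 1"
    by (simp_all add: SO_iff det_2)
  have "(P$1$1 - P$2$2)\<^sup>2 + (P$1$2 + P$2$1)\<^sup>2 = 0"
    using o d unfolding orthogonal_2_iff by (simp add: power2_sum power2_diff)
  then have "P$1$1 - P$2$2 = 0 \<and> P$1$2 + P$2$1 = 0"
    by (simp only: sum_power2_eq_zero_iff)
  then show "orthogonal_matrix P \<and> P$1$1 = P$2$2 \<and> P$1$2 = - P$2$1" using o by auto
next
  assume *: "orthogonal_matrix P \<and> P$1$1 = P$2$2 \<and> P$1$2 = - P$2$1"
  then have "(P$2$2)\<^sup>2 + (P$2$1)\<^sup>2 = 1" by (metis orthogonal_2_iff)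
  then have "det P = 1" using * by (simp add: det_2 power2_eq_square)
  then show "P \<in> SO" using * by (simp add: SO_iff)
qed

lemma orthogonal_2_cases:
  assumes "orthogonal_matrix (P :: real^2^2)"
  shows "(P$1$1 = P$2$2 \<and> P$1$2 = - P$2$1) \<or> (P$1$1 = - P$2$2 \<and> P$1$2 = P$2$1)"
proof -
  have "(det P)\<^sup>2 = 1" using det_orthogonal_matrix[OF assms] by auto
  then consider "det P = 1" | "det P = -1" by (auto simp: power2_eq_1_iff)
  then show ?thesis
  proof cases
    case 1
    then show ?thesis using SO_2_iff[of P] assms by (simp add: SO_iff)
  next
    case 2
    then have "(P$1$1 + P$2$2)\<^sup>2 + (P$1$2 - P$2$1)\<^sup>2 = 0"
      using assms unfolding orthogonal_2_iff det_2 by (simp add: power2_sum power2_diff)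
    then have "P$1$1 + P$2$2 = 0 \<and> P$1$2 - P$2$1 = 0"
      by (simp only: sum_power2_eq_zero_iff)
    then show ?thesis by auto
  qed
qed


section \<open>Centralizers of the normal forms\<close>

lemma act_fixed_iff:
  assumes "orthogonal_matrix g" shows "act g B = B \<longleftrightarrow> g ** B = B ** g"
proof
  assume "act g B = B"
  then have "act g B ** g = B ** g" by simp
  then show "g ** B = B ** g"
    using assms by (simp add: act_def orthogonal_matrix_cancel flip: matrix_mul_assoc)
next
  assume "g ** B = B ** g"
  then show "act g B = B"
    using assms by (simp add: act_def orthogonal_matrix_cancel flip: matrix_mul_assoc)
qed

lemma stabilizer_iff: "g \<in> stabilizer B \<longleftrightarrow> g \<in> SO \<and> g ** B = B ** g"
  by (auto simp: stabilizer_def SO_iff act_fixed_iff)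

text \<open>
  Unitary maps preserve the orientation, because the Pfaffian of the standard complex structure is not
  zero.
\<close>

lemma SO_if_commutes_standard:
  assumes "orthogonal_matrix g" "g ** normal_form (vector [1, 1, 1]) = normal_form (vector [1, 1, 1]) ** g"
  shows "g \<in> SO"
  using det_eq_1_if_act_fixed[of g "vector [1, 1, 1]"] assms by (simp add: SO_iff act_fixed_iff)

lemma mult_normal_form_nth:
  "(g ** normal_form l) $ i $ 1 = - l$1 * g $ i $ 2" "(g ** normal_form l) $ i $ 2 = l$1 * g $ i $ 1"
  "(g ** normal_form l) $ i $ 3 = - l$2 * g $ i $ 4" "(g ** normal_form l) $ i $ 4 = l$2 * g $ i $ 3"
  "(g ** normal_form l) $ i $ 5 = - l$3 * g $ i $ 6" "(g ** normal_form l) $ i $ 6 = l$3 * g $ i $ 5"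
  "(normal_form l ** g) $ 1 $ i = l$1 * g $ 2 $ i" "(normal_form l ** g) $ 2 $ i = - l$1 * g $ 1 $ i"
  "(normal_form l ** g) $ 3 $ i = l$2 * g $ 4 $ i" "(normal_form l ** g) $ 4 $ i = - l$2 * g $ 3 $ i"
  "(normal_form l ** g) $ 5 $ i = l$3 * g $ 6 $ i" "(normal_form l ** g) $ 6 $ i = - l$3 * g $ 5 $ i"
  by (simp_all add: matrix_matrix_mult_def normal_form_matrix sum_6)

lemma commutes_iff:
  "g ** normal_form l = normal_form l ** g \<longleftrightarrow>
     (\<forall>j. (g ** normal_form l) $ 1 $ j = l$1 * g $ 2 $ j \<and> (g ** normal_form l) $ 2 $ j = - l$1 * g $ 1 $ j \<and>
       (g ** normal_form l) $ 3 $ j = l$2 * g $ 4 $ j \<and> (g ** normal_form l) $ 4 $ j = - l$2 * g $ 3 $ j \<and>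
       (g ** normal_form l) $ 5 $ j = l$3 * g $ 6 $ j \<and> (g ** normal_form l) $ 6 $ j = - l$3 * g $ 5 $ j)"
  unfolding vec_eq_iff[of "g ** normal_form l"] vec_eq_iff[of "(g ** normal_form l) $ _"]
    forall_6[of "\<lambda>i. \<forall>j. _ i j"] mult_normal_form_nth by blast

lemma commutation_off_diagonal:
  fixes a b x y z t :: real
  assumes "b * x = a * t" "b * t = a * x" "b * y = - a * z" "b * z = - a * y" "a\<^sup>2 \<noteq> b\<^sup>2"
  shows "x = 0 \<and> y = 0 \<and> z = 0 \<and> t = 0"
proof -
  have "b * b * x = a * a * x" "b * b * t = a * a * t"
    using assms(1,2) by (metis mult.assoc mult.left_commute)+
  moreover have "b * b * y = a * a * y" "b * b * z = a * a * z"
    using assms(3,4) by (metis mult.assoc mult.left_commute mult_minus_left mult_minus_right minus_minus)+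
  ultimately show ?thesis using assms(5) by (simp add: power2_eq_square)
qed

lemma commutation_diagonal:
  fixes a b x y z t :: real
  assumes "a = b" "a \<noteq> 0 \<or> b \<noteq> 0" "b * x = a * t" "- b * y = a * z"
  shows "x = t \<and> y = - z"
proof -
  have "b * x = b * t" "b * y = b * (- z)" "b \<noteq> 0" using assms by auto
  then show ?thesis by (metis mult_left_cancel)
qed

definition odd_index :: "3 \<Rightarrow> 6" where
  "odd_index p = vector [1, 3, 5] $ p"

definition even_index :: "3 \<Rightarrow> 6" where
  "even_index p = vector [2, 4, 6] $ p"

lemma index_simps [simp]:
  "odd_index 1 = 1" "odd_index 2 = 3" "odd_index 3 = 5"
  "even_index 1 = 2" "even_index 2 = 4" "even_index 3 = 6"
  by (simp_all add: odd_index_def even_index_def)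

lemma mult_normal_form_block:
  "(g ** normal_form l) $ i $ odd_index p = - l$p * g $ i $ even_index p"
  "(g ** normal_form l) $ i $ even_index p = l$p * g $ i $ odd_index p"
  "(normal_form l ** g) $ odd_index p $ i = l$p * g $ even_index p $ i"
  "(normal_form l ** g) $ even_index p $ i = - l$p * g $ odd_index p $ i"
  using exhaust_3[of p] by (auto simp: mult_normal_form_nth)

text \<open>
  Commutation couples x with t and y with z. Applied twice, it multiplies an entry by the square of l$q on
  one side and by the square of l$p on the other.
\<close>

lemma centralizer_block:
  fixes g :: "real^6^6" and p q :: 3
  assumes "g ** normal_form l = normal_form l ** g"
  defines "x \<equiv> g $ odd_index p $ odd_index q" and "y \<equiv> g $ odd_index p $ even_index q"
    and "z \<equiv> g $ even_index p $ odd_index q" and "t \<equiv> g $ even_index p $ even_index q"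
  shows "(l$p)\<^sup>2 \<noteq> (l$q)\<^sup>2 \<Longrightarrow> x = 0 \<and> y = 0 \<and> z = 0 \<and> t = 0"
    and "l$p = l$q \<Longrightarrow> l$p \<noteq> 0 \<Longrightarrow> x = t \<and> y = - z"
proof -
  have "(g ** normal_form l) $ i $ j = (normal_form l ** g) $ i $ j" for i j
    using assms(1) by simp
  note eq = this[of "odd_index p" "odd_index q"] this[of "odd_index p" "even_index q"]
    this[of "even_index p" "odd_index q"] this[of "even_index p" "even_index q"]
  note eq = eq[unfolded mult_normal_form_block, folded x_def y_def z_def t_def]
  show "(l$p)\<^sup>2 \<noteq> (l$q)\<^sup>2 \<Longrightarrow> x = 0 \<and> y = 0 \<and> z = 0 \<and> t = 0"
    by (rule commutation_off_diagonal[of "l$q" _ "l$p"]) (use eq in auto)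
  show "l$p = l$q \<Longrightarrow> l$p \<noteq> 0 \<Longrightarrow> x = t \<and> y = - z"
    using commutation_diagonal[OF _ _ eq(2,1)] by blast
qed

text \<open>
  If the last plane is the kernel, the centralizer might a priori act on it by a reflection. But
  composed with the reflection in the last basis vector such an element would be unitary, hence
  of determinant 1.
\<close>

lemma block_4_2_rotation:
  assumes g: "block_4_2 P Q \<in> SO" and P: "P$1$1 = P$2$2" "P$1$2 = - P$2$1" "P$3$3 = P$4$4" "P$3$4 = - P$4$3"
    "P$1$3 = P$2$4" "P$1$4 = - P$2$3" "P$3$1 = P$4$2" "P$3$2 = - P$4$1"
  shows "Q \<in> SO"
proof (rule ccontr)
  assume Q: "Q \<notin> SO"
  have o: "orthogonal_matrix P" "orthogonal_matrix Q"
    using g by (simp_all add: SO_iff orthogonal_block)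
  then have reflect: "Q$1$1 = - Q$2$2" "Q$1$2 = Q$2$1"
    using orthogonal_2_cases[OF o(2)] Q SO_2_iff[of Q] by auto
  define D :: "real^2^2" where "D = vector [vector [1, 0], vector [0, -1]]"
  have "orthogonal_matrix D" by (simp add: orthogonal_2_iff D_def)
  then have "orthogonal_matrix (block_4_2 P (Q ** D))"
    using o by (simp add: orthogonal_block orthogonal_matrix_mul)
  moreover have "block_4_2 P (Q ** D) ** normal_form (vector [1, 1, 1]) =
      normal_form (vector [1, 1, 1]) ** block_4_2 P (Q ** D)"
    unfolding commutes_iff forall_6 mult_normal_form_nth
    using P reflect by (simp add: block_4_2_def D_def matrix_matrix_mult_def sum_2)
  ultimately have "block_4_2 P (Q ** D) \<in> SO" by (rule SO_if_commutes_standard)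
  moreover have "block_4_2 P (Q ** D) = block_4_2 P Q ** block_4_2 (mat 1) D"
    by (simp add: block_mult)
  ultimately have "det (block_4_2 (mat 1) D) = 1"
    using g by (simp add: SO_iff det_mul)
  moreover have "block_4_2 (mat 1) D = reflection (axis 6 1)"
    by (simp add: block_4_2_def D_def reflection_def mat_def axis_def vec_eq_iff forall_6)
  ultimately show False by (simp add: det_reflection)
qed

lemma stabilizer_regular:
  assumes "(l$1)\<^sup>2 \<noteq> (l$2)\<^sup>2" "(l$1)\<^sup>2 \<noteq> (l$3)\<^sup>2" "(l$2)\<^sup>2 \<noteq> (l$3)\<^sup>2" "l$1 \<noteq> 0" "l$2 \<noteq> 0"
  shows "stabilizer (normal_form l) = T3"
proof (intro set_eqI iffI)
  fix g assume "g \<in> stabilizer (normal_form l)"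
  then have g: "g \<in> SO" "g ** normal_form l = normal_form l ** g" by (simp_all add: stabilizer_iff)
  note off = centralizer_block(1)[OF g(2)]
  have rot: "g$1$1 = g$2$2" "g$1$2 = - g$2$1" "g$3$3 = g$4$4" "g$3$4 = - g$4$3"
    using centralizer_block(2)[OF g(2), of 1 1] centralizer_block(2)[OF g(2), of 2 2] assms(4,5) by auto
  define P Q R :: "real^2^2" where "P = vector [vector [g$1$1, g$1$2], vector [g$2$1, g$2$2]]"
    and "Q = vector [vector [g$3$3, g$3$4], vector [g$4$3, g$4$4]]"
    and "R = vector [vector [g$5$5, g$5$6], vector [g$6$5, g$6$6]]"
  define S :: "real^4^4" where "S = vector [vector [g$1$1, g$1$2, 0, 0], vector [g$2$1, g$2$2, 0, 0],
    vector [0, 0, g$3$3, g$3$4], vector [0, 0, g$4$3, g$4$4]]"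
  have gb: "g = block_2_2_2 P Q R" and gb': "g = block_4_2 S R"
    using off[of 1 2] off[of 2 1] off[of 1 3] off[of 3 1] off[of 2 3] off[of 3 2] assms(1-3)
    by (simp_all add: block_2_2_2_def block_4_2_def P_def Q_def R_def S_def vec_eq_iff forall_6)
  have "block_4_2 S R \<in> SO" "block_2_2_2 P Q R \<in> SO"
    using g(1) gb gb' by metis+
  then have SR: "block_4_2 S R \<in> SO" and o: "orthogonal_matrix P" "orthogonal_matrix Q"
    by (simp_all add: SO_iff orthogonal_block)
  have "R \<in> SO"
    by (rule block_4_2_rotation[OF SR]) (simp_all add: S_def rot)
  moreover have "P \<in> SO"
    unfolding SO_2_iff by (rule conjI[OF o(1)]) (simp add: P_def rot)
  moreover have "Q \<in> SO"
    unfolding SO_2_iff by (rule conjI[OF o(2)]) (simp add: Q_def rot)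
  ultimately show "g \<in> T3" using gb by (auto simp: T3_iff)
next
  fix g assume "g \<in> T3"
  then obtain P Q R where PQR: "P \<in> SO" "Q \<in> SO" "R \<in> SO" and g: "g = block_2_2_2 P Q R"
    by (auto simp: T3_iff)
  have "g ** normal_form k = normal_form k ** g" for k
    unfolding commutes_iff forall_6 mult_normal_form_nth
    using PQR by (simp add: g block_2_2_2_def SO_2_iff)
  moreover have "orthogonal_matrix g" using PQR by (simp add: g orthogonal_block SO_iff)
  ultimately show "g \<in> stabilizer (normal_form l)"
    using SO_if_commutes_standard by (simp add: stabilizer_iff)
qed

lemma stabilizer_two_equal:
  assumes "l$1 = l$2" "(l$1)\<^sup>2 \<noteq> (l$3)\<^sup>2" "l$1 \<noteq> 0"
  shows "stabilizer (normal_form l) = U2_SO2"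
proof (intro set_eqI iffI)
  fix g assume "g \<in> stabilizer (normal_form l)"
  then have g: "g \<in> SO" "g ** normal_form l = normal_form l ** g" by (simp_all add: stabilizer_iff)
  have l2: "(l$2)\<^sup>2 \<noteq> (l$3)\<^sup>2" "l$2 \<noteq> 0" using assms by simp_all
  note off = centralizer_block(1)[OF g(2)] and same = centralizer_block(2)[OF g(2)]
  define U :: "complex^2^2" where "U = vector [vector [Complex (g$1$1) (g$2$1), Complex (g$1$3) (g$2$3)],
    vector [Complex (g$3$1) (g$4$1), Complex (g$3$3) (g$4$3)]]"
  define Q :: "real^2^2" where "Q = vector [vector [g$5$5, g$5$6], vector [g$6$5, g$6$6]]"
  have gb: "g = block_4_2 (real_matrix_2 U) Q"
    using off[of 1 3] off[of 3 1] off[of 2 3] off[of 3 2] assms(2) l2(1)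
      same[of 1 1] same[of 2 2] same[of 1 2] same[of 2 1] assms(1,3) l2(2)
    by (simp add: block_4_2_def real_matrix_2_def U_def Q_def vec_eq_iff forall_6)
  have "block_4_2 (real_matrix_2 U) Q \<in> SO"
    using g(1) gb by metis
  then have "Q \<in> SO"
    by (rule block_4_2_rotation) (simp_all add: real_matrix_2_def)
  moreover have "orthogonal_matrix (real_matrix_2 U)"
    using g(1) gb by (simp add: SO_iff orthogonal_block)
  ultimately show "g \<in> U2_SO2" using gb by (auto simp: U2_SO2_iff)
next
  fix g assume "g \<in> U2_SO2"
  then obtain U Q where UQ: "Q \<in> SO" "orthogonal_matrix (real_matrix_2 U)"
    and g: "g = block_4_2 (real_matrix_2 U) Q"
    by (auto simp: U2_SO2_iff)
  have "g ** normal_form k = normal_form k ** g" if "k$1 = k$2" for k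
    unfolding commutes_iff forall_6 mult_normal_form_nth
    using UQ(1) that by (simp add: g block_4_2_def real_matrix_2_def SO_2_iff)
  moreover have "orthogonal_matrix g" using UQ by (simp add: g orthogonal_block SO_iff)
  ultimately show "g \<in> stabilizer (normal_form l)"
    using SO_if_commutes_standard assms(1) by (simp add: stabilizer_iff)
qed

lemma stabilizer_all_equal:
  assumes "l$1 = l$2" "l$1 = l$3" "l$1 \<noteq> 0"
  shows "stabilizer (normal_form l) = U3"
proof (intro set_eqI iffI)
  fix g assume "g \<in> stabilizer (normal_form l)"
  then have g: "g \<in> SO" "g ** normal_form l = normal_form l ** g" by (simp_all add: stabilizer_iff)
  have l: "l$2 \<noteq> 0" "l$3 \<noteq> 0" "l$2 = l$3" using assms by simp_all
  note same = centralizer_block(2)[OF g(2)]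
  define U :: "complex^3^3" where
    "U = vector [vector [Complex (g$1$1) (g$2$1), Complex (g$1$3) (g$2$3), Complex (g$1$5) (g$2$5)],
      vector [Complex (g$3$1) (g$4$1), Complex (g$3$3) (g$4$3), Complex (g$3$5) (g$4$5)],
      vector [Complex (g$5$1) (g$6$1), Complex (g$5$3) (g$6$3), Complex (g$5$5) (g$6$5)]]"
  have "g = real_matrix_3 U"
    using same[of 1 1] same[of 2 2] same[of 3 3] same[of 1 2] same[of 2 1] same[of 1 3] same[of 3 1]
      same[of 2 3] same[of 3 2] assms l
    by (simp add: real_matrix_3_def U_def vec_eq_iff forall_6)
  then show "g \<in> U3" using g(1) by (auto simp: U3_iff SO_iff)
next
  fix g assume "g \<in> U3"
  then obtain U where g: "g = real_matrix_3 U" and o: "orthogonal_matrix g" by (auto simp: U3_iff)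
  have "g ** normal_form k = normal_form k ** g" if "k$1 = k$2" "k$1 = k$3" for k
    unfolding commutes_iff forall_6 mult_normal_form_nth
    using that by (simp add: g real_matrix_3_def)
  then show "g \<in> stabilizer (normal_form l)"
    using SO_if_commutes_standard[OF o] assms(1,2) by (simp add: stabilizer_iff)
qed

lemma det_elementary:
  assumes "m \<noteq> n"
  shows "det (\<chi> i j. if i = m \<and> j = n then c else of_bool (i = j) :: real^'n^'n) = 1"
proof -
  have "(\<chi> i j. if i = m \<and> j = n then c else of_bool (i = j)) =
      (\<chi> k. if k = m then row m (mat 1 :: real^'n^'n) + c *s row n (mat 1) else row k (mat 1))"
    using assms by (auto simp: vec_eq_iff row_def mat_def)
  then show ?thesis using det_row_operation[OF assms, of "mat 1 :: real^'n^'n"] by simp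
qed

lemma det_transposition:
  assumes "m \<noteq> n"
  shows "det (\<chi> i j. mat 1 $ i $ Transposition.transpose m n j :: real^'n^'n) = - 1"
  using det_permute_columns[of "Transposition.transpose m n" "mat 1 :: real^'n^'n"] assms
  by (simp add: permutes_swap_id sign_swap_id)

definition last_four :: "4 \<Rightarrow> 6" where
  "last_four i = vector [3, 4, 5, 6] $ i"

lemma last_four_simps [simp]:
  "last_four 1 = 3" "last_four 2 = 4" "last_four 3 = 5" "last_four 4 = 6"
  by (simp_all add: last_four_def)

lemma last_four_neq: "last_four i \<noteq> 1" "last_four i \<noteq> 2"
  using exhaust_4[of i] by auto

lemma last_four_eq_iff: "last_four i = last_four j \<longleftrightarrow> i = j"
  using exhaust_4[of i] exhaust_4[of j] by auto

text \<open>
  This form of the entries shows that the elementary matrices of size four become elementary matrices of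
  size six.
\<close>

lemma block_2_4_eqI:
  assumes "\<And>i j. A $ last_four i $ last_four j = Q $ i $ j"
    and "\<And>k. A $ 1 $ k = of_bool (k = 1)" "\<And>k. A $ 2 $ k = of_bool (k = 2)"
    and "\<And>k. A $ k $ 1 = of_bool (k = 1)" "\<And>k. A $ k $ 2 = of_bool (k = 2)"
  shows "block_2_4 (mat 1) Q = A"
  unfolding vec_eq_iff forall_6
  by (simp add: block_2_4_def mat_def assms(2-) assms(1)[symmetric])

text \<open>Both sides are multiplicative, so it is enough to compare them on elementary matrices.\<close>

lemma det_block_2_4: "det (block_2_4 (mat 1) Q) = det Q"
proof (induction Q rule: induct_matrix_elementary)
  case (1 A B)
  have "block_2_4 (mat 1) (A ** B) = block_2_4 (mat 1) A ** block_2_4 (mat 1) B"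
    by (simp add: block_mult)
  then show ?case using 1 by (simp add: det_mul)
next
  case (2 A i)
  then have "A $ i $ j = 0" for j by (simp add: row_def vec_eq_iff)
  then have "row (last_four i) (block_2_4 (mat 1) A) = 0"
    using exhaust_4[of i] by (auto simp: row_def block_2_4_def vec_eq_iff forall_6)
  then show ?case using 2 det_zero_row by metis
next
  case (3 A)
  have "block_2_4 (mat 1) A $ i $ j = 0" if "i \<noteq> j" for i j
    using that exhaust_6[of i] exhaust_6[of j]
    by (elim disjE) (simp_all add: block_2_4_def mat_def 3)
  then have "det (block_2_4 (mat 1) A) = (\<Prod>i\<in>UNIV. block_2_4 (mat 1) A $ i $ i)"
    by (rule det_diagonal)
  also have "\<dots> = A$1$1 * A$2$2 * A$3$3 * A$4$4"
    by (simp add: prod_6 block_2_4_def mat_def)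
  also have "\<dots> = (\<Prod>i\<in>UNIV. A $ i $ i)"
    unfolding UNIV_4 by simp
  also have "\<dots> = det A" by (rule det_diagonal[symmetric]) (rule 3)
  finally show ?case .
next
  case (4 m n)
  have "block_2_4 (mat 1) (\<chi> i j. mat 1 $ i $ Transposition.transpose m n j) =
      (\<chi> i j. mat 1 $ i $ Transposition.transpose (last_four m) (last_four n) j)"
    by (rule block_2_4_eqI)
      (auto simp: mat_def Transposition.transpose_def last_four_eq_iff last_four_neq
        last_four_neq[symmetric])
  then show ?case using 4 by (simp add: det_transposition last_four_eq_iff)
next
  case (5 m n c)
  have "block_2_4 (mat 1) (\<chi> i j. if i = m \<and> j = n then c else of_bool (i = j)) =
      (\<chi> i j. if i = last_four m \<and> j = last_four n then c else of_bool (i = j))"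
    by (rule block_2_4_eqI) (auto simp: last_four_eq_iff last_four_neq last_four_neq[symmetric])
  then show ?case using 5 by (simp add: det_elementary last_four_eq_iff)
qed

lemma det_block_2_4_rotation: assumes "P \<in> SO" shows "det (block_2_4 P Q) = det Q"
proof -
  have "block_2_4 P (mat 1) ** normal_form (vector [1, 1, 1]) =
      normal_form (vector [1, 1, 1]) ** block_2_4 P (mat 1)"
    unfolding commutes_iff forall_6 mult_normal_form_nth
    using assms by (simp add: block_2_4_def mat_def SO_2_iff)
  then have "block_2_4 P (mat 1) \<in> SO"
    using assms by (intro SO_if_commutes_standard) (simp_all add: orthogonal_block SO_iff orthogonal_matrix_id)
  moreover have "block_2_4 P Q = block_2_4 P (mat 1) ** block_2_4 (mat 1) Q"
    by (simp add: block_mult)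
  ultimately show ?thesis by (simp add: det_mul det_block_2_4 SO_iff)
qed

lemma stabilizer_rank_two:
  assumes "l$1 \<noteq> 0" "l$2 = 0" "l$3 = 0"
  shows "stabilizer (normal_form l) = SO2_SO4"
proof (intro set_eqI iffI)
  fix g assume "g \<in> stabilizer (normal_form l)"
  then have g: "g \<in> SO" "g ** normal_form l = normal_form l ** g" by (simp_all add: stabilizer_iff)
  have l: "(l$1)\<^sup>2 \<noteq> (l$2)\<^sup>2" "(l$1)\<^sup>2 \<noteq> (l$3)\<^sup>2" using assms by simp_all
  note off = centralizer_block(1)[OF g(2)]
  define P :: "real^2^2" where "P = vector [vector [g$1$1, g$1$2], vector [g$2$1, g$2$2]]"
  define Q :: "real^4^4" where "Q = vector [vector [g$3$3, g$3$4, g$3$5, g$3$6],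
    vector [g$4$3, g$4$4, g$4$5, g$4$6], vector [g$5$3, g$5$4, g$5$5, g$5$6],
    vector [g$6$3, g$6$4, g$6$5, g$6$6]]"
  have gb: "g = block_2_4 P Q"
    using off[of 1 2] off[of 2 1] off[of 1 3] off[of 3 1] l
    by (simp add: block_2_4_def P_def Q_def vec_eq_iff forall_6)
  have o: "orthogonal_matrix P" "orthogonal_matrix Q"
    using g(1) gb by (simp_all add: SO_iff orthogonal_block)
  have "P \<in> SO"
    using o(1) centralizer_block(2)[OF g(2), of 1 1] assms(1) by (simp add: SO_2_iff P_def)
  moreover from this have "Q \<in> SO"
    using g(1) gb o(2) det_block_2_4_rotation[of P Q] by (simp add: SO_iff)
  ultimately show "g \<in> SO2_SO4" using gb by (auto simp: SO2_SO4_iff)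
next
  fix g assume "g \<in> SO2_SO4"
  then obtain P Q where PQ: "P \<in> SO" "Q \<in> SO" and g: "g = block_2_4 P Q" by (auto simp: SO2_SO4_iff)
  have "g ** normal_form l = normal_form l ** g"
    unfolding commutes_iff forall_6 mult_normal_form_nth
    using PQ(1) assms by (simp add: g block_2_4_def SO_2_iff)
  moreover have "g \<in> SO"
    using PQ by (simp add: g SO_iff orthogonal_block det_block_2_4_rotation)
  ultimately show "g \<in> stabilizer (normal_form l)" by (simp add: stabilizer_iff)
qed


section \<open>Isotropy groups on the faces of the triangle\<close>

lemma orbit_typeI:
  assumes "l \<in> Delta" "normal_form k \<in> orbit (normal_form l)" "stabilizer (normal_form k) = H"
  shows "conjugate_in_SO6 (stabilizer (normal_form l)) H \<and>
    homogeneous_diffeo (orbit (normal_form l)) H"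
proof -
  obtain g where "g \<in> SO" "normal_form k = act g (normal_form l)"
    using assms(2) by (auto simp: orbit_def)
  then show ?thesis using orbit_type assms(1,3) by metis
qed

lemma Weyl_orbit:
  assumes "normal_form (vector [a, b, c]) \<in> orbit B"
  shows "normal_form (vector [b, a, c]) \<in> orbit B"
    and "normal_form (vector [a, c, b]) \<in> orbit B"
    and "normal_form (vector [a, - c, - b]) \<in> orbit B"
proof -
  have "act (reflection n ** reflection m) (normal_form (vector [a, b, c])) \<in> orbit B"
    if "norm n = 1" "norm m = 1" for n m
    using act_orbit[OF reflections_SO[OF that], of "normal_form (vector [a, b, c])"]
    by (simp only: orbit_trans[OF assms])
  note moves = Weyl_moves[of "vector [a, b, c]", OF this, unfolded vector_3]
  show "normal_form (vector [b, a, c]) \<in> orbit B" "normal_form (vector [a, c, b]) \<in> orbit B"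
    "normal_form (vector [a, - c, - b]) \<in> orbit B"
    by (rule moves; assumption)+
qed

lemma normal_form_orbit_self: "normal_form (vector [l$1, l$2, l$3]) \<in> orbit (normal_form l)"
proof -
  have "vector [l$1, l$2, l$3] = l" by (simp add: vec_eq_iff forall_3)
  then show ?thesis by (simp add: orbit_refl)
qed

lemma orbit_type_interior:
  assumes l: "l \<in> Delta" "l$1 > l$2" "l$2 > \<bar>l$3\<bar>"
  shows "conjugate_in_SO6 (stabilizer (normal_form l)) T3 \<and> homogeneous_diffeo (orbit (normal_form l)) T3"
proof (rule orbit_typeI[OF l(1) orbit_refl], rule stabilizer_regular)
  have "\<bar>l$2\<bar> < \<bar>l$1\<bar>" "\<bar>l$3\<bar> < \<bar>l$1\<bar>" "\<bar>l$3\<bar> < \<bar>l$2\<bar>" using l by auto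
  then have "\<bar>l$1\<bar> \<noteq> \<bar>l$2\<bar>" "\<bar>l$1\<bar> \<noteq> \<bar>l$3\<bar>" "\<bar>l$2\<bar> \<noteq> \<bar>l$3\<bar>" by linarith+
  then show "(l$1)\<^sup>2 \<noteq> (l$2)\<^sup>2" "(l$1)\<^sup>2 \<noteq> (l$3)\<^sup>2" "(l$2)\<^sup>2 \<noteq> (l$3)\<^sup>2"
    by (metis power2_eq_iff abs_minus)+
qed (use l in auto)

lemma orbit_type_edge_12:
  assumes l: "l \<in> Delta" "l$1 = l$2" "l$2 > \<bar>l$3\<bar>"
  shows "conjugate_in_SO6 (stabilizer (normal_form l)) U2_SO2 \<and> homogeneous_diffeo (orbit (normal_form l)) U2_SO2"
proof (rule orbit_typeI[OF l(1) orbit_refl], rule stabilizer_two_equal)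
  show "(l$1)\<^sup>2 \<noteq> (l$3)\<^sup>2" using l(2,3) by (auto simp: power2_eq_iff)
qed (use l in auto)

text \<open>
  Weyl moves bring the two equal parameters to the front; if l$3 is negative, one of them also changes
  the signs of two parameters.
\<close>

lemma orbit_type_edge_23:
  assumes l: "l \<in> Delta" "l$1 > l$2" "l$2 = \<bar>l$3\<bar>" "l$3 \<noteq> 0"
  shows "conjugate_in_SO6 (stabilizer (normal_form l)) U2_SO2 \<and> homogeneous_diffeo (orbit (normal_form l)) U2_SO2"
proof -
  have *: "normal_form (vector [l$2, l$1, l$3]) \<in> orbit (normal_form l)"
    using Weyl_orbit(1)[OF normal_form_orbit_self[of l]] .
  have "\<exists>k. normal_form k \<in> orbit (normal_form l) \<and> k$1 = l$2 \<and> k$2 = l$2 \<and> (k$3)\<^sup>2 = (l$1)\<^sup>2"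
  proof (cases "l$3 > 0")
    case True
    then show ?thesis
      using Weyl_orbit(2)[OF *] l(3) by (intro exI[of _ "vector [l$2, l$3, l$1]"]) simp
  next
    case False
    then show ?thesis
      using Weyl_orbit(3)[OF *] l(3) by (intro exI[of _ "vector [l$2, - l$3, - l$1]"]) simp
  qed
  then obtain k where k: "normal_form k \<in> orbit (normal_form l)" "k$1 = l$2" "k$2 = l$2" "(k$3)\<^sup>2 = (l$1)\<^sup>2"
    by blast
  have "(l$2)\<^sup>2 \<noteq> (l$1)\<^sup>2" using l by (auto simp: power2_eq_iff)
  then have "stabilizer (normal_form k) = U2_SO2"
    using k l(3,4) by (intro stabilizer_two_equal) auto
  then show ?thesis using orbit_typeI[OF l(1) k(1)] by blast
qed

text \<open>
  For negative l$3 the normal form is conjugate to minus a multiple of the standard complex structure,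
  which has the same centralizer as the complex structure itself.
\<close>

lemma orbit_type_U3:
  assumes l: "l \<in> Delta" "l$1 = l$2" "l$2 = \<bar>l$3\<bar>"
  shows "conjugate_in_SO6 (stabilizer (normal_form l)) U3 \<and> homogeneous_diffeo (orbit (normal_form l)) U3"
proof (cases "l$3 > 0")
  case True
  then show ?thesis
    using l by (intro orbit_typeI[OF l(1) orbit_refl] stabilizer_all_equal) auto
next
  case False
  have "normal_form (vector [l$1, l$3, l$2]) \<in> orbit (normal_form l)"
    using Weyl_orbit(2)[OF normal_form_orbit_self[of l]] .
  from Weyl_orbit(3)[OF Weyl_orbit(1)[OF this]]
  have "normal_form (vector [l$3, - l$2, - l$1]) \<in> orbit (normal_form l)" .
  then show ?thesis
    using l False Delta_pos[OF l(1)] by (intro orbit_typeI[OF l(1)] stabilizer_all_equal) auto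
qed

lemma orbit_type_rank_two:
  assumes l: "l \<in> Delta" "l$2 = 0" "l$3 = 0"
  shows "conjugate_in_SO6 (stabilizer (normal_form l)) SO2_SO4 \<and>
    homogeneous_diffeo (orbit (normal_form l)) SO2_SO4"
  using Delta_pos[OF l(1)] l by (intro orbit_typeI[OF l(1) orbit_refl] stabilizer_rank_two) auto


section \<open>Twistors: the orbits of complex structures\<close>

definition herm_re :: "complex^4 \<Rightarrow> 4 \<Rightarrow> 4 \<Rightarrow> real" where
  "herm_re z a b = Re (cnj (z $ a) * z $ b)"

definition herm_im :: "complex^4 \<Rightarrow> 4 \<Rightarrow> 4 \<Rightarrow> real" where
  "herm_im z a b = Im (cnj (z $ a) * z $ b)"

text \<open>
  Let \<open>B\<^sub>1 = i \<sigma>\<^sub>1 \<otimes> 1\<close>, \<open>B\<^sub>2 = i \<sigma>\<^sub>2 \<otimes> 1\<close>, \<open>B\<^sub>3 = i \<sigma>\<^sub>3 \<otimes> \<sigma>\<^sub>1\<close>, \<open>B\<^sub>4 = i \<sigma>\<^sub>3 \<otimes> \<sigma>\<^sub>2\<close>,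
  \<open>B\<^sub>5 = i \<sigma>\<^sub>3 \<otimes> \<sigma>\<^sub>3\<close> in terms of the Pauli matrices; these are anticommuting skew Hermitian matrices
  with square - 1. The entries of the twistor are the Hermitian forms of \<open>i B\<^sub>j B\<^sub>k\<close> for j < k < 6 and of
  \<open>- i B\<^sub>k\<close> for the index pair k, 6. The three diagonal blocks carry the weights of the half-spin
  representation.
\<close>

definition twistor :: "complex^4 \<Rightarrow> real^6^6" where
  "twistor z =
     (herm_re z 1 1 + herm_re z 2 2 - herm_re z 3 3 - herm_re z 4 4) *\<^sub>R e2 1 2 +
     (herm_re z 1 1 - herm_re z 2 2 + herm_re z 3 3 - herm_re z 4 4) *\<^sub>R e2 3 4 +
     (herm_re z 1 1 - herm_re z 2 2 - herm_re z 3 3 + herm_re z 4 4) *\<^sub>R e2 5 6 +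
     (- 2 * (herm_im z 1 4 + herm_im z 2 3)) *\<^sub>R e2 1 3 +
     (2 * (herm_re z 1 4 - herm_re z 2 3)) *\<^sub>R e2 1 4 +
     (2 * (herm_re z 1 4 + herm_re z 2 3)) *\<^sub>R e2 2 3 +
     (2 * (herm_im z 1 4 - herm_im z 2 3)) *\<^sub>R e2 2 4 +
     (2 * (herm_im z 2 4 - herm_im z 1 3)) *\<^sub>R e2 1 5 +
     (2 * (herm_re z 1 3 + herm_re z 2 4)) *\<^sub>R e2 1 6 +
     (2 * (herm_re z 1 3 - herm_re z 2 4)) *\<^sub>R e2 2 5 +
     (2 * (herm_im z 1 3 + herm_im z 2 4)) *\<^sub>R e2 2 6 +
     (- 2 * (herm_im z 1 2 + herm_im z 3 4)) *\<^sub>R e2 3 5 +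
     (2 * (herm_re z 1 2 - herm_re z 3 4)) *\<^sub>R e2 3 6 +
     (2 * (herm_re z 1 2 + herm_re z 3 4)) *\<^sub>R e2 4 5 +
     (2 * (herm_im z 1 2 - herm_im z 3 4)) *\<^sub>R e2 4 6"

lemma twistor_nth:
  "twistor z $ 1 $ 2 = herm_re z 1 1 + herm_re z 2 2 - herm_re z 3 3 - herm_re z 4 4"
  "twistor z $ 3 $ 4 = herm_re z 1 1 - herm_re z 2 2 + herm_re z 3 3 - herm_re z 4 4"
  "twistor z $ 5 $ 6 = herm_re z 1 1 - herm_re z 2 2 - herm_re z 3 3 + herm_re z 4 4"
  "twistor z $ 1 $ 3 = - 2 * (herm_im z 1 4 + herm_im z 2 3)"
  "twistor z $ 1 $ 4 = 2 * (herm_re z 1 4 - herm_re z 2 3)"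
  "twistor z $ 2 $ 3 = 2 * (herm_re z 1 4 + herm_re z 2 3)"
  "twistor z $ 2 $ 4 = 2 * (herm_im z 1 4 - herm_im z 2 3)"
  "twistor z $ 1 $ 5 = 2 * (herm_im z 2 4 - herm_im z 1 3)"
  "twistor z $ 1 $ 6 = 2 * (herm_re z 1 3 + herm_re z 2 4)"
  "twistor z $ 2 $ 5 = 2 * (herm_re z 1 3 - herm_re z 2 4)"
  "twistor z $ 2 $ 6 = 2 * (herm_im z 1 3 + herm_im z 2 4)"
  "twistor z $ 3 $ 5 = - 2 * (herm_im z 1 2 + herm_im z 3 4)"
  "twistor z $ 3 $ 6 = 2 * (herm_re z 1 2 - herm_re z 3 4)"
  "twistor z $ 4 $ 5 = 2 * (herm_re z 1 2 + herm_re z 3 4)"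
  "twistor z $ 4 $ 6 = 2 * (herm_im z 1 2 - herm_im z 3 4)"
  by (simp_all add: twistor_def e2_def wedge_def axis_def)

lemma twistor_bivector: "twistor z \<in> bivectors"
  unfolding twistor_def e2_def
  by (intro subspace_add subspace_scale subspace_bivectors wedge_bivector)

lemma bivector_diag: "B \<in> bivectors \<Longrightarrow> B $ i $ i = 0"
  using bivectors_nth[of B i i] by simp

lemma bivectors_eqI:
  assumes "A \<in> bivectors" "B \<in> bivectors"
    "A$1$2 = B$1$2" "A$1$3 = B$1$3" "A$1$4 = B$1$4" "A$1$5 = B$1$5" "A$1$6 = B$1$6"
    "A$2$3 = B$2$3" "A$2$4 = B$2$4" "A$2$5 = B$2$5" "A$2$6 = B$2$6" "A$3$4 = B$3$4"
    "A$3$5 = B$3$5" "A$3$6 = B$3$6" "A$4$5 = B$4$5" "A$4$6 = B$4$6" "A$5$6 = B$5$6"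
  shows "A = B"
proof -
  have diag: "A $ i $ i = B $ i $ i" for i using assms(1,2) by (simp add: bivector_diag)
  have flip: "A $ j $ i = B $ j $ i" if "A $ i $ j = B $ i $ j" for i j
    using that bivectors_nth[OF assms(1), of j i] bivectors_nth[OF assms(2), of j i] by simp
  show ?thesis
    unfolding vec_eq_iff[of A] vec_eq_iff[of "A $ _"] forall_6
    using assms(3-) assms(3-)[THEN flip] diag by simp
qed

text \<open>
  In the notation above this is the matrix \<open>n\<^sub>6 - \<Sum>\<^sub>k n\<^sub>k B\<^sub>k\<close>.
\<close>

definition spin :: "real^6 \<Rightarrow> complex^4 \<Rightarrow> complex^4" where
  "spin n z = (let a = Complex (n$6) (n$5); b = Complex (n$4) (n$3); c = Complex (n$2) (n$1) in
     vector [cnj a * z$1 - b * z$2 - c * z$3, a * z$2 + cnj b * z$1 - c * z$4,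
             a * z$3 + cnj c * z$1 + b * z$4, cnj a * z$4 + cnj c * z$2 - cnj b * z$3])"

lemma inner_6: "v \<bullet> w = v$1 * w$1 + v$2 * w$2 + v$3 * w$3 + v$4 * w$4 + v$5 * w$5 + v$6 * w$6"
  for v w :: "real^6" by (simp add: inner_vec_def sum_6)

lemma complex_coordinates:
  fixes z :: "complex^4"
  obtains a b c d e f g h where "z = vector [Complex a b, Complex c d, Complex e f, Complex g h]"
proof
  show "z = vector [Complex (Re (z$1)) (Im (z$1)), Complex (Re (z$2)) (Im (z$2)),
      Complex (Re (z$3)) (Im (z$3)), Complex (Re (z$4)) (Im (z$4))]"
    by (simp add: vec_eq_iff forall_4)
qed

lemma inner_spin: "spin n z \<bullet> spin n z = (n \<bullet> n) * (z \<bullet> z)"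
proof -
  obtain a b c d e f g h where z: "z = vector [Complex a b, Complex c d, Complex e f, Complex g h]"
    by (rule complex_coordinates)
  show ?thesis
    unfolding inner_6 z by (simp add: inner_vec_def sum_4 inner_complex_def spin_def Let_def) algebra
qed

text \<open>
  For a unit vector n both sides are images under reflections. The factor n \<bullet> n makes the equation
  homogeneous, hence a polynomial identity in the coordinates of n and z.
\<close>

lemma spin_twistor_homogeneous:
  "(n \<bullet> n) *\<^sub>R twistor z + 2 *\<^sub>R wedge n (twistor z *v n) =
     twistor (spin n z) + 2 *\<^sub>R wedge (axis 6 1) (twistor (spin n z) *v axis 6 1)"
proof -
  obtain a b c d e f g h where z: "z = vector [Complex a b, Complex c d, Complex e f, Complex g h]"
    by (rule complex_coordinates)
  note skew = bivectors_nth[OF twistor_bivector, of z]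
  note skew = skew[of 2 1] skew[of 3 1] skew[of 4 1] skew[of 5 1] skew[of 6 1] skew[of 3 2] skew[of 4 2]
    skew[of 5 2] skew[of 6 2] skew[of 4 3] skew[of 5 3] skew[of 6 3] skew[of 5 4] skew[of 6 4] skew[of 6 5]
  have lhs: "((n \<bullet> n) *\<^sub>R twistor z + 2 *\<^sub>R wedge n (twistor z *v n)) $ i $ j =
      (n \<bullet> n) * twistor z $ i $ j + 2 * (n $ i * (\<Sum>k\<in>UNIV. twistor z $ j $ k * n $ k) -
        (\<Sum>k\<in>UNIV. twistor z $ i $ k * n $ k) * n $ j)" for i j
    by (simp add: wedge_def matrix_vector_mult_def)
  let ?R = "\<lambda>w. twistor w + 2 *\<^sub>R wedge (axis 6 1) (twistor w *v axis 6 1)"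
  have ax: "(axis 6 1 :: real^6) $ i = (if i = 6 then 1 else 0)" for i by (simp add: axis_def)
  have R1: "?R w $ i $ j = twistor w $ i $ j" if "i \<noteq> 6" "j \<noteq> 6" for w i j
    using that by (simp add: wedge_def matrix_vector_mult_basis column_def ax)
  have R2: "?R w $ i $ 6 = - twistor w $ i $ 6" if "i \<noteq> 6" for w i
    using that by (simp add: wedge_def matrix_vector_mult_basis column_def ax)
  have rhs: "?R w $ 1 $ 2 = twistor w $ 1 $ 2"
    "?R w $ 1 $ 3 = twistor w $ 1 $ 3"
    "?R w $ 1 $ 4 = twistor w $ 1 $ 4"
    "?R w $ 1 $ 5 = twistor w $ 1 $ 5"
    "?R w $ 1 $ 6 = - twistor w $ 1 $ 6"
    "?R w $ 2 $ 3 = twistor w $ 2 $ 3"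
    "?R w $ 2 $ 4 = twistor w $ 2 $ 4"
    "?R w $ 2 $ 5 = twistor w $ 2 $ 5"
    "?R w $ 2 $ 6 = - twistor w $ 2 $ 6"
    "?R w $ 3 $ 4 = twistor w $ 3 $ 4"
    "?R w $ 3 $ 5 = twistor w $ 3 $ 5"
    "?R w $ 3 $ 6 = - twistor w $ 3 $ 6"
    "?R w $ 4 $ 5 = twistor w $ 4 $ 5"
    "?R w $ 4 $ 6 = - twistor w $ 4 $ 6"
    "?R w $ 5 $ 6 = - twistor w $ 5 $ 6" for w
    by ((rule R1; simp; fail) | (rule R2; simp; fail))+
  show ?thesis
  proof (rule bivectors_eqI)
    show "(n \<bullet> n) *\<^sub>R twistor z + 2 *\<^sub>R wedge n (twistor z *v n) \<in> bivectors" "?R (spin n z) \<in> bivectors"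
      by (intro subspace_add subspace_scale subspace_bivectors wedge_bivector twistor_bivector)+
  qed ((unfold lhs rhs, unfold sum_6 skew bivector_diag[OF twistor_bivector] twistor_nth,
      unfold inner_6 spin_def Let_def herm_re_def herm_im_def z, simp, algebra)[1])+
qed

text \<open>
  A reflection of R^6 exchanges the two families of orthogonal complex structures. Followed by a
  fixed reflection it therefore acts on the first family, and this action lifts to a linear map of
  spinors (up to sign, a Clifford multiplication by two unit vectors).
\<close>

lemma act_reflection_twistor:
  assumes "norm n = 1"
  shows "act (reflection n) (twistor z) = act (reflection (axis 6 1)) (twistor (spin n z))"
  using spin_twistor_homogeneous[of n z] assms
  by (simp add: act_reflection twistor_bivector norm_eq_1)

definition twistors :: "(real^6^6) set" where
  "twistors = (\<lambda>z. (1 / sqrt 3) *\<^sub>R twistor z) ` sphere 0 1"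

lemma twistorsE:
  assumes "W \<in> twistors" obtains z where "norm z = 1" "W = (1 / sqrt 3) *\<^sub>R twistor z"
proof -
  from assms obtain z where "W = (1 / sqrt 3) *\<^sub>R twistor z" "z \<in> sphere 0 1"
    unfolding twistors_def by (rule imageE)
  then show ?thesis by (intro that[of z]) simp_all
qed

lemma twistors_bivectors: "twistors \<subseteq> bivectors"
  unfolding twistors_def by (auto intro: subspace_scale subspace_bivectors twistor_bivector)

lemma smooth_at_twistor: "smooth_at x twistor"
proof -
  have cnj_mult: "smooth_at x (\<lambda>z::complex^4. cnj (z $ a) * z $ b)" for a b
    by (intro smooth_at_bilinear[OF bounded_bilinear_mult] smooth_at_linear_compose[of cnj]
        smooth_intros) (simp add: linear_iff)
  have "smooth_at x (\<lambda>z. herm_re z a b)" "smooth_at x (\<lambda>z. herm_im z a b)" for a b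
    unfolding herm_re_def herm_im_def
    by (rule smooth_at_linear_compose[OF _ cnj_mult]; simp add: linear_iff)+
  then show ?thesis
    unfolding twistor_def by (intro smooth_intros)
qed

lemma compact_twistors: "compact twistors"
  unfolding twistors_def
  by (intro compact_continuous_image compact_sphere continuous_at_imp_continuous_on ballI
      smooth_at_isCont smooth_intros smooth_at_twistor)

lemma reflections_twistors:
  assumes "M \<in> twistors" "norm n = 1" "norm m = 1"
  shows "act (reflection n ** reflection m) M \<in> twistors"
proof -
  let ?D = "reflection (axis 6 1 :: real^6)"
  have D: "orthogonal_matrix ?D" "?D ** ?D = mat 1"
    by (simp_all add: orthogonal_reflection reflection_reflection)
  have flip: "\<exists>M'\<in>twistors. act (reflection n) M = act ?D M'"
    if M: "M \<in> twistors" and n: "norm n = 1" for n M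
  proof -
    obtain z where z: "norm z = 1" "M = (1 / sqrt 3) *\<^sub>R twistor z"
      using M by (rule twistorsE)
    have "norm (spin n z) = 1"
      using z(1) n inner_spin[of n z] by (simp add: norm_eq_1)
    moreover have "act (reflection n) M = act ?D ((1 / sqrt 3) *\<^sub>R twistor (spin n z))"
      by (simp add: z(2) linear_scale[OF linear_act] act_reflection_twistor[OF n])
    ultimately show ?thesis unfolding twistors_def by auto
  qed
  obtain M1 where M1: "M1 \<in> twistors" "act (reflection m) M = act ?D M1"
    using flip[OF assms(1,3)] by blast
  have "norm (?D *v n) = 1" using D(1) assms(2) by (simp add: norm_orthogonal_mult_vec)
  then obtain M2 where M2: "M2 \<in> twistors" "act (reflection (?D *v n)) M1 = act ?D M2"
    using flip[OF M1(1)] by blast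
  have "reflection n ** ?D = ?D ** reflection (?D *v n)"
    using D(2) by (simp add: reflection_conj[OF D(1)] matrix_mul_assoc)
  have "act (reflection n ** reflection m) M = act (reflection n) (act ?D M1)"
    by (simp only: M1(2) flip: act_act)
  also have "\<dots> = act ?D (act (reflection (?D *v n)) M1)"
    by (simp only: act_act \<open>reflection n ** ?D = ?D ** reflection (?D *v n)\<close>)
  finally have "act (reflection n ** reflection m) M = act ?D (act (reflection (?D *v n)) M1)" .
  then show ?thesis using M2 D(2) by (simp add: act_act)
qed

text \<open>
  The rotations that preserve the family of twistors form a compact group that contains the products
  of two reflections, so it still brings every bivector to normal form.
\<close>

lemma twistor_normal_form:
  assumes "W \<in> bivectors"
  obtains k l where "k \<in> SO" "act k W = normal_form l" "l$1 \<ge> l$2" "l$2 \<ge> \<bar>l$3\<bar>"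
    "act k W \<in> twistors \<longleftrightarrow> W \<in> twistors"
proof -
  \<comment> \<open>The condition on the transpose makes K closed under inverses.\<close>
  define K where "K = SO \<inter> (\<Inter>M\<in>twistors. {k. act k M \<in> twistors} \<inter> {k. act (transpose k) M \<in> twistors})"
  have "closed {k. act k M \<in> twistors}" "closed {k. act (transpose k) M \<in> twistors}" for M
    using compact_imp_closed[OF compact_twistors]
    by (auto intro!: closed_vimage[unfolded vimage_def] continuous_at_imp_continuous_on
        smooth_at_isCont smooth_intros)
  then have "compact K"
    unfolding K_def by (intro compact_Int_closed compact_SO closed_INT ballI closed_Int)
  then have 1: "compact ((\<lambda>k. act k W) ` K)"
    by (intro compact_continuous_image continuous_on_act continuous_on_id continuous_on_const)
  have 2: "(\<lambda>k. act k W) ` K \<noteq> {}"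
    using mat_1_SO by (auto simp: K_def transpose_mat intro!: exI[of _ "mat 1"])
  have 3: "(\<lambda>k. act k W) ` K \<subseteq> bivectors" using assms by (auto intro: act_bivector)
  have 4: "act (reflection n ** reflection m) M \<in> (\<lambda>k. act k W) ` K"
    if M: "M \<in> (\<lambda>k. act k W) ` K" and n: "norm n = 1" and m: "norm m = 1" for M n m
  proof -
    obtain k where k: "k \<in> K" "M = act k W" using M by blast
    have "reflection n ** reflection m ** k \<in> K"
      using k(1) reflections_twistors[OF _ n m] reflections_twistors[OF _ m n] reflections_SO[OF n m]
      unfolding K_def by (auto simp: SO_mult matrix_transpose_mul simp flip: act_act)
    then show ?thesis using k(2) by (auto simp: act_act)
  qed
  obtain l where l: "normal_form l \<in> (\<lambda>k. act k W) ` K" "l$1 \<ge> l$2" "l$2 \<ge> \<bar>l$3\<bar>"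
    using invariant_compact_set_meets_chamber[OF 1 2 3 4] by blast
  then obtain k where k: "k \<in> K" "act k W = normal_form l" by auto
  have "act k W \<in> twistors \<longleftrightarrow> W \<in> twistors"
    using k(1) act_transpose_act(1)[of k W] unfolding K_def by auto
  then show ?thesis using that k l(2,3) unfolding K_def by blast
qed

definition vertex_p :: "real^3" where
  "vertex_p = vector [1 / sqrt 3, 1 / sqrt 3, 1 / sqrt 3]"

definition vertex_q :: "real^3" where
  "vertex_q = vector [1 / sqrt 3, 1 / sqrt 3, - 1 / sqrt 3]"

lemma vertex_p_Delta: "vertex_p \<in> Delta" and vertex_q_Delta: "vertex_q \<in> Delta"
  by (simp_all add: Delta_def vertex_p_def vertex_q_def power_divide)

text \<open>
  If the twistor of z has no entries outside of the diagonal blocks, then the products of different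
  coordinates of z vanish, and z lies on a coordinate axis. The four axes have the sign patterns
  (+,+,+), (+,-,-), (-,+,-) and (-,-,+), of which only the first one is in the chamber.
\<close>

lemma twistor_chamber:
  assumes "normal_form l \<in> twistors" "l$1 \<ge> l$2" "l$2 \<ge> \<bar>l$3\<bar>"
  shows "l = vertex_p"
proof -
  obtain z where z: "norm z = 1" "normal_form l = (1 / sqrt 3) *\<^sub>R twistor z"
    using assms(1) by (rule twistorsE)
  have "twistor z = sqrt 3 *\<^sub>R normal_form l" by (simp add: z(2))
  then have t: "twistor z $ i $ j = sqrt 3 * normal_form l $ i $ j" for i j by simp
  define p q where "p = herm_re z" and "q = herm_im z"
  note t = t[of 1 2] t[of 3 4] t[of 5 6] t[of 1 3] t[of 1 4] t[of 2 3] t[of 2 4] t[of 1 5] t[of 1 6]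
    t[of 2 5] t[of 2 6] t[of 3 5] t[of 3 6] t[of 4 5] t[of 4 6]
  note t = t[unfolded twistor_nth, folded p_def q_def]
  have "q 1 4 + q 2 3 = 0" "p 1 4 - p 2 3 = 0" "p 1 4 + p 2 3 = 0" "q 1 4 - q 2 3 = 0"
    "q 2 4 - q 1 3 = 0" "p 1 3 + p 2 4 = 0" "p 1 3 - p 2 4 = 0" "q 1 3 + q 2 4 = 0"
    "q 1 2 + q 3 4 = 0" "p 1 2 - p 3 4 = 0" "p 1 2 + p 3 4 = 0" "q 1 2 - q 3 4 = 0"
    using t(4-) by (simp_all add: normal_form_matrix)
  then have off: "p 1 4 = 0" "p 2 3 = 0" "q 1 4 = 0" "q 2 3 = 0" "p 1 3 = 0" "p 2 4 = 0" "q 1 3 = 0"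
    "q 2 4 = 0" "p 1 2 = 0" "p 3 4 = 0" "q 1 2 = 0" "q 3 4 = 0"
    by linarith+
  have "cnj (z$1) * z$2 = 0" "cnj (z$1) * z$3 = 0" "cnj (z$1) * z$4 = 0"
    "cnj (z$2) * z$3 = 0" "cnj (z$2) * z$4 = 0" "cnj (z$3) * z$4 = 0"
    using off unfolding p_def q_def herm_re_def herm_im_def by (simp_all only: complex_eq_iff zero_complex.sel)
  then have pairs: "z$1 = 0 \<or> z$2 = 0" "z$1 = 0 \<or> z$3 = 0" "z$1 = 0 \<or> z$4 = 0"
    "z$2 = 0 \<or> z$3 = 0" "z$2 = 0 \<or> z$4 = 0" "z$3 = 0 \<or> z$4 = 0"
    by simp_all
  have sum: "p 1 1 + p 2 2 + p 3 3 + p 4 4 = 1"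
    using z(1) by (simp add: norm_eq_1 inner_vec_def sum_4 inner_complex_def p_def herm_re_def)
  have nonneg: "p i i \<ge> 0" for i by (simp add: p_def herm_re_def)
  have l: "sqrt 3 * l$1 = p 1 1 + p 2 2 - p 3 3 - p 4 4" "sqrt 3 * l$2 = p 1 1 - p 2 2 + p 3 3 - p 4 4"
    "sqrt 3 * l$3 = p 1 1 - p 2 2 - p 3 3 + p 4 4"
    using t(1-3) by (simp_all add: normal_form_matrix)
  have "sqrt 3 * l$1 \<ge> 0" "sqrt 3 * l$2 \<ge> 0" using assms(2,3) by auto
  then have "p 1 1 + p 2 2 \<ge> p 3 3 + p 4 4" "p 1 1 + p 3 3 \<ge> p 2 2 + p 4 4"
    unfolding l by linarith+
  moreover have "z$i = 0 \<Longrightarrow> p i i = 0" for i by (simp add: p_def herm_re_def)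
  ultimately have "p 2 2 = 0" "p 3 3 = 0" "p 4 4 = 0"
    using pairs nonneg[of 1] nonneg[of 2] nonneg[of 3] nonneg[of 4] sum by (smt (verit))+
  then have "sqrt 3 * l$1 = 1" "sqrt 3 * l$2 = 1" "sqrt 3 * l$3 = 1" using l sum by simp_all
  then have "l$1 = 1 / sqrt 3" "l$2 = 1 / sqrt 3" "l$3 = 1 / sqrt 3"
    by (simp_all add: eq_divide_eq mult.commute)
  then show ?thesis by (simp add: vertex_p_def vec_eq_iff forall_3)
qed

lemma vertex_p_twistor: "normal_form vertex_p \<in> twistors"
proof -
  have "normal_form vertex_p = (1 / sqrt 3) *\<^sub>R twistor (axis 1 1)"
    by (simp add: twistor_def herm_re_def herm_im_def normal_form_def vertex_p_def axis_def scaleR_add_right)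
  then show ?thesis unfolding twistors_def by (auto intro!: imageI)
qed

text \<open>
  Both sets are preserved when a bivector is brought to normal form within the group that preserves the
  twistors, and both contain just one bivector in the chamber.
\<close>

lemma twistors_orbit: "twistors = orbit (normal_form vertex_p)"
proof (intro equalityI subsetI)
  fix W assume W: "W \<in> twistors"
  then have "W \<in> bivectors" using twistors_bivectors by blast
  then obtain k l where k: "k \<in> SO" "act k W = normal_form l" "l$1 \<ge> l$2" "l$2 \<ge> \<bar>l$3\<bar>"
    "act k W \<in> twistors \<longleftrightarrow> W \<in> twistors" by (rule twistor_normal_form)
  then have "l = vertex_p" using twistor_chamber W by simp
  then have "W = act (transpose k) (normal_form vertex_p)"
    using k(1,2) act_transpose_act(1) by metis
  then show "W \<in> orbit (normal_form vertex_p)" using act_orbit[OF SO_transpose[OF k(1)]] by simp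
next
  fix W assume W: "W \<in> orbit (normal_form vertex_p)"
  have unit: "W \<in> unit_bivectors"
    using W normal_form_Delta[OF vertex_p_Delta] by (auto simp: orbit_def act_unit_bivector)
  then have "W \<in> bivectors" by (simp add: unit_bivectors_def)
  then obtain k l where k: "k \<in> SO" "act k W = normal_form l" "l$1 \<ge> l$2" "l$2 \<ge> \<bar>l$3\<bar>"
    "act k W \<in> twistors \<longleftrightarrow> W \<in> twistors" by (rule twistor_normal_form)
  have "normal_form l \<in> unit_bivectors" using act_unit_bivector[OF k(1) unit] k(2) by simp
  then have "l \<in> Delta" using Delta_if_unit k(3,4) by blast
  moreover have "normal_form l \<in> orbit (normal_form vertex_p)"
    using act_orbit[OF k(1), of W] orbit_trans[OF W] k(2) by simp
  ultimately have "l = vertex_p" using Delta_unique vertex_p_Delta by blast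
  then show "W \<in> twistors" using k(2,5) vertex_p_twistor by simp
qed

text \<open>
  The Hermitian matrix with the entries \<open>cnj (z $ a) * z $ b\<close> is, up to scale, an affine function of the
  twistor of z, as the 15 entries of the twistor together with the norm of z form a basis of the Hermitian
  forms. Each nonzero row of this matrix spans the line of z.
\<close>

definition spinor_matrix :: "real^6^6 \<Rightarrow> complex^4^4" where
  "spinor_matrix W = (let w = sqrt 3 *\<^sub>R W; A = Complex (w$3$6 + w$4$5) (w$4$6 - w$3$5);
     B = Complex (w$1$6 + w$2$5) (w$2$6 - w$1$5); C = Complex (w$1$4 + w$2$3) (w$2$4 - w$1$3);
     D = Complex (w$2$3 - w$1$4) (- (w$1$3 + w$2$4)); E = Complex (w$1$6 - w$2$5) (w$1$5 + w$2$6);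
     F = Complex (w$4$5 - w$3$6) (- (w$3$5 + w$4$6)) in
     vector [vector [of_real (1 + w$1$2 + w$3$4 + w$5$6), A, B, C],
       vector [cnj A, of_real (1 + w$1$2 - w$3$4 - w$5$6), D, E],
       vector [cnj B, cnj D, of_real (1 - w$1$2 + w$3$4 - w$5$6), F],
       vector [cnj C, cnj E, cnj F, of_real (1 - w$1$2 - w$3$4 + w$5$6)]])"

definition unit_twistor :: "complex^4 \<Rightarrow> real^6^6" where
  "unit_twistor z = (1 / (sqrt 3 * (z \<bullet> z))) *\<^sub>R twistor z"

lemma spinor_matrix_unit_twistor:
  assumes "z \<noteq> 0"
  shows "spinor_matrix (unit_twistor z) $ a $ b = of_real (4 / (z \<bullet> z)) * (cnj (z $ a) * z $ b)"
proof -
  define t where "t = z \<bullet> z"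
  have t: "t \<noteq> 0" using assms by (simp add: t_def)
  have sum: "t = herm_re z 1 1 + herm_re z 2 2 + herm_re z 3 3 + herm_re z 4 4"
    by (simp add: t_def inner_vec_def sum_4 inner_complex_def herm_re_def)
  have w: "(sqrt 3 *\<^sub>R unit_twistor z) $ i $ j = twistor z $ i $ j / t" for i j
    by (simp add: unit_twistor_def t_def)
  have entry: "of_real (4 / t) * (cnj (z $ a) * z $ b) = Complex (4 * herm_re z a b / t) (4 * herm_im z a b / t)"
    for a b by (simp add: complex_eq_iff herm_re_def herm_im_def)
  have herm: "herm_re z 2 1 = herm_re z 1 2" "herm_re z 3 1 = herm_re z 1 3" "herm_re z 4 1 = herm_re z 1 4"
    "herm_re z 3 2 = herm_re z 2 3" "herm_re z 4 2 = herm_re z 2 4" "herm_re z 4 3 = herm_re z 3 4"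
    "herm_im z 2 1 = - herm_im z 1 2" "herm_im z 3 1 = - herm_im z 1 3" "herm_im z 4 1 = - herm_im z 1 4"
    "herm_im z 3 2 = - herm_im z 2 3" "herm_im z 4 2 = - herm_im z 2 4" "herm_im z 4 3 = - herm_im z 3 4"
    "herm_im z c c = 0" for c
    by (simp_all add: herm_re_def herm_im_def)
  define p q where "p = (\<lambda>a b. herm_re z a b / t)" and "q = (\<lambda>a b. herm_im z a b / t)"
  have pq: "herm_re z a b = t * p a b" "herm_im z a b = t * q a b" for a b
    using t by (simp_all add: p_def q_def)
  have one: "p 1 1 + p 2 2 + p 3 3 + p 4 4 = 1"
    using t sum by (simp add: p_def flip: add_divide_distrib)
  have "\<forall>a b. spinor_matrix (unit_twistor z) $ a $ b = of_real (4 / t) * (cnj (z $ a) * z $ b)"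
    unfolding forall_4 entry spinor_matrix_def Let_def w twistor_nth herm complex_eq_iff
    unfolding pq
    by (simp add: t add_divide_distrib diff_divide_distrib algebra_simps; use one in \<open>(intro conjI)?; linarith\<close>)
  then show ?thesis by (simp add: t_def)
qed

lemma spinor_matrix_row:
  "z \<noteq> 0 \<Longrightarrow> spinor_matrix (unit_twistor z) $ k = (of_real (4 / (z \<bullet> z)) * cnj (z $ k)) *s z"
  by (simp add: vec_eq_iff spinor_matrix_unit_twistor)

lemma smooth_at_spinor_matrix: "smooth_at W spinor_matrix"
proof -
  have "linear (\<lambda>W. spinor_matrix W - spinor_matrix 0)"
    by (simp add: linear_iff spinor_matrix_def Let_def vec_eq_iff forall_4 complex_eq_iff algebra_simps)
  then have "smooth_at W (\<lambda>W. (spinor_matrix W - spinor_matrix 0) + spinor_matrix 0)"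
    by (intro smooth_at_add smooth_at_linear smooth_at_const)
  then show ?thesis by simp
qed

lemma Re_mult_real: "Re (of_real r * w) = r * Re w" and Im_mult_real: "Im (of_real r * w) = r * Im w"
  by simp_all

lemma unit_twistor_scale:
  assumes "c \<noteq> 0" shows "unit_twistor (c *s z) = unit_twistor z"
proof -
  have "cnj ((c *s z) $ a) * (c *s z) $ b = of_real ((cmod c)\<^sup>2) * (cnj (z $ a) * z $ b)" for a b
    by (simp only: complex_norm_square vector_smult_component complex_cnj_mult mult_ac)
  then have "herm_re (c *s z) a b = (cmod c)\<^sup>2 * herm_re z a b"
    "herm_im (c *s z) a b = (cmod c)\<^sup>2 * herm_im z a b" for a b
    by (simp_all only: herm_re_def herm_im_def Re_mult_real Im_mult_real)
  then have "twistor (c *s z) = (cmod c)\<^sup>2 *\<^sub>R twistor z"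
    by (simp add: twistor_def algebra_simps)
  moreover have "(c *s z) \<bullet> (c *s z) = (cmod c)\<^sup>2 * (z \<bullet> z)"
    unfolding cmod_power2
    by (simp add: inner_vec_def sum_4 inner_complex_def power2_eq_square algebra_simps)
  ultimately show ?thesis using assms by (simp add: unit_twistor_def)
qed

lemma smooth_at_unit_twistor: assumes "z \<noteq> 0" shows "smooth_at z unit_twistor"
proof -
  have eq: "unit_twistor = (\<lambda>z. ((1 / sqrt 3) * (z \<bullet> z) powr (-1)) *\<^sub>R twistor z)"
    by (simp add: unit_twistor_def fun_eq_iff powr_minus_divide)
  show ?thesis
    unfolding eq using assms by (intro smooth_intros smooth_at_twistor) simp
qed

lemma complex_line_scale: "c \<noteq> 0 \<Longrightarrow> complex_line (c *s z) = complex_line z"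
proof -
  have sub: "complex_line (c *s z) \<subseteq> complex_line z" for c z
    by (auto simp: complex_line_def)
  assume "c \<noteq> 0"
  then have "complex_line z = complex_line ((1 / c) *s (c *s z))" by simp
  also have "\<dots> \<subseteq> complex_line (c *s z)" by (rule sub)
  finally show ?thesis using sub by blast
qed

lemma unit_twistor_eq_iff:
  assumes "x \<noteq> 0" "y \<noteq> 0"
  shows "unit_twistor x = unit_twistor y \<longleftrightarrow> complex_line x = complex_line y"
proof
  assume eq: "unit_twistor x = unit_twistor y"
  obtain k where k: "x $ k \<noteq> 0" using assms(1) by (auto simp: vec_eq_iff)
  define c where "c = of_real (4 / (x \<bullet> x)) * cnj (x $ k)"
  define d where "d = of_real (4 / (y \<bullet> y)) * cnj (y $ k)"
  have cd: "c *s x = d *s y"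
    using spinor_matrix_row[OF assms(1), of k] spinor_matrix_row[OF assms(2), of k] eq
    by (simp add: c_def d_def)
  have c: "c \<noteq> 0" using k assms(1) by (simp add: c_def)
  then have "c *s x \<noteq> 0" using assms(1) by simp
  then have "d \<noteq> 0" using cd by auto
  then show "complex_line x = complex_line y"
    using complex_line_scale[OF c, of x] complex_line_scale[of d y] cd by simp
next
  assume "complex_line x = complex_line y"
  moreover have "x \<in> complex_line x" by (auto simp: complex_line_def intro: image_eqI[of _ _ 1])
  ultimately obtain c where "x = c *s y" by (auto simp: complex_line_def)
  then show "unit_twistor x = unit_twistor y" using assms(1) unit_twistor_scale by fastforce
qed

lemma unit_twistor_image: "unit_twistor ` (- {0}) = twistors"
proof (intro equalityI subsetI)
  fix W assume "W \<in> unit_twistor ` (- {0})"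
  then obtain z where z: "z \<noteq> 0" "W = unit_twistor z" by auto
  define c where "c = complex_of_real (1 / norm z)"
  have "c \<noteq> 0" using z(1) by (simp add: c_def)
  have "c *s z = (1 / norm z) *\<^sub>R z"
    by (simp add: c_def vec_eq_iff scaleR_conv_of_real[where 'a = complex])
  then have "norm (c *s z) = 1" using z(1) by simp
  moreover have "W = unit_twistor (c *s z)" using unit_twistor_scale[OF \<open>c \<noteq> 0\<close>] z(2) by simp
  ultimately show "W \<in> twistors"
    by (auto simp: twistors_def unit_twistor_def norm_eq_1)
next
  fix W assume "W \<in> twistors"
  then obtain z where "norm z = 1" "W = (1 / sqrt 3) *\<^sub>R twistor z" by (auto simp: twistors_def)
  then show "W \<in> unit_twistor ` (- {0})"
    by (intro image_eqI[of _ _ z]) (auto simp: unit_twistor_def norm_eq_1)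
qed

text \<open>
  The isometry g serves to treat the orbit at the other U(3) vertex, which is a mirror image of this one.
  A local section is a row of the Hermitian matrix that does not vanish at the given point.
\<close>

lemma diffeo_CP3_act:
  assumes g: "orthogonal_matrix g" shows "diffeo_CP3 (act g ` orbit (normal_form vertex_p))"
proof -
  let ?F = "\<lambda>z. act g (unit_twistor z)"
  have cancel: "act (transpose g) (act g B) = B" for B
    using g by (simp add: act_act orthogonal_matrix_cancel)
  have "\<exists>f. quotient_diffeomorphism (- {0}) complex_line (act g ` twistors) f \<and>
      (\<forall>z\<in>- {0}. f (complex_line z) = ?F z)"
  proof (rule quotient_diffeomorphismI)
    show "?F x = ?F y \<longleftrightarrow> complex_line x = complex_line y" if "x \<in> - {0}" "y \<in> - {0}" for x y
      using that unit_twistor_eq_iff by (metis ComplD cancel singletonI)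
    show "?F ` (- {0}) = act g ` twistors" by (simp add: image_image flip: unit_twistor_image)
    show "smooth_at z ?F" if "z \<in> - {0}" for z
      using that smooth_at_unit_twistor by (auto intro!: smooth_intros)
    fix y assume "y \<in> act g ` twistors"
    then obtain z where z: "z \<noteq> 0" "y = ?F z" by (auto simp flip: unit_twistor_image)
    obtain k where k: "z $ k \<noteq> 0" using z(1) by (auto simp: vec_eq_iff)
    define s where "s = (\<lambda>w. spinor_matrix (act (transpose g) w) $ k)"
    have "smooth_at y (\<lambda>w. act (transpose g) w)" by (intro smooth_intros)
    from smooth_at_vec_nth[OF smooth_at_compose[OF smooth_at_spinor_matrix this]]
    have s: "smooth_at y s" unfolding s_def .
    have sF: "s (?F x) = (of_real (4 / (x \<bullet> x)) * cnj (x $ k)) *s x" if "x \<noteq> 0" for x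
      using that by (simp add: s_def cancel spinor_matrix_row)
    have "s y \<noteq> 0" using sF[OF z(1)] z k by simp
    then have "eventually (\<lambda>w. s w \<bullet> s w > 0) (nhds y)"
      by (intro smooth_at_eventually_pos smooth_intros s) simp
    then have "eventually (\<lambda>w. w \<in> act g ` twistors \<longrightarrow> s w \<in> - {0} \<and> ?F (s w) = w) (nhds y)"
    proof eventually_elim
      case (elim w)
      show ?case
      proof
        assume "w \<in> act g ` twistors"
        then obtain x where x: "x \<noteq> 0" "w = ?F x" by (auto simp flip: unit_twistor_image)
        have nz: "s w \<noteq> 0" using elim by auto
        then have "of_real (4 / (x \<bullet> x)) * cnj (x $ k) \<noteq> 0" using sF[OF x(1)] x(2) by auto
        then have "unit_twistor (s w) = unit_twistor x"
          unfolding x(2) sF[OF x(1)] by (rule unit_twistor_scale)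
        then show "s w \<in> - {0} \<and> ?F (s w) = w" using nz x(2) by simp
      qed
    qed
    then show "\<exists>s. smooth_at y s \<and>
        eventually (\<lambda>w. w \<in> act g ` twistors \<longrightarrow> s w \<in> - {0} \<and> ?F (s w) = w) (nhds y)"
      using s by blast
  qed
  then show ?thesis unfolding diffeo_CP3_def twistors_orbit by blast
qed

lemma diffeo_CP3_vertex_p: "diffeo_CP3 (orbit (normal_form vertex_p))"
  using diffeo_CP3_act[OF orthogonal_matrix_id] by simp

lemma diffeo_CP3_vertex_q: "diffeo_CP3 (orbit (normal_form vertex_q))"
proof -
  let ?D = "reflection (axis 6 1 :: real^6)"
  have D: "orthogonal_matrix ?D" "?D ** ?D = mat 1" "det ?D = - 1"
    by (simp_all add: orthogonal_reflection reflection_reflection det_reflection)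
  have "normal_form vertex_p *v axis 6 1 = (1 / sqrt 3) *\<^sub>R axis 5 1"
    by (simp add: normal_form_mult_vec vertex_p_def vec_eq_iff forall_6 axis_def)
  then have Dp: "act ?D (normal_form vertex_p) = normal_form vertex_q"
    by (simp add: act_reflection normal_form_bivector)
      (simp add: normal_form_matrix vertex_p_def vertex_q_def wedge_def axis_def vec_eq_iff forall_6)
  have conj: "?D ** k ** ?D \<in> SO" if "k \<in> SO" for k
    using that D by (simp add: SO_iff orthogonal_matrix_mul det_mul)
  have "act ?D ` orbit (normal_form vertex_p) = orbit (normal_form vertex_q)"
  proof (intro equalityI subsetI)
    fix W assume "W \<in> act ?D ` orbit (normal_form vertex_p)"
    then obtain k where k: "k \<in> SO" "W = act ?D (act k (normal_form vertex_p))"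
      by (auto simp: orbit_def)
    have "act (?D ** k ** ?D) (normal_form vertex_q) = act (?D ** k ** (?D ** ?D)) (normal_form vertex_p)"
      by (simp only: act_act matrix_mul_assoc flip: Dp)
    then have "W = act (?D ** k ** ?D) (normal_form vertex_q)"
      using k(2) by (simp add: D(2) act_act)
    then show "W \<in> orbit (normal_form vertex_q)" using act_orbit[OF conj[OF k(1)]] by simp
  next
    fix W assume "W \<in> orbit (normal_form vertex_q)"
    then obtain k where k: "k \<in> SO" "W = act k (normal_form vertex_q)" by (auto simp: orbit_def)
    have "act ?D (act (?D ** k ** ?D) (normal_form vertex_p)) = act ((?D ** ?D) ** k) (act ?D (normal_form vertex_p))"
      by (simp only: act_act matrix_mul_assoc)
    then have "W = act ?D (act (?D ** k ** ?D) (normal_form vertex_p))"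
      using k(2) by (simp add: D(2) Dp)
    then show "W \<in> act ?D ` orbit (normal_form vertex_p)" using act_orbit[OF conj[OF k(1)]] by blast
  qed
  then show ?thesis using diffeo_CP3_act[OF D(1)] by simp
qed


section \<open>The Grassmannian of oriented planes\<close>

lemma bounded_bilinear_wedge: "bounded_bilinear wedge"
  unfolding bilinear_conv_bounded_bilinear[symmetric] bilinear_def linear_iff
  by (simp add: wedge_def vec_eq_iff algebra_simps)

lemmas smooth_at_wedge [smooth_intros] = smooth_at_bilinear[OF bounded_bilinear_wedge]

definition gram :: "(real^6) \<times> (real^6) \<Rightarrow> real" where
  "gram x = (fst x \<bullet> fst x) * (snd x \<bullet> snd x) - (fst x \<bullet> snd x)\<^sup>2"

lemma gram_nonneg: "gram x \<ge> 0"
  using Cauchy_Schwarz_ineq[of "fst x" "snd x"] by (simp add: gram_def)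

lemma bases_2_iff: "(u, v) \<in> bases_2 \<longleftrightarrow> gram (u, v) > 0"
proof -
  have "(u, v) \<in> bases_2 \<longleftrightarrow> v \<noteq> 0 \<and> (\<forall>k. u \<noteq> k *\<^sub>R v)"
  proof -
    have "u = v \<Longrightarrow> \<exists>k. u = k *\<^sub>R v" by (rule exI[of _ 1]) simp
    then show ?thesis
      by (auto simp: bases_2_def independent_insert span_singleton)
  qed
  also have "\<dots> \<longleftrightarrow> gram (u, v) > 0"
  proof
    assume *: "v \<noteq> 0 \<and> (\<forall>k. u \<noteq> k *\<^sub>R v)"
    have "gram (u, v) \<noteq> 0"
    proof
      assume g: "gram (u, v) = 0"
      let ?d = "(v \<bullet> v) *\<^sub>R u - (u \<bullet> v) *\<^sub>R v"
      have "?d \<bullet> ?d = (v \<bullet> v) * gram (u, v)"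
        by (simp add: gram_def inner_diff_left inner_diff_right inner_commute[of v u]
            power2_eq_square algebra_simps)
      then have "(v \<bullet> v) *\<^sub>R u = (u \<bullet> v) *\<^sub>R v" using g by simp
      then have "(1 / (v \<bullet> v)) *\<^sub>R ((v \<bullet> v) *\<^sub>R u) = (1 / (v \<bullet> v)) *\<^sub>R ((u \<bullet> v) *\<^sub>R v)" by simp
      then have "u = ((u \<bullet> v) / (v \<bullet> v)) *\<^sub>R v" using * by simp
      then show False using * by blast
    qed
    then show "gram (u, v) > 0" using gram_nonneg[of "(u, v)"] by simp
  next
    assume "gram (u, v) > 0"
    then show "v \<noteq> 0 \<and> (\<forall>k. u \<noteq> k *\<^sub>R v)"
      by (auto simp: gram_def power2_eq_square)
  qed
  finally show ?thesis .
qed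

lemma wedge_combination:
  "wedge (a *\<^sub>R u + b *\<^sub>R v) (c *\<^sub>R u + d *\<^sub>R v) = (a * d - b * c) *\<^sub>R wedge u v"
  by (simp add: wedge_def vec_eq_iff algebra_simps)

lemma gram_combination:
  "gram (a *\<^sub>R u + b *\<^sub>R v, c *\<^sub>R u + d *\<^sub>R v) = (a * d - b * c)\<^sup>2 * gram (u, v)"
  by (simp add: gram_def inner_add_left inner_add_right inner_commute[of v u] power2_eq_square
      algebra_simps)

lemma gram_eq_inner: "wedge u v \<bullet> wedge u v = 2 * gram (u, v)"
  using bivector_inner_wedge[of u v u v]
  by (simp add: bivector_inner_def gram_def inner_commute[of v u] power2_eq_square)

lemma wedge_cube: "wedge u v *v (wedge u v *v (wedge u v *v x)) = - gram (u, v) *\<^sub>R (wedge u v *v x)"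
  by (simp add: wedge_mult_vec gram_def matrix_vector_mult_diff_distrib matrix_vector_mult_scaleR
      inner_commute[of v u] power2_eq_square algebra_simps)

text \<open>
  A basis vector is recovered by applying the wedge product of the basis to a suitable vector, so it is a
  combination of the other basis. The factor c is the determinant of this change of basis.
\<close>

lemma basis_from_wedge:
  assumes uv: "gram (u', v') > 0" and c: "c > 0" and eq: "wedge u' v' = c *\<^sub>R wedge u v"
    and g: "gram (u, v) > 0"
  shows "(u', v') \<in> oriented_plane (u, v)"
proof -
  have comb: "\<exists>a b. (1 / gram (u', v')) *\<^sub>R (wedge u' v' *v t) = a *\<^sub>R u + b *\<^sub>R v" for t
  proof -
    have "(1 / gram (u', v')) *\<^sub>R (wedge u' v' *v t) =
        (c * (v \<bullet> t) / gram (u', v')) *\<^sub>R u + (- c * (u \<bullet> t) / gram (u', v')) *\<^sub>R v"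
      by (simp add: eq wedge_mult_vec algebra_simps flip: scaleR_matrix_vector_assoc)
    then show ?thesis by blast
  qed
  have "wedge u' v' *v ((u' \<bullet> u') *\<^sub>R v' - (u' \<bullet> v') *\<^sub>R u') = gram (u', v') *\<^sub>R u'"
    by (simp add: wedge_mult_vec inner_diff_right inner_commute[of v' u'] gram_def power2_eq_square
        algebra_simps)
  moreover have "wedge u' v' *v ((u' \<bullet> v') *\<^sub>R v' - (v' \<bullet> v') *\<^sub>R u') = gram (u', v') *\<^sub>R v'"
    by (simp add: wedge_mult_vec inner_diff_right inner_commute[of v' u'] gram_def power2_eq_square
        algebra_simps)
  ultimately have "(1 / gram (u', v')) *\<^sub>R (wedge u' v' *v ((u' \<bullet> u') *\<^sub>R v' - (u' \<bullet> v') *\<^sub>R u')) = u'"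
    "(1 / gram (u', v')) *\<^sub>R (wedge u' v' *v ((u' \<bullet> v') *\<^sub>R v' - (v' \<bullet> v') *\<^sub>R u')) = v'"
    using uv by simp_all
  then obtain a b c' d where ab: "u' = a *\<^sub>R u + b *\<^sub>R v" and cd: "v' = c' *\<^sub>R u + d *\<^sub>R v"
    using comb by metis
  have "(a * d - b * c') *\<^sub>R wedge u v = c *\<^sub>R wedge u v"
    using eq unfolding ab cd wedge_combination .
  moreover have "wedge u v \<noteq> 0" using gram_eq_inner[of u v] g by auto
  ultimately have "a * d - b * c' > 0" using c by simp
  then show ?thesis unfolding oriented_plane_def ab cd by auto
qed

lemma oriented_plane_self: "(u, v) \<in> oriented_plane (u, v)"
proof -
  have "(u, v) = (1 *\<^sub>R u + 0 *\<^sub>R v, 0 *\<^sub>R u + 1 *\<^sub>R v) \<and> (0 :: real) < 1 * 1 - 0 * 0" by simp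
  then show ?thesis unfolding oriented_plane_def by blast
qed

lemma oriented_plane_mono:
  assumes "(u', v') \<in> oriented_plane (u, v)"
  shows "oriented_plane (u', v') \<subseteq> oriented_plane (u, v)"
proof
  obtain a b c d where 1: "u' = a *\<^sub>R u + b *\<^sub>R v" "v' = c *\<^sub>R u + d *\<^sub>R v" "a * d - b * c > 0"
    using assms by (auto simp: oriented_plane_def)
  fix x assume "x \<in> oriented_plane (u', v')"
  then obtain a' b' c' d' where
    2: "x = (a' *\<^sub>R u' + b' *\<^sub>R v', c' *\<^sub>R u' + d' *\<^sub>R v')" "a' * d' - b' * c' > 0"
    by (auto simp: oriented_plane_def)
  have "x = ((a' * a + b' * c) *\<^sub>R u + (a' * b + b' * d) *\<^sub>R v,
      (c' * a + d' * c) *\<^sub>R u + (c' * b + d' * d) *\<^sub>R v)"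
    by (simp add: 2 1(1,2) algebra_simps)
  moreover have "(a' * a + b' * c) * (c' * b + d' * d) - (a' * b + b' * d) * (c' * a + d' * c) =
      (a' * d' - b' * c') * (a * d - b * c)"
    by (simp add: algebra_simps)
  then have "(a' * a + b' * c) * (c' * b + d' * d) - (a' * b + b' * d) * (c' * a + d' * c) > 0"
    using 1(3) 2(2) by simp
  ultimately show "x \<in> oriented_plane (u, v)" unfolding oriented_plane_def by blast
qed

definition unit_wedge :: "(real^6) \<times> (real^6) \<Rightarrow> real^6^6" where
  "unit_wedge x = (gram x powr (-1/2)) *\<^sub>R wedge (fst x) (snd x)"

lemma powr_half_square: "t > 0 \<Longrightarrow> (t powr (-1/2)) * (t powr (-1/2)) = 1 / t" for t :: real
  by (simp add: powr_minus_divide flip: powr_add)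

lemma unit_wedge_combination:
  assumes "a * d - b * c > 0"
  shows "unit_wedge (a *\<^sub>R u + b *\<^sub>R v, c *\<^sub>R u + d *\<^sub>R v) = unit_wedge (u, v)"
proof -
  let ?e = "a * d - b * c"
  have "(?e\<^sup>2 * gram (u, v)) powr (-1/2) = (?e\<^sup>2) powr (-1/2) * gram (u, v) powr (-1/2)"
    using gram_nonneg by (simp add: powr_mult)
  also have "(?e\<^sup>2) powr (-1/2) = ?e powr (-1)"
    using assms by (simp add: powr_powr flip: powr_numeral)
  finally have "(?e\<^sup>2 * gram (u, v)) powr (-1/2) * ?e = gram (u, v) powr (-1/2)"
    using assms by (simp add: powr_minus_divide)
  then show ?thesis
    by (simp add: unit_wedge_def gram_combination wedge_combination)
qed

lemma unit_wedge_eq_iff: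
  assumes "x \<in> bases_2" "y \<in> bases_2"
  shows "unit_wedge x = unit_wedge y \<longleftrightarrow> oriented_plane x = oriented_plane y"
proof -
  obtain u v u' v' where xy: "x = (u, v)" "y = (u', v')" by (metis surj_pair)
  have g: "gram (u, v) > 0" "gram (u', v') > 0" using assms by (simp_all add: xy bases_2_iff)
  show ?thesis
  proof
    assume "unit_wedge x = unit_wedge y"
    then have eq: "gram (u, v) powr (-1/2) *\<^sub>R wedge u v = gram (u', v') powr (-1/2) *\<^sub>R wedge u' v'"
      by (simp add: unit_wedge_def xy)
    have mem: "(u', v') \<in> oriented_plane (u, v)"
      if "gram (u, v) > 0" "gram (u', v') > 0"
        "gram (u, v) powr (-1/2) *\<^sub>R wedge u v = gram (u', v') powr (-1/2) *\<^sub>R wedge u' v'" for u v u' v'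
    proof (rule basis_from_wedge[OF that(2) _ _ that(1)])
      show "gram (u, v) powr (-1/2) / gram (u', v') powr (-1/2) > 0" using that by simp
      have "(1 / gram (u', v') powr (-1/2)) *\<^sub>R (gram (u', v') powr (-1/2) *\<^sub>R wedge u' v') = wedge u' v'"
        using that(2) by simp
      then show "wedge u' v' = (gram (u, v) powr (-1/2) / gram (u', v') powr (-1/2)) *\<^sub>R wedge u v"
        unfolding that(3)[symmetric] by simp
    qed
    show "oriented_plane x = oriented_plane y"
      using oriented_plane_mono[OF mem[OF g eq]] oriented_plane_mono[OF mem[OF g(2,1) eq[symmetric]]]
      by (auto simp: xy)
  next
    assume "oriented_plane x = oriented_plane y"
    then have "(u', v') \<in> oriented_plane (u, v)" using oriented_plane_self[of u' v'] xy by simp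
    then obtain a b c d where "u' = a *\<^sub>R u + b *\<^sub>R v" "v' = c *\<^sub>R u + d *\<^sub>R v" "a * d - b * c > 0"
      by (auto simp: oriented_plane_def)
    then show "unit_wedge x = unit_wedge y" using unit_wedge_combination xy by simp
  qed
qed

definition vertex_r :: "real^3" where "vertex_r = vector [1, 0, 0]"

lemma vertex_r_Delta: "vertex_r \<in> Delta"
  by (simp add: Delta_def vertex_r_def)

lemma normal_form_vertex_r: "normal_form vertex_r = wedge (axis 1 1) (axis 2 1)"
  by (simp add: normal_form_def vertex_r_def e2_def)

lemma act_unit_wedge:
  assumes "g \<in> SO" shows "unit_wedge (g *v u, g *v v) = act g (unit_wedge (u, v))"
  using assms by (simp add: unit_wedge_def gram_def SO_inner linear_scale[OF linear_act] act_wedge)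

lemma unit_wedge_axis: "unit_wedge (axis 1 1, axis 2 1) = normal_form vertex_r"
  by (simp add: unit_wedge_def normal_form_vertex_r gram_def inner_axis_axis)

text \<open>
  A normalized wedge product W satisfies \<open>W\<^sup>3 = - W\<close>, so the largest parameter of its normal form is 1
  and the others vanish.
\<close>

lemma unit_wedge_image: "unit_wedge ` bases_2 = orbit (normal_form vertex_r)"
proof (intro equalityI subsetI)
  fix W assume "W \<in> unit_wedge ` bases_2"
  then obtain u v where uv: "gram (u, v) > 0" "W = unit_wedge (u, v)"
    using bases_2_iff by fastforce
  let ?c = "gram (u, v) powr (-1/2)"
  have W: "W = ?c *\<^sub>R wedge u v" by (simp add: uv(2) unit_wedge_def)
  have unit: "W \<in> unit_bivectors"
    using uv(1) powr_half_square[OF uv(1)] gram_eq_inner[of u v]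
    by (simp add: W unit_bivectors_def bivector_inner_def subspace_scale[OF subspace_bivectors]
        wedge_bivector mult.assoc[symmetric])
  have cube: "W *v (W *v (W *v x)) = - (W *v x)" for x
    using powr_half_square[OF uv(1)] uv(1)
    by (simp add: W wedge_cube matrix_vector_mult_scaleR mult.assoc[symmetric]
        flip: scaleR_matrix_vector_assoc)
  obtain l g where l: "l \<in> Delta" and g: "g \<in> SO" "act g W = normal_form l"
    using normal_form_exists[OF unit] by blast
  have W_act: "normal_form l *v x = g *v (W *v (transpose g *v x))" for x
    by (simp add: act_mult_vec flip: g(2))
  have "normal_form l *v (normal_form l *v (normal_form l *v x)) = - (normal_form l *v x)" for x
    using g(1)
    by (simp add: W_act matrix_vector_mul_assoc[of "transpose g" g] SO_cancel cube mult_vec_minus)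
  from arg_cong[OF this[of "axis 1 1"], of "\<lambda>x. x $ 2"]
  have "(l$1)\<^sup>2 * l$1 = l$1"
    unfolding normal_form_square by (simp add: normal_form_mult_vec)
  then have "l$1 = 1" using Delta_pos[OF l] by (simp add: power2_eq_1_iff)
  then have "(l$2)\<^sup>2 + (l$3)\<^sup>2 = 0" using l unfolding Delta_def by simp
  then have "l$2 = 0 \<and> l$3 = 0" by (simp only: sum_power2_eq_zero_iff)
  then have "l = vertex_r" using \<open>l$1 = 1\<close> by (simp add: vertex_r_def vec_eq_iff forall_3)
  then have "W = act (transpose g) (normal_form vertex_r)"
    using g act_transpose_act(1) by metis
  then show "W \<in> orbit (normal_form vertex_r)" using act_orbit[OF SO_transpose[OF g(1)]] by simp
next
  fix W assume "W \<in> orbit (normal_form vertex_r)"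
  then obtain h where h: "h \<in> SO" "W = act h (normal_form vertex_r)" by (auto simp: orbit_def)
  then have W: "W = unit_wedge (h *v axis 1 1, h *v axis 2 1)"
    by (simp only: act_unit_wedge unit_wedge_axis)
  have "(h *v axis 1 1, h *v axis 2 1) \<in> bases_2"
    using h(1) by (simp add: bases_2_iff gram_def SO_inner inner_axis_axis)
  then show "W \<in> unit_wedge ` bases_2" using W by blast
qed

text \<open>
  Near the plane with orthonormal basis a, b, a basis of the plane of w is formed by the images under w
  of b and - a, that is, by the projections of these vectors turned by a right angle. For w = a \<and> b
  these are the vectors a and b.
\<close>

lemma diffeo_Gr2_vertex_r: "diffeo_Gr2 (orbit (normal_form vertex_r))"
proof -
  let ?N = "orbit (normal_form vertex_r)"
  have "\<exists>f. quotient_diffeomorphism bases_2 oriented_plane ?N f \<and>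
      (\<forall>x\<in>bases_2. f (oriented_plane x) = unit_wedge x)"
  proof (rule quotient_diffeomorphismI)
    show "unit_wedge x = unit_wedge y \<longleftrightarrow> oriented_plane x = oriented_plane y"
      if "x \<in> bases_2" "y \<in> bases_2" for x y by (rule unit_wedge_eq_iff[OF that])
    show "unit_wedge ` bases_2 = ?N" by (rule unit_wedge_image)
    show "smooth_at x unit_wedge" if "x \<in> bases_2" for x
    proof -
      have "gram x > 0" using that bases_2_iff by (metis surj_pair)
      moreover have "smooth_at x gram"
        unfolding gram_def power2_eq_square by (intro smooth_intros)
      ultimately show ?thesis unfolding unit_wedge_def by (intro smooth_intros)
    qed
    fix y assume "y \<in> ?N"
    then obtain h where h: "h \<in> SO" "y = act h (normal_form vertex_r)" by (auto simp: orbit_def)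
    define a b where "a = h *v axis 1 1" and "b = h *v axis 2 1"
    have y: "y = wedge a b" by (simp add: h(2) normal_form_vertex_r act_wedge a_def b_def)
    have ab: "a \<bullet> a = 1" "b \<bullet> b = 1" "a \<bullet> b = 0" "b \<bullet> a = 0"
      using h(1) by (simp_all add: a_def b_def SO_inner inner_axis_axis)
    define s where "s = (\<lambda>w::real^6^6. (w *v b, - (w *v a)))"
    have s: "smooth_at y s" unfolding s_def by (intro smooth_intros)
    have "y \<bullet> y > 0" by (simp add: y gram_eq_inner gram_def ab)
    then have "eventually (\<lambda>w. w \<bullet> y > 0) (nhds y)"
      by (intro smooth_at_eventually_pos smooth_intros)
    then have "eventually (\<lambda>w. w \<in> ?N \<longrightarrow> s w \<in> bases_2 \<and> unit_wedge (s w) = w) (nhds y)"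
    proof eventually_elim
      case (elim w)
      show ?case
      proof
        assume "w \<in> ?N"
        then obtain k where k: "k \<in> SO" "w = act k (normal_form vertex_r)" by (auto simp: orbit_def)
        define u v where "u = k *v axis 1 1" and "v = k *v axis 2 1"
        have w: "w = wedge u v" "w = unit_wedge (u, v)"
          using act_unit_wedge[OF k(1)] unit_wedge_axis
          by (simp_all add: k(2) normal_form_vertex_r act_wedge u_def v_def)
        have g: "gram (u, v) = 1"
          using k(1) by (simp add: u_def v_def gram_def SO_inner inner_axis_axis)
        let ?d = "(v \<bullet> b) * (u \<bullet> a) - (- (u \<bullet> b)) * (- (v \<bullet> a))"
        have sw: "s w = ((v \<bullet> b) *\<^sub>R u + (- (u \<bullet> b)) *\<^sub>R v, (- (v \<bullet> a)) *\<^sub>R u + (u \<bullet> a) *\<^sub>R v)"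
          by (simp add: s_def w(1) wedge_mult_vec)
        have "w \<bullet> y = 2 * ?d"
          using bivector_inner_wedge[of u v a b] by (simp add: w(1) y bivector_inner_def)
        then have d: "?d > 0" using elim by simp
        then have "s w \<in> bases_2"
          unfolding sw bases_2_iff gram_combination g by simp
        moreover have "unit_wedge (s w) = w"
          by (simp only: sw unit_wedge_combination[OF d] w(2)[symmetric])
        ultimately show "s w \<in> bases_2 \<and> unit_wedge (s w) = w" by blast
      qed
    qed
    then show "\<exists>s. smooth_at y s \<and>
        eventually (\<lambda>w. w \<in> ?N \<longrightarrow> s w \<in> bases_2 \<and> unit_wedge (s w) = w) (nhds y)"
      using s by blast
  qed
  then obtain f where f: "quotient_diffeomorphism bases_2 oriented_plane ?N f"
    "\<forall>x\<in>bases_2. f (oriented_plane x) = unit_wedge x" by blast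
  have "f (oriented_plane (g *v u, g *v v)) = act g (f (oriented_plane (u, v)))"
    if g: "g \<in> SO" and uv: "(u, v) \<in> bases_2" for g u v
  proof -
    have "(g *v u, g *v v) \<in> bases_2" using uv g by (simp add: bases_2_iff gram_def SO_inner)
    then show ?thesis using f(2) uv act_unit_wedge[OF g] by simp
  qed
  then show ?thesis unfolding diffeo_Gr2_def using f(1) by blast
qed


section \<open>The spherical triangle\<close>

lemma vertices_distinct: "vertex_p \<noteq> vertex_q" "vertex_p \<noteq> vertex_r" "vertex_q \<noteq> vertex_r"
  by (simp_all add: vertex_p_def vertex_q_def vertex_r_def vec_eq_iff forall_3)

lemma vertex_combination:
  "(a *\<^sub>R vertex_p + b *\<^sub>R vertex_q + c *\<^sub>R vertex_r) $ 1 = (a + b) / sqrt 3 + c"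
  "(a *\<^sub>R vertex_p + b *\<^sub>R vertex_q + c *\<^sub>R vertex_r) $ 2 = (a + b) / sqrt 3"
  "(a *\<^sub>R vertex_p + b *\<^sub>R vertex_q + c *\<^sub>R vertex_r) $ 3 = (a - b) / sqrt 3"
  by (simp_all add: vertex_p_def vertex_q_def vertex_r_def add_divide_distrib diff_divide_distrib)

lemma vertex_combination_eq_0:
  assumes "a *\<^sub>R vertex_p + b *\<^sub>R vertex_q + c *\<^sub>R vertex_r = 0"
  shows "a = 0 \<and> b = 0 \<and> c = 0"
proof -
  have "(a + b) / sqrt 3 + c = 0" "(a + b) / sqrt 3 = 0" "(a - b) / sqrt 3 = 0"
    using assms vertex_combination[of a b c] by simp_all
  then show ?thesis by simp
qed

lemma vertices_independent: "independent {vertex_p, vertex_q, vertex_r}"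
  unfolding independent_explicit
proof (intro conjI allI impI ballI)
  fix u v
  assume "(\<Sum>v\<in>{vertex_p, vertex_q, vertex_r}. u v *\<^sub>R v) = 0" "v \<in> {vertex_p, vertex_q, vertex_r}"
  then show "u v = 0"
    using vertex_combination_eq_0[of "u vertex_p" "u vertex_q" "u vertex_r"] vertices_distinct
    by (auto simp: add.assoc)
qed simp

text \<open>The cone condition is homogeneous, so it survives the radial projection.\<close>

lemma sgn_combination_Delta:
  assumes "a \<ge> 0" "b \<ge> 0" "c \<ge> 0" "a + b + c > 0"
  defines "x \<equiv> a *\<^sub>R vertex_p + b *\<^sub>R vertex_q + c *\<^sub>R vertex_r"
  shows "sgn x \<in> Delta" "\<exists>t>0. sgn x = t *\<^sub>R x"
proof -
  have "x \<noteq> 0" using vertex_combination_eq_0[of a b c] assms by auto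
  then have t: "inverse (norm x) > 0" by simp
  then show "\<exists>t>0. sgn x = t *\<^sub>R x" unfolding sgn_div_norm by blast
  have "x$1 \<ge> x$2" "x$2 \<ge> \<bar>x$3\<bar>"
    using assms(1-3) unfolding x_def vertex_combination by (auto simp: abs_le_iff divide_le_cancel minus_divide_left)
  moreover have "sgn x $ i = inverse (norm x) * x $ i" for i by (simp add: sgn_div_norm)
  ultimately have "sgn x $ 1 \<ge> sgn x $ 2" "sgn x $ 2 \<ge> \<bar>sgn x $ 3\<bar>"
    using t by (simp_all add: abs_mult)
  moreover have "norm (sgn x) = 1" using \<open>x \<noteq> 0\<close> by (simp add: norm_sgn)
  then have "(sgn x $ 1)\<^sup>2 + (sgn x $ 2)\<^sup>2 + (sgn x $ 3)\<^sup>2 = 1"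
    by (simp only: norm_eq_1 inner_vec_def sum_3 power2_eq_square inner_real_def)
  ultimately show "sgn x \<in> Delta" by (simp add: Delta_def)
qed

lemma Delta_spherical_triangle: "spherical_triangle {vertex_p, vertex_q, vertex_r} Delta"
  unfolding spherical_triangle_def
proof (intro conjI)
  show "card {vertex_p, vertex_q, vertex_r} = 3" using vertices_distinct by simp
  show "{vertex_p, vertex_q, vertex_r} \<subseteq> sphere 0 1"
    by (simp add: norm_eq_1 inner_vec_def sum_3 vertex_p_def vertex_q_def vertex_r_def)
  show "independent {vertex_p, vertex_q, vertex_r}" by (rule vertices_independent)
  show "Delta = sgn ` (convex hull {vertex_p, vertex_q, vertex_r})"
  proof (intro equalityI subsetI)
    fix l assume l: "l \<in> Delta"
    define a b c where "a = sqrt 3 * (l$2 + l$3) / 2" and "b = sqrt 3 * (l$2 - l$3) / 2" and "c = l$1 - l$2"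
    have abc: "a \<ge> 0" "b \<ge> 0" "c \<ge> 0" using l by (auto simp: Delta_def a_def b_def c_def)
    have "a + b = sqrt 3 * l$2" "a - b = sqrt 3 * l$3"
      by (simp_all add: a_def b_def algebra_simps flip: add_divide_distrib diff_divide_distrib)
    then have l_eq: "l = a *\<^sub>R vertex_p + b *\<^sub>R vertex_q + c *\<^sub>R vertex_r"
      unfolding vec_eq_iff forall_3 vertex_combination by (simp add: c_def)
    have s: "a + b + c > 0"
    proof (rule ccontr)
      assume "\<not> a + b + c > 0"
      then have "a = 0" "b = 0" "c = 0" using abc by auto
      then show False using l_eq Delta_pos[OF l] by simp
    qed
    let ?x = "(1 / (a + b + c)) *\<^sub>R l"
    have "a / (a + b + c) + b / (a + b + c) + c / (a + b + c) = 1"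
      using s by (simp flip: add_divide_distrib)
    moreover have "?x = (a / (a + b + c)) *\<^sub>R vertex_p + (b / (a + b + c)) *\<^sub>R vertex_q +
        (c / (a + b + c)) *\<^sub>R vertex_r"
      by (subst l_eq) (simp add: scaleR_add_right)
    ultimately have "?x \<in> convex hull {vertex_p, vertex_q, vertex_r}"
      unfolding convex_hull_3 using abc s
      by (intro CollectI exI[of _ "a / (a + b + c)"] exI[of _ "b / (a + b + c)"] exI[of _ "c / (a + b + c)"]) simp
    moreover have "norm l = 1"
      using l by (simp add: Delta_def norm_eq_1 inner_vec_def sum_3 power2_eq_square)
    then have "sgn ?x = l" using s by (simp add: sgn_scaleR sgn_div_norm)
    ultimately show "l \<in> sgn ` (convex hull {vertex_p, vertex_q, vertex_r})" by force
  next
    fix l assume "l \<in> sgn ` (convex hull {vertex_p, vertex_q, vertex_r})"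
    then obtain a b c where "a \<ge> 0" "b \<ge> 0" "c \<ge> 0" "a + b + c = 1"
      "l = sgn (a *\<^sub>R vertex_p + b *\<^sub>R vertex_q + c *\<^sub>R vertex_r)"
      unfolding convex_hull_3 by auto
    then show "l \<in> Delta" using sgn_combination_Delta(1)[of a b c] by simp
  qed
qed

text \<open>
  Points of the open face have positive barycentric coordinates at the vertices of the face, and the
  coordinates at the other vertices vanish.
\<close>

lemma open_spherical_face_coordinates:
  assumes W: "W \<subseteq> {vertex_p, vertex_q, vertex_r}" and l: "l \<in> open_spherical_face W"
  shows "\<exists>a b c. l \<in> Delta \<and> l = a *\<^sub>R vertex_p + b *\<^sub>R vertex_q + c *\<^sub>R vertex_r \<and>
    (if vertex_p \<in> W then a > 0 else a = 0) \<and> (if vertex_q \<in> W then b > 0 else b = 0) \<and>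
    (if vertex_r \<in> W then c > 0 else c = 0)"
proof -
  have "\<not> affine_dependent W"
    using vertices_independent W independent_mono affine_dependent_imp_dependent by metis
  then obtain y u where y: "l = sgn y" "\<forall>x\<in>W. 0 < u x" "sum u W = 1" "(\<Sum>x\<in>W. u x *\<^sub>R x) = y"
    using l unfolding open_spherical_face_def by (auto simp: rel_interior_convex_hull_explicit)
  define w where "w = (\<lambda>x. if x \<in> W then u x else 0)"
  have "sum g W = sum (\<lambda>x. if x \<in> W then g x else 0) {vertex_p, vertex_q, vertex_r}"
    for g :: "real^3 \<Rightarrow> 'c::comm_monoid_add"
    using W by (intro sum.mono_neutral_cong_left) auto
  note this[of u] this[of "\<lambda>x. u x *\<^sub>R x"]
  then have sums: "w vertex_p + w vertex_q + w vertex_r = 1"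
    "w vertex_p *\<^sub>R vertex_p + w vertex_q *\<^sub>R vertex_q + w vertex_r *\<^sub>R vertex_r = y"
    using y(3,4) vertices_distinct by (auto simp: w_def add.assoc)
  have nonneg: "w x \<ge> 0" for x using y(2) by (auto simp: w_def intro: less_imp_le)
  note D = sgn_combination_Delta[OF nonneg nonneg nonneg, of vertex_p vertex_q vertex_r, unfolded sums]
  obtain t where t: "t > 0" "sgn y = t *\<^sub>R y" using D(2) by auto
  have "l = (t * w vertex_p) *\<^sub>R vertex_p + (t * w vertex_q) *\<^sub>R vertex_q + (t * w vertex_r) *\<^sub>R vertex_r"
    unfolding y(1) t(2) by (subst sums(2)[symmetric]) (simp add: scaleR_add_right)
  moreover have "l \<in> Delta" using D(1) y(1) by simp
  moreover have "if x \<in> W then t * w x > 0 else t * w x = 0" for x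
    using y(2) t(1) by (simp add: w_def)
  ultimately show ?thesis by blast
qed

lemma Delta_vertex_sets:
  "{l \<in> Delta. l$1 = l$2 \<and> l$2 = l$3} = {vertex_p}"
  "{l \<in> Delta. l$1 = l$2 \<and> l$2 = - l$3} = {vertex_q}"
  "{l \<in> Delta. l$2 = 0 \<and> l$3 = 0} = {vertex_r}"
proof -
  have root: "x = 1 / sqrt 3" if "x > 0" "x\<^sup>2 + x\<^sup>2 + x\<^sup>2 = 1" for x :: real
  proof -
    have "(sqrt 3 * x)\<^sup>2 = 1\<^sup>2" using that(2) by (simp add: power_mult_distrib)
    then have "sqrt 3 * x = 1" using that(1) by (subst (asm) power2_eq_iff_nonneg) auto
    then show ?thesis by (simp add: eq_divide_eq mult.commute)
  qed
  show "{l \<in> Delta. l$1 = l$2 \<and> l$2 = l$3} = {vertex_p}"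
  proof (intro equalityI subsetI)
    fix l assume "l \<in> {l \<in> Delta. l$1 = l$2 \<and> l$2 = l$3}"
    then have l: "l \<in> Delta" "l$2 = l$1" "l$3 = l$1" by auto
    then have "l$1 = 1 / sqrt 3" using root[OF Delta_pos[OF l(1)]] by (simp add: Delta_def)
    then show "l \<in> {vertex_p}" using l by (simp add: vertex_p_def vec_eq_iff forall_3)
  qed (use vertex_p_Delta in \<open>auto simp: vertex_p_def\<close>)
  show "{l \<in> Delta. l$1 = l$2 \<and> l$2 = - l$3} = {vertex_q}"
  proof (intro equalityI subsetI)
    fix l assume "l \<in> {l \<in> Delta. l$1 = l$2 \<and> l$2 = - l$3}"
    then have l: "l \<in> Delta" "l$2 = l$1" "l$3 = - l$1" by auto
    then have "l$1 = 1 / sqrt 3" using root[OF Delta_pos[OF l(1)]] by (simp add: Delta_def)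
    then show "l \<in> {vertex_q}" using l by (simp add: vertex_q_def vec_eq_iff forall_3)
  qed (use vertex_q_Delta in \<open>auto simp: vertex_q_def\<close>)
  show "{l \<in> Delta. l$2 = 0 \<and> l$3 = 0} = {vertex_r}"
  proof (intro equalityI subsetI)
    fix l assume "l \<in> {l \<in> Delta. l$2 = 0 \<and> l$3 = 0}"
    then have l: "l \<in> Delta" "l$2 = 0" "l$3 = 0" by auto
    then have "l$1 = 1" using Delta_pos[OF l(1)] by (simp add: Delta_def power2_eq_1_iff)
    then show "l \<in> {vertex_r}" using l by (simp add: vertex_r_def vec_eq_iff forall_3)
  qed (use vertex_r_Delta in \<open>auto simp: vertex_r_def\<close>)
qed

lemma orbit_type_open_triangle:
  assumes "l \<in> open_spherical_face {vertex_p, vertex_q, vertex_r}"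
  shows "conjugate_in_SO6 (stabilizer (normal_form l)) T3 \<and> homogeneous_diffeo (orbit (normal_form l)) T3"
proof -
  obtain a b c where l: "l \<in> Delta" "l = a *\<^sub>R vertex_p + b *\<^sub>R vertex_q + c *\<^sub>R vertex_r"
    and pos: "a > 0" "b > 0" "c > 0"
    using open_spherical_face_coordinates[OF subset_refl assms] by auto
  have "l$2 < l$1" "\<bar>l$3\<bar> < l$2"
    unfolding l(2) vertex_combination using pos
    by (simp_all add: abs_less_iff divide_strict_right_mono minus_divide_left)
  then show ?thesis using orbit_type_interior[OF l(1)] by blast
qed

lemma orbit_type_open_edge:
  assumes W: "W \<subseteq> {vertex_p, vertex_q, vertex_r}" "card W = 2" and l: "l \<in> open_spherical_face W"
  shows "conjugate_in_SO6 (stabilizer (normal_form l)) U2_SO2 \<and>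
    homogeneous_diffeo (orbit (normal_form l)) U2_SO2"
proof -
  obtain a b c where l: "l \<in> Delta" "l = a *\<^sub>R vertex_p + b *\<^sub>R vertex_q + c *\<^sub>R vertex_r"
    and pos: "if vertex_p \<in> W then a > 0 else a = 0" "if vertex_q \<in> W then b > 0 else b = 0"
      "if vertex_r \<in> W then c > 0 else c = 0"
    using open_spherical_face_coordinates[OF W(1) l] by blast
  note coords = vertex_combination[of a b c, folded l(2)]
  consider "W = {vertex_p, vertex_q}" | "W = {vertex_p, vertex_r}" | "W = {vertex_q, vertex_r}"
  proof -
    obtain x y where "W = {x, y}" "x \<noteq> y" using W(2) by (metis card_2_iff)
    then show ?thesis using W(1) that by auto
  qed
  then show ?thesis
  proof cases
    case 1
    then have "a > 0" "b > 0" "c = 0" using pos vertices_distinct by auto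
    then have "l$1 = l$2" "\<bar>l$3\<bar> < l$2"
      unfolding coords by (simp_all add: abs_less_iff divide_strict_right_mono minus_divide_left)
    then show ?thesis using orbit_type_edge_12[OF l(1)] by blast
  next
    case 2
    then have "a > 0" "b = 0" "c > 0" using pos vertices_distinct by auto
    then have "l$2 < l$1" "l$2 = \<bar>l$3\<bar>" "l$3 \<noteq> 0"
      unfolding coords by simp_all
    then show ?thesis using orbit_type_edge_23[OF l(1)] by blast
  next
    case 3
    then have "a = 0" "b > 0" "c > 0" using pos vertices_distinct by auto
    then have "l$2 < l$1" "l$2 = \<bar>l$3\<bar>" "l$3 \<noteq> 0"
      unfolding coords by simp_all
    then show ?thesis using orbit_type_edge_23[OF l(1)] by blast
  qed
qed

lemma Pfaffian_orbit: "B \<in> orbit (normal_form l) \<Longrightarrow> Pfaffian B = l$1 * l$2 * l$3"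
  by (auto simp: orbit_def Pfaffian_act Pfaffian_normal_form SO_iff)

theorem proposition18p1:
  shows "(\<forall>B\<in>unit_bivectors. \<exists>l\<in>Delta. \<exists>g\<in>SO. act g B = normal_form l) \<and>
    dim bivectors = 15 \<and>
    homeomorphic_map (top_of_set Delta) (quotient_topology (top_of_set unit_bivectors) orbit)
      (\<lambda>l. orbit (normal_form l)) \<and>
    (\<exists>p q r.
      spherical_triangle {p, q, r} Delta \<and>
      {l \<in> Delta. l$1 = l$2 \<and> l$2 = l$3} = {p} \<and>
      {l \<in> Delta. l$1 = l$2 \<and> l$2 = - l$3} = {q} \<and>
      {l \<in> Delta. l$2 = 0 \<and> l$3 = 0} = {r} \<and>
      (\<forall>l \<in> open_spherical_face {p, q, r}.
         conjugate_in_SO6 (stabilizer (normal_form l)) T3 \<and>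
         homogeneous_diffeo (orbit (normal_form l)) T3) \<and>
      (\<forall>W. W \<subseteq> {p, q, r} \<and> card W = 2 \<longrightarrow>
         (\<forall>l \<in> open_spherical_face W.
            conjugate_in_SO6 (stabilizer (normal_form l)) U2_SO2 \<and>
            homogeneous_diffeo (orbit (normal_form l)) U2_SO2)) \<and>
      (\<forall>l \<in> {p, q}.
         conjugate_in_SO6 (stabilizer (normal_form l)) U3 \<and>
         homogeneous_diffeo (orbit (normal_form l)) U3 \<and>
         diffeo_CP3 (orbit (normal_form l))) \<and>
      conjugate_in_SO6 (stabilizer (normal_form r)) SO2_SO4 \<and>
      homogeneous_diffeo (orbit (normal_form r)) SO2_SO4 \<and>
      diffeo_Gr2 (orbit (normal_form r)) \<and>
      orbit (normal_form p) \<noteq> orbit (normal_form q) \<and>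
      (\<forall>B \<in> orbit (normal_form p). Pfaffian B > 0) \<and>
      (\<forall>B \<in> orbit (normal_form q). Pfaffian B < 0))"
proof -
  let ?V = "{vertex_p, vertex_q, vertex_r}"
  have exists: "\<forall>B\<in>unit_bivectors. \<exists>l\<in>Delta. \<exists>g\<in>SO. act g B = normal_form l"
    using normal_form_exists by blast
  have interior: "\<forall>l \<in> open_spherical_face ?V.
      conjugate_in_SO6 (stabilizer (normal_form l)) T3 \<and> homogeneous_diffeo (orbit (normal_form l)) T3"
    using orbit_type_open_triangle by blast
  have edges: "\<forall>W. W \<subseteq> ?V \<and> card W = 2 \<longrightarrow> (\<forall>l \<in> open_spherical_face W.
      conjugate_in_SO6 (stabilizer (normal_form l)) U2_SO2 \<and>
      homogeneous_diffeo (orbit (normal_form l)) U2_SO2)"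
    using orbit_type_open_edge by blast
  have U3: "\<forall>l \<in> {vertex_p, vertex_q}. conjugate_in_SO6 (stabilizer (normal_form l)) U3 \<and>
      homogeneous_diffeo (orbit (normal_form l)) U3 \<and> diffeo_CP3 (orbit (normal_form l))"
  proof
    fix l assume l: "l \<in> {vertex_p, vertex_q}"
    then have "l \<in> Delta" "l$1 = l$2" "l$2 = \<bar>l$3\<bar>"
      using vertex_p_Delta vertex_q_Delta by (auto simp: vertex_p_def vertex_q_def)
    moreover have "diffeo_CP3 (orbit (normal_form l))"
      using l diffeo_CP3_vertex_p diffeo_CP3_vertex_q by blast
    ultimately show "conjugate_in_SO6 (stabilizer (normal_form l)) U3 \<and>
        homogeneous_diffeo (orbit (normal_form l)) U3 \<and> diffeo_CP3 (orbit (normal_form l))"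
      using orbit_type_U3 by blast
  qed
  have r: "conjugate_in_SO6 (stabilizer (normal_form vertex_r)) SO2_SO4"
    "homogeneous_diffeo (orbit (normal_form vertex_r)) SO2_SO4"
    using orbit_type_rank_two[OF vertex_r_Delta] by (simp_all add: vertex_r_def)
  have Pf: "\<forall>B \<in> orbit (normal_form vertex_p). Pfaffian B > 0"
    "\<forall>B \<in> orbit (normal_form vertex_q). Pfaffian B < 0"
    by (simp_all add: Pfaffian_orbit vertex_p_def vertex_q_def)
  then have "orbit (normal_form vertex_p) \<noteq> orbit (normal_form vertex_q)"
    using orbit_refl by fastforce
  note facts = exists dim_bivectors orbit_space_homeomorphic Delta_spherical_triangle Delta_vertex_sets
    interior edges U3 r diffeo_Gr2_vertex_r this Pf
  show ?thesis
    by (intro conjI; (rule exI[of _ vertex_p], rule exI[of _ vertex_q], rule exI[of _ vertex_r],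
          intro conjI)?; rule facts)
qed

end
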